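(* Let $0<\alpha,\beta<\infty$, let $\varphi:D\to D$ be an analytic self-map of $D$, let $g\in H(D)$, and suppose that the operator $V_gC_\varphi:\mathcal{Z}^\alpha\to\mathcal{Z}^\beta$, $(V_gC_\varphi f)(z)=\int_0^z f'(\varphi(\xi))g(\xi)\,d\xi$, is bounded. (i) If $0<\alpha<1$, then $$\|V_gC_\varphi\|_{e,\mathcal{Z}^\alpha\to\mathcal{Z}^\beta}\asymp\limsup_{n\to\infty}(n+1)^\alpha\|g\varphi'\varphi^n\|_{v_\beta}.$$ (ii) If $\alpha=1$, then $$\|V_gC_\varphi\|_{e,\mathcal{Z}^1\to\mathcal{Z}^\beta}\asymp\max\Big\{\limsup_{n\to\infty}(n+1)\|g\varphi'\varphi^n\|_{v_\beta},\ \limsup_{n\to\infty}(\log n)\|g'\varphi^n\|_{v_\beta}\Big\}.$$ (iii) If $\alpha>1$, then $$\|V_gC_\varphi\|_{e,\mathcal{Z}^\alpha\to\mathcal{Z}^\beta}\asymp\max\Big\{\limsup_{n\to\infty}(n+1)^\alpha\|g\varphi'\varphi^n\|_{v_\beta},\ \limsup_{n\to\infty}(n+1)^{\alpha-1}\|g'\varphi^n\|_{v_\beta}\Big\}.$$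
   Context: $D=\{z\in\mathbb{C}:|z|<1\}$ and $H(D)$ is the set of analytic functions on $D$. For $0<\alpha<\infty$, the Zygmund type space $\mathcal{Z}^\alpha$ is the Banach space of $f\in H(D)$ with $\sup_{z\in D}(1-|z|^2)^\alpha|f''(z)|<\infty$, normed by $\|f\|_{\mathcal{Z}^\alpha}=|f(0)|+|f'(0)|+\sup_{z\in D}(1-|z|^2)^\alpha|f''(z)|$. For $0<\beta<\infty$, $v_\beta(z)=(1-|z|^2)^\beta$ and $\|h\|_{v_\beta}=\sup_{z\in D}v_\beta(z)|h(z)|$ for $h\in H(D)$. $\varphi^n$ denotes the $n$-th power (pointwise product) of $\varphi$. The essential norm of a bounded linear operator $T:X\to Y$ is $\|T\|_{e,X\to Y}=\inf\{\|T+K\|_{X\to Y}: K:X\to Y\text{ compact}\}$. $A\asymp B$ means that there are positive constants $C_1,C_2$ with $C_1A\le B\le C_2A$ (constants not depending on $g$ or $\varphi$). *)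

theory Defs
  imports "HOL-Complex_Analysis.Complex_Analysis"
begin

abbreviation unit_disc :: "complex set" ("\<D>") where
  "\<D> \<equiv> ball 0 1"

text \<open>Functions on the disc are represented by total functions that vanish outside it,
  so that equality of elements of \<^term>\<open>H_disc\<close> is equality of functions on the disc.\<close>

definition H_disc :: "(complex \<Rightarrow> complex) set" where
  "H_disc = {f. f holomorphic_on \<D> \<and> (\<forall>z. z \<notin> \<D> \<longrightarrow> f z = 0)}"

text \<open>The weighted supremum norm is extended-valued: it is \<open>\<infinity>\<close> when the supremum does not exist
  in the reals.\<close>

definition weighted_norm :: "real \<Rightarrow> (complex \<Rightarrow> complex) \<Rightarrow> ennreal" where
  "weighted_norm b h = (SUP z\<in>\<D>. ennreal ((1 - (cmod z)\<^sup>2) powr b * cmod (h z)))"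

definition zygmund :: "real \<Rightarrow> (complex \<Rightarrow> complex) set" where
  "zygmund a = {f \<in> H_disc. weighted_norm a ((deriv ^^ 2) f) < \<infinity>}"

definition zygmund_norm :: "real \<Rightarrow> (complex \<Rightarrow> complex) \<Rightarrow> real" where
  "zygmund_norm a f =
     cmod (f 0) + cmod (deriv f 0) + enn2real (weighted_norm a ((deriv ^^ 2) f))"

text \<open>Operators between normed spaces of complex-valued functions, each given by a carrier and a
  norm: \<open>(X, nX)\<close> is the domain and \<open>(Y, nY)\<close> the codomain.\<close>

definition linear_op :: "('a \<Rightarrow> complex) set \<Rightarrow> ('b \<Rightarrow> complex) set \<Rightarrow>
    (('a \<Rightarrow> complex) \<Rightarrow> ('b \<Rightarrow> complex)) \<Rightarrow> bool" where
  "linear_op X Y T \<longleftrightarrow> T ` X \<subseteq> Y \<and>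
     (\<forall>f\<in>X. \<forall>h\<in>X. T (\<lambda>z. f z + h z) = (\<lambda>z. T f z + T h z)) \<and>
     (\<forall>f\<in>X. \<forall>c. T (\<lambda>z. c * f z) = (\<lambda>z. c * T f z))"

definition bounded_op :: "('a \<Rightarrow> complex) set \<Rightarrow> (('a \<Rightarrow> complex) \<Rightarrow> real) \<Rightarrow>
    ('b \<Rightarrow> complex) set \<Rightarrow> (('b \<Rightarrow> complex) \<Rightarrow> real) \<Rightarrow>
    (('a \<Rightarrow> complex) \<Rightarrow> ('b \<Rightarrow> complex)) \<Rightarrow> bool" where
  "bounded_op X nX Y nY T \<longleftrightarrow> linear_op X Y T \<and> (\<exists>C. \<forall>f\<in>X. nY (T f) \<le> C * nX f)"

text \<open>The locale \<^locale>\<open>Metric_space\<close> wants nonnegativity and symmetry of the metric on the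
  whole type, hence the irrelevant value \<open>0\<close> off the carrier.\<close>

definition norm_topology ::
    "('a \<Rightarrow> complex) set \<Rightarrow> (('a \<Rightarrow> complex) \<Rightarrow> real) \<Rightarrow> ('a \<Rightarrow> complex) topology" where
  "norm_topology Y nY = Metric_space.mtopology Y (\<lambda>f h.
     if f \<in> Y \<and> h \<in> Y then nY (\<lambda>z. f z - h z) else 0)"

definition compact_op :: "('a \<Rightarrow> complex) set \<Rightarrow> (('a \<Rightarrow> complex) \<Rightarrow> real) \<Rightarrow>
    ('b \<Rightarrow> complex) set \<Rightarrow> (('b \<Rightarrow> complex) \<Rightarrow> real) \<Rightarrow>
    (('a \<Rightarrow> complex) \<Rightarrow> ('b \<Rightarrow> complex)) \<Rightarrow> bool" where
  "compact_op X nX Y nY K \<longleftrightarrow> linear_op X Y K \<and>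
     compactin (norm_topology Y nY) (norm_topology Y nY closure_of (K ` {f \<in> X. nX f \<le> 1}))"

definition op_norm :: "('a \<Rightarrow> complex) set \<Rightarrow> (('a \<Rightarrow> complex) \<Rightarrow> real) \<Rightarrow>
    (('b \<Rightarrow> complex) \<Rightarrow> real) \<Rightarrow> (('a \<Rightarrow> complex) \<Rightarrow> ('b \<Rightarrow> complex)) \<Rightarrow> ennreal" where
  "op_norm X nX nY T = (SUP f\<in>{f \<in> X. nX f \<le> 1}. ennreal (nY (T f)))"

definition essential_norm :: "('a \<Rightarrow> complex) set \<Rightarrow> (('a \<Rightarrow> complex) \<Rightarrow> real) \<Rightarrow>
    ('b \<Rightarrow> complex) set \<Rightarrow> (('b \<Rightarrow> complex) \<Rightarrow> real) \<Rightarrow>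
    (('a \<Rightarrow> complex) \<Rightarrow> ('b \<Rightarrow> complex)) \<Rightarrow> ennreal" where
  "essential_norm X nX Y nY T =
     (INF K\<in>{K. compact_op X nX Y nY K}. op_norm X nX nY (\<lambda>f z. T f z + K f z))"

text \<open>The path from \<open>0\<close> to \<open>z\<close> is immaterial for holomorphic \<open>g\<close> and \<open>\<phi>\<close>; the segment is used.\<close>

definition VC :: "(complex \<Rightarrow> complex) \<Rightarrow> (complex \<Rightarrow> complex) \<Rightarrow>
    (complex \<Rightarrow> complex) \<Rightarrow> complex \<Rightarrow> complex" where
  "VC g \<phi> f z =
     (if z \<in> \<D> then contour_integral (linepath 0 z) (\<lambda>\<xi>. deriv f (\<phi> \<xi>) * g \<xi>) else 0)"

definition VC_bounded_symbols ::
    "real \<Rightarrow> real \<Rightarrow> ((complex \<Rightarrow> complex) \<times> (complex \<Rightarrow> complex)) set" where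
  "VC_bounded_symbols a b = {(g, \<phi>). g holomorphic_on \<D> \<and> \<phi> holomorphic_on \<D> \<and> \<phi> ` \<D> \<subseteq> \<D> \<and>
     bounded_op (zygmund a) (zygmund_norm a) (zygmund b) (zygmund_norm b) (VC g \<phi>)}"

definition VC_essential_norm ::
    "real \<Rightarrow> real \<Rightarrow> (complex \<Rightarrow> complex) \<Rightarrow> (complex \<Rightarrow> complex) \<Rightarrow> ennreal" where
  "VC_essential_norm a b g \<phi> =
     essential_norm (zygmund a) (zygmund_norm a) (zygmund b) (zygmund_norm b) (VC g \<phi>)"

text \<open>\<open>A \<asymp> B\<close>, with constants that are uniform over the parameters in \<open>P\<close>.\<close>

definition comparable_on :: "'p set \<Rightarrow> ('p \<Rightarrow> ennreal) \<Rightarrow> ('p \<Rightarrow> ennreal) \<Rightarrow> bool" where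
  "comparable_on P A B \<longleftrightarrow> (\<exists>C1>0. \<exists>C2>0. \<forall>p\<in>P.
     ennreal C1 * A p \<le> B p \<and> B p \<le> ennreal C2 * A p)"

end

theory Submission
  imports Defs
begin

text \<open>
  Put \<open>u = g \<phi>'\<close> and \<open>w = g'\<close>. The operator \<open>T = V\<^sub>g C\<^sub>\<phi>\<close> satisfies
  \<open>(T f)'' = (f'' \<circ> \<phi>) u + (f' \<circ> \<phi>) w\<close>, so up to one point evaluation the norm of \<open>T f\<close> is
  the weighted supremum of this combination. A function in the unit ball of the domain has
  \<open>\<bar>f''(\<zeta>)\<bar> \<le> (1 - \<bar>\<zeta>\<bar>\<^sup>2)\<^bsup>-\<alpha>\<^esup>\<close>, and integration along radii shows that \<open>f'\<close> grows at most like a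
  constant, like \<open>log (1 / (1 - \<bar>\<zeta>\<bar>))\<close> or like \<open>(1 - \<bar>\<zeta>\<bar>)\<^bsup>1-\<alpha>\<^esup>\<close> for \<open>\<alpha> < 1\<close>, \<open>\<alpha> = 1\<close> and
  \<open>\<alpha> > 1\<close>. Since \<open>n\<^bsup>c\<^esup> x\<^bsup>n\<^esup>\<close> is largest for \<open>n\<close> of size \<open>1 / (1 - x)\<close>, where it is comparable to
  \<open>(1 - x)\<^bsup>-c\<^esup>\<close>, the upper limits in the theorem measure, up to constants, how \<open>u\<close> and \<open>w\<close>, weighted by the
  growth rates of \<open>f''\<close> and \<open>f'\<close>, behave at the points where \<open>\<bar>\<phi>\<bar>\<close> is close to \<open>1\<close>.

  Upper bounds. Let \<open>(L f)'\<close> be a Taylor polynomial of the dilation \<open>f'(\<rho> z)\<close>. The operators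
  \<open>T \<circ> L\<close> have finite rank, hence are compact. By \<open>dilated_taylor_approximation\<close>, the second
  derivative of \<open>f - L f\<close>, and hence the first, is small on a given compact disc, uniformly over the
  unit ball, and it obeys the same growth estimate as \<open>f''\<close> up to a factor. So only
  the points with \<open>\<bar>\<phi>(z)\<bar>\<close> near \<open>1\<close> contribute to the norm of \<open>T - T \<circ> L\<close>
  (\<open>essential_norm_upper\<close>). For \<open>\<alpha> < 1\<close> the derivative of \<open>f - L f\<close> is small on the whole disc,
  and therefore \<open>w\<close> is absent from the result.

  Lower bounds. A compact \<open>K\<close> is not assumed to respect locally uniform convergence, so
  \<open>K f\<^sub>n \<rightarrow> 0\<close> is not automatic for a bounded sequence that tends to \<open>0\<close> locally uniformly. It does hold
  if each \<open>f\<^sub>n''\<close> is also bounded on the disc (\<open>compact_op_vanishing_sequence\<close>): a gliding hump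
  argument gives sums of arbitrarily many \<open>f\<^sub>n\<close> whose norms are bounded up to an
  arbitrarily small multiple of their number, which is incompatible with
  a nonzero limit point of \<open>K f\<^sub>n\<close>. The essential norm thus dominates \<open>\<parallel>T f\<^sub>n\<parallel>\<close> asymptotically.
  For \<open>f\<^sub>k' = k\<^bsup>\<alpha>-1\<^esup> z\<^bsup>k\<^esup>\<close>, comparing \<open>k\<close> with \<open>2 k\<close> separates the contribution of \<open>u\<close> from that of \<open>w\<close>
  (\<open>separate_power_terms\<close>); this settles \<open>\<alpha> \<noteq> 1\<close> and the \<open>u\<close> part for \<open>\<alpha> = 1\<close>. The remaining
  logarithmic term is detected by squares of partial sums of the logarithmic series
  (\<open>essential_norm_lower_log\<close>).
\<close>

section \<open>Normed spaces of functions and compact operators\<close>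

locale normed_function_space =
  fixes X :: "('a \<Rightarrow> complex) set" and nX :: "('a \<Rightarrow> complex) \<Rightarrow> real"
  assumes zero_mem: "(\<lambda>_. 0) \<in> X"
    and add_mem: "f \<in> X \<Longrightarrow> h \<in> X \<Longrightarrow> (\<lambda>z. f z + h z) \<in> X"
    and scale_mem: "f \<in> X \<Longrightarrow> (\<lambda>z. c * f z) \<in> X"
    and norm_add: "f \<in> X \<Longrightarrow> h \<in> X \<Longrightarrow> nX (\<lambda>z. f z + h z) \<le> nX f + nX h"
    and norm_scale: "f \<in> X \<Longrightarrow> nX (\<lambda>z. c * f z) = cmod c * nX f"
    and norm_eq_0: "f \<in> X \<Longrightarrow> nX f = 0 \<Longrightarrow> f = (\<lambda>_. 0)"
begin

lemma norm_zero: "nX (\<lambda>_. 0) = 0"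
  using norm_scale[OF zero_mem, of 0] by simp

lemma minus_mem: "f \<in> X \<Longrightarrow> (\<lambda>z. - f z) \<in> X"
  using scale_mem[of f "-1"] by simp

lemma norm_minus: "f \<in> X \<Longrightarrow> nX (\<lambda>z. - f z) = nX f"
  using norm_scale[of f "-1"] by simp

lemma norm_nonneg: "f \<in> X \<Longrightarrow> 0 \<le> nX f"
  using norm_add[OF _ minus_mem, of f f] by (simp add: norm_minus norm_zero)

lemma diff_mem: "f \<in> X \<Longrightarrow> h \<in> X \<Longrightarrow> (\<lambda>z. f z - h z) \<in> X"
  using add_mem[OF _ minus_mem, of f h] by simp

lemma norm_diff_commute:
  "f \<in> X \<Longrightarrow> h \<in> X \<Longrightarrow> nX (\<lambda>z. f z - h z) = nX (\<lambda>z. h z - f z)"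
  using norm_minus[OF diff_mem, of h f] by simp

lemma norm_le_diff:
  assumes "f \<in> X" "h \<in> X"
  shows "nX f \<le> nX h + nX (\<lambda>z. f z - h z)"
  using norm_add[OF assms(2) diff_mem[OF assms]] by simp

lemma sum_mem: "(\<And>i. i \<in> I \<Longrightarrow> f i \<in> X) \<Longrightarrow> (\<lambda>z. \<Sum>i\<in>I. f i z) \<in> X"
proof (induction I rule: infinite_finite_induct)
  case (insert i I)
  then show ?case using add_mem[of "f i" "\<lambda>z. \<Sum>i\<in>I. f i z"] by simp
qed (simp_all add: zero_mem)

lemma norm_sum:
  "(\<And>i. i \<in> I \<Longrightarrow> f i \<in> X) \<Longrightarrow> nX (\<lambda>z. \<Sum>i\<in>I. f i z) \<le> (\<Sum>i\<in>I. nX (f i))"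
proof (induction I rule: infinite_finite_induct)
  case (insert i I)
  then show ?case using norm_add[of "f i" "\<lambda>z. \<Sum>i\<in>I. f i z"] sum_mem[of I f] by fastforce
qed (simp_all add: norm_zero)

abbreviation dist_X :: "('a \<Rightarrow> complex) \<Rightarrow> ('a \<Rightarrow> complex) \<Rightarrow> real" where
  "dist_X f h \<equiv> if f \<in> X \<and> h \<in> X then nX (\<lambda>z. f z - h z) else 0"

sublocale metric: Metric_space X dist_X
proof
  fix f h k
  show "0 \<le> dist_X f h" by (simp add: norm_nonneg diff_mem)
  show "dist_X f h = dist_X h f" using norm_diff_commute[of f h] by auto
  show "dist_X f h = 0 \<longleftrightarrow> f = h" if "f \<in> X" "h \<in> X"
    using norm_eq_0[OF diff_mem[OF that]] that by (auto simp: norm_zero fun_eq_iff)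
  show "dist_X f k \<le> dist_X f h + dist_X h k" if "f \<in> X" "h \<in> X" "k \<in> X"
    using norm_add[OF diff_mem diff_mem, of f h h k] that by simp
qed

lemma norm_topology_eq: "norm_topology X nX = metric.mtopology"
  by (simp add: norm_topology_def)

lemma limitin_norm:
  assumes "\<And>n. f n \<in> X" "l \<in> X"
  shows "limitin metric.mtopology f l sequentially \<longleftrightarrow> (\<lambda>n. nX (\<lambda>z. f n z - l z)) \<longlonglongrightarrow> 0"
  using assms by (simp add: metric.limitin_metric_dist_null)

text \<open>Adding one direction with a bounded coefficient keeps compactness, by extracting convergent
  subsequences first of the coefficients and then of the remainders.\<close>

lemma compactin_add_direction:
  assumes S: "compactin metric.mtopology S" and h: "h \<in> X"
  shows "compactin metric.mtopology {\<lambda>z. f z + c * h z |f c. f \<in> S \<and> cmod c \<le> M}"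
    (is "compactin _ ?S'")
  unfolding metric.compactin_sequentially
proof (intro conjI allI impI)
  have SX: "S \<subseteq> X" using S unfolding metric.compactin_sequentially by blast
  show "?S' \<subseteq> X" using SX by (auto intro!: add_mem scale_mem h)
  fix \<sigma> :: "nat \<Rightarrow> 'a \<Rightarrow> complex" assume "range \<sigma> \<subseteq> ?S'"
  then have "\<forall>n. \<exists>f c. f \<in> S \<and> cmod c \<le> M \<and> \<sigma> n = (\<lambda>z. f z + c * h z)" by blast
  then obtain f c where fc: "\<And>n. f n \<in> S" "\<And>n. cmod (c n) \<le> M"
    "\<And>n. \<sigma> n = (\<lambda>z. f n z + c n * h z)" by metis
  have "compact (cball (0::complex) M)" by simp
  moreover have "\<forall>n. c n \<in> cball 0 M" using fc(2) by simp
  ultimately obtain c' r where c': "c' \<in> cball 0 M" "strict_mono r" "(c \<circ> r) \<longlonglongrightarrow> c'"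
    unfolding compact_def by metis
  have "range (f \<circ> r) \<subseteq> S" using fc(1) by auto
  then obtain f' s where f': "f' \<in> S" "strict_mono s"
    "limitin metric.mtopology ((f \<circ> r) \<circ> s) f' sequentially"
    using S unfolding metric.compactin_sequentially by blast
  let ?l = "\<lambda>z. f' z + c' * h z"
  have memS: "f (r (s n)) \<in> X" "f' \<in> X" for n using fc(1) f'(1) SX by auto
  have lim1: "(\<lambda>n. nX (\<lambda>z. f (r (s n)) z - f' z)) \<longlonglongrightarrow> 0"
    using f'(3) limitin_norm[of "f \<circ> r \<circ> s" f'] memS by simp
  have "(\<lambda>n. c (r (s n))) \<longlonglongrightarrow> c'"
    using LIMSEQ_subseq_LIMSEQ[OF c'(3) f'(2)] by (simp add: o_def)
  then have "(\<lambda>n. cmod (c (r (s n)) - c')) \<longlonglongrightarrow> 0"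
    by (simp add: tendsto_norm_zero LIM_zero)
  from tendsto_add[OF lim1 tendsto_mult_left_zero[OF this, of "nX h"]]
  have lim2: "(\<lambda>n. nX (\<lambda>z. f (r (s n)) z - f' z) + cmod (c (r (s n)) - c') * nX h) \<longlonglongrightarrow> 0"
    by simp
  have le: "nX (\<lambda>z. \<sigma> (r (s n)) z - ?l z)
      \<le> nX (\<lambda>z. f (r (s n)) z - f' z) + cmod (c (r (s n)) - c') * nX h" for n
  proof -
    have "(\<lambda>z. \<sigma> (r (s n)) z - ?l z)
        = (\<lambda>z. (f (r (s n)) z - f' z) + (c (r (s n)) - c') * h z)"
      by (simp add: fc(3) algebra_simps)
    then show ?thesis
      using norm_add[OF diff_mem[OF memS] scale_mem[OF h], of n "c (r (s n)) - c'"]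
      by (simp only: norm_scale[OF h])
  qed
  have lX: "?l \<in> X" "\<sigma> (r (s n)) \<in> X" for n
    using memS by (auto simp: fc(3) intro!: add_mem scale_mem h)
  have "(\<lambda>n. nX (\<lambda>z. \<sigma> (r (s n)) z - ?l z)) \<longlonglongrightarrow> 0"
    by (rule tendsto_sandwich[OF _ _ tendsto_const lim2])
      (intro always_eventually allI norm_nonneg diff_mem lX le)+
  then have "limitin metric.mtopology (\<sigma> \<circ> (r \<circ> s)) ?l sequentially"
    using limitin_norm[of "\<sigma> \<circ> (r \<circ> s)" ?l] lX by simp
  moreover have "?l \<in> ?S'" using f'(1) c'(1) by auto
  ultimately show "\<exists>l r. l \<in> ?S' \<and> strict_mono r \<and> limitin metric.mtopology (\<sigma> \<circ> r) l sequentially"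
    using strict_mono_o[OF c'(2) f'(2)] by blast
qed

text \<open>Bounded coefficient vectors form a compact set, so their image under a linear map is compact;
  the induction adds one coefficient at a time.\<close>

lemma compactin_bounded_combinations:
  fixes N :: nat
  assumes "\<And>n. n < N \<Longrightarrow> h n \<in> X"
  shows "compactin metric.mtopology {\<lambda>z. \<Sum>n<N. c n * h n z |c. \<forall>n<N. cmod (c n) \<le> M n}"
  using assms
proof (induction N)
  case 0
  show ?case using zero_mem by simp
next
  case (Suc N)
  let ?S = "\<lambda>N. {\<lambda>z. \<Sum>n<N. c n * h n z |c. \<forall>n<N. cmod (c n) \<le> M n}"
  have "?S (Suc N) = {\<lambda>z. f z + c * h N z |f c. f \<in> ?S N \<and> cmod c \<le> M N}" (is "_ = ?R")
  proof (intro equalityI subsetI)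
    fix F assume "F \<in> ?S (Suc N)"
    then obtain c where c: "F = (\<lambda>z. \<Sum>n<Suc N. c n * h n z)" "\<forall>n<Suc N. cmod (c n) \<le> M n" by auto
    have "F = (\<lambda>z. (\<Sum>n<N. c n * h n z) + c N * h N z)" using c(1) by simp
    moreover have "(\<lambda>z. \<Sum>n<N. c n * h n z) \<in> ?S N"
      using c(2) by (intro CollectI exI[of _ c]) simp
    ultimately show "F \<in> ?R"
      using c(2) by (intro CollectI exI[of _ "\<lambda>z. \<Sum>n<N. c n * h n z"] exI[of _ "c N"]) simp
  next
    fix F assume "F \<in> ?R"
    then obtain f c d where f: "F = (\<lambda>z. f z + d * h N z)" and d: "cmod d \<le> M N"
      and c: "f = (\<lambda>z. \<Sum>n<N. c n * h n z)" "\<forall>n<N. cmod (c n) \<le> M n"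
      by (elim CollectE exE conjE) (rule that)
    have "F = (\<lambda>z. \<Sum>n<Suc N. (c(N := d)) n * h n z)" unfolding f c(1) by (auto intro!: sum.cong)
    moreover have "\<forall>n<Suc N. cmod ((c(N := d)) n) \<le> M n" using c(2) d by (auto simp: less_Suc_eq)
    ultimately show "F \<in> ?S (Suc N)" by (intro CollectI exI[of _ "c(N := d)"]) simp
  qed
  moreover have "compactin metric.mtopology (?S N)" using Suc by simp
  ultimately show ?case using compactin_add_direction[of "?S N" "h N"] Suc.prems by simp
qed

end

lemma linear_opD:
  assumes "linear_op X Y T"
  shows "f \<in> X \<Longrightarrow> T f \<in> Y"
    and "f \<in> X \<Longrightarrow> h \<in> X \<Longrightarrow> T (\<lambda>z. f z + h z) = (\<lambda>z. T f z + T h z)"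
    and "f \<in> X \<Longrightarrow> T (\<lambda>z. c * f z) = (\<lambda>z. c * T f z)"
  using assms by (auto simp: linear_op_def)

locale function_operator = dom: normed_function_space X nX + cod: normed_function_space Y nY
  for X :: "('a \<Rightarrow> complex) set" and nX and Y :: "('b \<Rightarrow> complex) set" and nY +
  fixes T :: "('a \<Rightarrow> complex) \<Rightarrow> ('b \<Rightarrow> complex)"
  assumes lin: "linear_op X Y T"
begin

lemmas op_mem = linear_opD(1)[OF lin]
  and op_add = linear_opD(2)[OF lin]
  and op_scale = linear_opD(3)[OF lin]

lemma op_zero: "T (\<lambda>_. 0) = (\<lambda>_. 0)"
  using op_scale[OF dom.zero_mem, of 0] by simp

lemma op_diff: "f \<in> X \<Longrightarrow> h \<in> X \<Longrightarrow> T (\<lambda>z. f z - h z) = (\<lambda>z. T f z - T h z)"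
  using op_add[OF _ dom.minus_mem, of f h] op_scale[of h "-1"] by simp

lemma op_sum: "(\<And>i. i \<in> I \<Longrightarrow> f i \<in> X) \<Longrightarrow> T (\<lambda>z. \<Sum>i\<in>I. f i z) = (\<lambda>z. \<Sum>i\<in>I. T (f i) z)"
proof (induction I rule: infinite_finite_induct)
  case (insert i I)
  then show ?case using op_add[of "f i" "\<lambda>z. \<Sum>i\<in>I. f i z"] dom.sum_mem[of I f] by simp
qed (simp_all add: op_zero)

text \<open>Rescaling to the unit ball. Elements of norm \<open>0\<close>, which cannot be rescaled, are \<open>0\<close>.\<close>

lemma op_norm_bound:
  assumes bd: "\<And>f. f \<in> X \<Longrightarrow> nX f \<le> 1 \<Longrightarrow> nY (T f) \<le> B" and f: "f \<in> X"
  shows "nY (T f) \<le> B * nX f"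
proof (cases "nX f = 0")
  case True
  then have "f = (\<lambda>_. 0)" by (rule dom.norm_eq_0[OF f])
  then show ?thesis by (simp add: op_zero cod.norm_zero dom.norm_zero)
next
  case False
  then have pos: "nX f > 0" using dom.norm_nonneg[OF f] by simp
  let ?c = "complex_of_real (1 / nX f)"
  have "nY (T (\<lambda>z. ?c * f z)) \<le> B"
    using pos by (intro bd dom.scale_mem f) (simp only: dom.norm_scale[OF f] norm_of_real, simp)
  moreover have "nY (T (\<lambda>z. ?c * f z)) = nY (T f) / nX f"
    using pos by (simp only: op_scale[OF f] cod.norm_scale[OF op_mem[OF f]] norm_of_real) simp
  ultimately have "nY (T f) / nX f \<le> B" by metis
  then show ?thesis using pos by (simp add: pos_divide_le_eq)
qed

text \<open>The definition of compactness speaks of the unit ball; scaling makes it available for every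
  bounded sequence, with the rescaled limit.\<close>

lemma compact_op_subsequence:
  assumes K: "compact_op X nX Y nY T" and f: "\<And>n. f n \<in> X" "\<And>n. nX (f n) \<le> C"
  obtains y r where "y \<in> Y" "strict_mono (r :: nat \<Rightarrow> nat)"
    "(\<lambda>n. nY (\<lambda>z. T (f (r n)) z - y z)) \<longlonglongrightarrow> 0"
proof -
  \<comment> \<open>a strictly positive bound, so that division by it is harmless\<close>
  define D where "D = \<bar>C\<bar> + 1"
  have D: "D > 0" "C \<le> D" by (auto simp: D_def)
  let ?g = "\<lambda>n z. complex_of_real (1 / D) * f n z"
  let ?S = "cod.metric.mtopology closure_of (T ` {f \<in> X. nX f \<le> 1})"
  have "nX (?g n) \<le> 1" for n
    using D f(2)[of n] by (simp only: dom.norm_scale[OF f(1)] norm_of_real) (simp add: field_simps)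
  then have g: "T (?g n) \<in> T ` {f \<in> X. nX f \<le> 1}" for n
    by (intro imageI CollectI conjI dom.scale_mem f)
  have "T ` {f \<in> X. nX f \<le> 1} \<subseteq> ?S"
    by (rule closure_of_subset) (use op_mem in auto)
  then have "range (\<lambda>n. T (?g n)) \<subseteq> ?S" using g by blast
  moreover have "compactin cod.metric.mtopology ?S"
    using K by (simp add: compact_op_def cod.norm_topology_eq)
  ultimately obtain l r where l: "l \<in> ?S" "strict_mono r"
      "limitin cod.metric.mtopology ((\<lambda>n. T (?g n)) \<circ> r) l sequentially"
    unfolding cod.metric.compactin_sequentially by blast
  have lY: "l \<in> Y" using l(3) by (simp add: cod.metric.limitin_metric)
  have gX: "?g n \<in> X" for n by (intro dom.scale_mem f)
  have lim: "(\<lambda>n. nY (\<lambda>z. T (?g (r n)) z - l z)) \<longlonglongrightarrow> 0"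
    using l(3) cod.limitin_norm[of "(\<lambda>n. T (?g n)) \<circ> r" l] lY op_mem[OF gX] by simp
  let ?y = "\<lambda>z. complex_of_real D * l z"
  have "nY (\<lambda>z. T (f (r n)) z - ?y z) = D * nY (\<lambda>z. T (?g (r n)) z - l z)" for n
  proof -
    have "(\<lambda>z. T (f (r n)) z - ?y z) = (\<lambda>z. complex_of_real D * (T (?g (r n)) z - l z))"
      using D by (simp only: op_scale[OF f(1)]) (simp add: algebra_simps)
    then show ?thesis
      using cod.norm_scale[OF cod.diff_mem[OF op_mem[OF gX] lY], of "complex_of_real D"] D by simp
  qed
  then have "(\<lambda>n. nY (\<lambda>z. T (f (r n)) z - ?y z)) \<longlonglongrightarrow> 0"
    using tendsto_mult_right_zero[OF lim] by simp
  then show ?thesis using that cod.scale_mem[OF lY] l(2) by blast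
qed

lemma compact_op_bounded:
  assumes K: "compact_op X nX Y nY T"
  obtains B where "0 < B" "\<And>f. f \<in> X \<Longrightarrow> nY (T f) \<le> B * nX f"
proof -
  let ?S = "cod.metric.mtopology closure_of (T ` {f \<in> X. nX f \<le> 1})"
  have "compactin cod.metric.mtopology ?S"
    using K by (simp add: compact_op_def cod.norm_topology_eq)
  then obtain x B where B: "B > 0" "?S \<subseteq> cod.metric.mcball x B"
    using cod.metric.compactin_imp_mbounded cod.metric.mbounded_pos by blast
  have sub: "T ` {f \<in> X. nX f \<le> 1} \<subseteq> ?S"
    by (rule closure_of_subset) (use op_mem in auto)
  have "nY (T f) \<le> nY x + B" and xY: "x \<in> Y" if "f \<in> X" "nX f \<le> 1" for f
  proof -
    have "T f \<in> cod.metric.mcball x B" using B sub that by blast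
    then show x: "x \<in> Y" and "nY (T f) \<le> nY x + B"
      using cod.norm_le_diff[OF op_mem[OF that(1)], of x]
        cod.norm_diff_commute[OF op_mem[OF that(1)], of x] op_mem[OF that(1)]
      by (auto simp: cod.metric.in_mcball)
  qed
  moreover from this(2)[OF dom.zero_mem] have "nY x \<ge> 0" by (simp add: dom.norm_zero cod.norm_nonneg)
  ultimately show ?thesis using that[of "nY x + B"] op_norm_bound[of "nY x + B"] B(1) by force
qed

end

text \<open>The image of the unit ball lies in a compact set of bounded combinations of the \<open>h n\<close>. That
  set is closed, so it also contains the closure of the image.\<close>

lemma compact_op_finite_rank:
  fixes N :: nat
  assumes X: "normed_function_space X nX" and Y: "normed_function_space Y nY"
    and lin: "linear_op X Y (\<lambda>f z. \<Sum>n<N. c n f * h n z)"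
    and h: "\<And>n. n < N \<Longrightarrow> h n \<in> Y"
    and bd: "\<And>f n. f \<in> X \<Longrightarrow> nX f \<le> 1 \<Longrightarrow> n < N \<Longrightarrow> cmod (c n f) \<le> M n"
  shows "compact_op X nX Y nY (\<lambda>f z. \<Sum>n<N. c n f * h n z)"
  unfolding compact_op_def
proof (intro conjI lin)
  interpret X: normed_function_space X nX by (rule X)
  interpret Y: normed_function_space Y nY by (rule Y)
  let ?A = "(\<lambda>f z. \<Sum>n<N. c n f * h n z) ` {f \<in> X. nX f \<le> 1}"
  let ?S = "{\<lambda>z. \<Sum>n<N. c n * h n z |c. \<forall>n<N. cmod (c n) \<le> M n}"
  have S: "compactin Y.metric.mtopology ?S"
    by (rule Y.compactin_bounded_combinations[OF h])
  have "?A \<subseteq> ?S"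
  proof
    fix F assume "F \<in> ?A"
    then obtain f where f: "f \<in> X" "nX f \<le> 1" and F: "F = (\<lambda>z. \<Sum>n<N. c n f * h n z)" by auto
    have "\<forall>n<N. cmod (c n f) \<le> M n" using bd f by simp
    with F show "F \<in> ?S" by (intro CollectI exI[of _ "\<lambda>n. c n f"]) simp
  qed
  moreover have "closedin Y.metric.mtopology ?S"
    using S Y.metric.Hausdorff_space_mtopology by (rule compactin_imp_closedin[rotated])
  ultimately have "Y.metric.mtopology closure_of ?A \<subseteq> ?S" by (rule closure_of_minimal)
  then have "compactin Y.metric.mtopology (Y.metric.mtopology closure_of ?A)"
    using S closed_compactin closedin_closure_of by blast
  then show "compactin (norm_topology Y nY) (norm_topology Y nY closure_of ?A)"
    by (simp only: Y.norm_topology_eq)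
qed

section \<open>The Zygmund type spaces\<close>

abbreviation wt :: "real \<Rightarrow> complex \<Rightarrow> real" where
  "wt b z \<equiv> (1 - (cmod z)\<^sup>2) powr b"

abbreviation deriv2 :: "(complex \<Rightarrow> complex) \<Rightarrow> complex \<Rightarrow> complex" where
  "deriv2 f \<equiv> (deriv ^^ 2) f"

lemma one_minus_sq_pos: "cmod z < 1 \<Longrightarrow> 0 < 1 - (cmod z)\<^sup>2"
  by (simp add: power_less_one_iff abs_square_less_1)

lemma wt_le_1: "0 \<le> b \<Longrightarrow> cmod z < 1 \<Longrightarrow> wt b z \<le> 1"
  using one_minus_sq_pos[of z] by (intro powr_le1) auto

lemma wt_vanishes_at_boundary:
  assumes "0 < b" "0 < e"
  obtains r where "0 \<le> r" "r < 1" "\<And>z. cmod z < 1 \<Longrightarrow> r < cmod z \<Longrightarrow> wt b z \<le> e"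
proof -
  define t where "t = min 1 (e powr (1 / b))"
  have t: "0 < t" "t \<le> 1" using assms by (auto simp: t_def)
  have te: "t powr b \<le> e"
  proof -
    have "t powr b \<le> (e powr (1 / b)) powr b"
      using t assms by (intro powr_mono2) (auto simp: t_def)
    then show ?thesis using assms by (simp add: powr_powr)
  qed
  have "wt b z \<le> e" if z: "cmod z < 1" "sqrt (1 - t) < cmod z" for z
  proof -
    have "1 - t < (cmod z)\<^sup>2" using z(2) by (metis norm_ge_zero not_le real_sqrt_unique real_sqrt_le_iff abs_norm_cancel real_sqrt_abs)
    then have "wt b z \<le> t powr b"
      using one_minus_sq_pos[OF z(1)] assms by (intro powr_mono2) auto
    then show ?thesis using te by simp
  qed
  moreover have "0 \<le> sqrt (1 - t)" "sqrt (1 - t) < 1" using t by auto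
  ultimately show ?thesis using that by blast
qed

lemma weighted_norm_le_iff:
  assumes "0 \<le> M"
  shows "weighted_norm b h \<le> ennreal M \<longleftrightarrow> (\<forall>z\<in>\<D>. wt b z * cmod (h z) \<le> M)"
  unfolding weighted_norm_def SUP_le_iff using assms by (simp add: ennreal_le_iff)

lemma weighted_norm_upper: "z \<in> \<D> \<Longrightarrow> ennreal (wt b z * cmod (h z)) \<le> weighted_norm b h"
  unfolding weighted_norm_def by (rule SUP_upper)

lemma weighted_norm_cong:
  "(\<And>z. z \<in> \<D> \<Longrightarrow> h z = k z) \<Longrightarrow> weighted_norm b h = weighted_norm b k"
  unfolding weighted_norm_def by (rule SUP_cong) auto

lemma weighted_norm_bound:
  assumes "weighted_norm b h < \<infinity>" "z \<in> \<D>"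
  shows "wt b z * cmod (h z) \<le> enn2real (weighted_norm b h)"
  using weighted_norm_upper[OF assms(2), of b h] assms(1)
  by (metis enn2real_mono enn2real_ennreal infinity_ennreal_def norm_ge_zero powr_ge_zero zero_le_mult_iff)

lemma weighted_norm_le_enn2real:
  assumes "0 \<le> M" "\<And>z. z \<in> \<D> \<Longrightarrow> wt b z * cmod (h z) \<le> M"
  shows "weighted_norm b h < \<infinity>" "enn2real (weighted_norm b h) \<le> M"
proof -
  have le: "weighted_norm b h \<le> ennreal M" using assms weighted_norm_le_iff by blast
  then show "weighted_norm b h < \<infinity>" by (simp add: order_le_less_trans)
  show "enn2real (weighted_norm b h) \<le> M" using enn2real_mono[OF le] assms(1) by simp
qed

lemma H_disc_holomorphic: "f \<in> H_disc \<Longrightarrow> f holomorphic_on \<D>"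
  by (simp add: H_disc_def)

lemma deriv_holomorphic: "f \<in> H_disc \<Longrightarrow> deriv f holomorphic_on \<D>"
  by (simp add: H_disc_def holomorphic_deriv)

lemma deriv2_holomorphic: "f \<in> H_disc \<Longrightarrow> deriv2 f holomorphic_on \<D>"
  by (simp add: H_disc_def holomorphic_higher_deriv)

lemma deriv2_eq: "deriv2 f = deriv (deriv f)"
  by (simp add: numeral_2_eq_2)

lemma has_deriv_H_disc:
  assumes "f \<in> H_disc" "z \<in> \<D>"
  shows "(f has_field_derivative deriv f z) (at z)"
    and "(deriv f has_field_derivative deriv2 f z) (at z)"
  using assms unfolding deriv2_eq
  by (auto intro!: holomorphic_derivI[of _ "\<D>"] simp: H_disc_holomorphic deriv_holomorphic)

lemma H_disc_zero: "(\<lambda>_. 0) \<in> H_disc"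
  by (simp add: H_disc_def)

lemma H_disc_add: "f \<in> H_disc \<Longrightarrow> h \<in> H_disc \<Longrightarrow> (\<lambda>z. f z + h z) \<in> H_disc"
  by (auto simp: H_disc_def intro!: holomorphic_intros)

lemma H_disc_scale: "f \<in> H_disc \<Longrightarrow> (\<lambda>z. c * f z) \<in> H_disc"
  by (auto simp: H_disc_def intro!: holomorphic_intros)

lemma higher_deriv_add_H_disc:
  "f \<in> H_disc \<Longrightarrow> h \<in> H_disc \<Longrightarrow> z \<in> \<D> \<Longrightarrow>
    (deriv ^^ n) (\<lambda>z. f z + h z) z = (deriv ^^ n) f z + (deriv ^^ n) h z"
  by (rule higher_deriv_add[of _ "\<D>"]) (auto simp: H_disc_holomorphic)

lemma higher_deriv_scale_H_disc:
  "f \<in> H_disc \<Longrightarrow> z \<in> \<D> \<Longrightarrow> (deriv ^^ n) (\<lambda>z. c * f z) z = c * (deriv ^^ n) f z"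
  by (rule higher_deriv_cmult[of _ "\<D>"]) (auto simp: H_disc_holomorphic)

lemmas deriv_add_H_disc = higher_deriv_add_H_disc[where n = 1, simplified]
lemmas deriv_scale_H_disc = higher_deriv_scale_H_disc[where n = 1, simplified]

lemma H_disc_sum: "(\<And>i. i \<in> I \<Longrightarrow> f i \<in> H_disc) \<Longrightarrow> (\<lambda>z. \<Sum>i\<in>I. f i z) \<in> H_disc"
  by (induction I rule: infinite_finite_induct) (auto intro!: H_disc_add simp: H_disc_zero)

lemma higher_deriv_sum_H_disc:
  assumes "\<And>i. i \<in> I \<Longrightarrow> f i \<in> H_disc" "z \<in> \<D>"
  shows "(deriv ^^ n) (\<lambda>z. \<Sum>i\<in>I. f i z) z = (\<Sum>i\<in>I. (deriv ^^ n) (f i) z)"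
proof -
  have zero: "(deriv ^^ n) (\<lambda>_. 0) z = (0::complex)" 
    using higher_deriv_scale_H_disc[OF H_disc_zero assms(2), of n 0] by simp
  show ?thesis using assms(1)
  proof (induction I rule: infinite_finite_induct)
    case (insert i I)
    then show ?case
      using higher_deriv_add_H_disc[of "f i" "\<lambda>z. \<Sum>i\<in>I. f i z" z n] H_disc_sum[of I f] assms(2) by simp
  qed (simp_all add: zero)
qed

lemma zygmundI:
  assumes "f \<in> H_disc" "\<And>z. z \<in> \<D> \<Longrightarrow> wt a z * cmod (deriv2 f z) \<le> M"
  shows "f \<in> zygmund a"
proof -
  have "0 \<le> M" using assms(2)[of 0] by (simp add: order_trans[OF norm_ge_zero])
  then show ?thesis
    using assms weighted_norm_le_enn2real(1)[of M a "deriv2 f"] by (simp add: zygmund_def)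
qed

lemma zygmund_norm_le:
  assumes "\<And>z. z \<in> \<D> \<Longrightarrow> wt a z * cmod (deriv2 f z) \<le> M"
  shows "zygmund_norm a f \<le> cmod (f 0) + cmod (deriv f 0) + M"
proof -
  have "0 \<le> M" using assms[of 0] by (simp add: order_trans[OF norm_ge_zero])
  then show ?thesis
    using assms weighted_norm_le_enn2real(2)[of M a "deriv2 f"] by (simp add: zygmund_norm_def)
qed

lemma zygmund_H_disc: "f \<in> zygmund a \<Longrightarrow> f \<in> H_disc"
  by (simp add: zygmund_def)

lemma zygmund_bounds:
  assumes "f \<in> zygmund a"
  shows "cmod (f 0) \<le> zygmund_norm a f" "cmod (deriv f 0) \<le> zygmund_norm a f"
    "z \<in> \<D> \<Longrightarrow> wt a z * cmod (deriv2 f z) \<le> zygmund_norm a f"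
  using weighted_norm_bound[of a "deriv2 f" z] assms
  by (auto simp: zygmund_norm_def zygmund_def intro: add_increasing)

text \<open>Definiteness of the norm: the values of a function and its derivative at \<open>0\<close> fix the two
  constants of integration, and outside the disc every element of \<open>H_disc\<close> vanishes.\<close>

lemma H_disc_eq_0:
  assumes f: "f \<in> H_disc" and "f 0 = 0" "deriv f 0 = 0" "\<And>z. z \<in> \<D> \<Longrightarrow> deriv2 f z = 0"
  shows "f = (\<lambda>_. 0)"
proof -
  have const: "h z = h 0" if "\<And>z. z \<in> \<D> \<Longrightarrow> (h has_field_derivative 0) (at z)" "z \<in> \<D>"
    for h :: "complex \<Rightarrow> complex" and z
    using has_field_derivative_zero_constant[of "\<D>" h] that
    by (metis centre_in_ball convex_ball has_field_derivative_at_within zero_less_one)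
  have "deriv f z = 0" if "z \<in> \<D>" for z
    using const[of "deriv f" z] has_deriv_H_disc(2)[OF f] assms that by metis
  then have "f z = 0" if "z \<in> \<D>" for z
    using const[of f z] has_deriv_H_disc(1)[OF f] assms that by metis
  moreover have "f z = 0" if "z \<notin> \<D>" for z using f that by (simp add: H_disc_def)
  ultimately show ?thesis by blast
qed

interpretation zygmund: normed_function_space "zygmund a" "zygmund_norm a" for a
proof
  have z2: "deriv2 (\<lambda>_. 0) z = (0::complex)" for z
    by (simp add: deriv2_eq)
  show "(\<lambda>_. 0) \<in> zygmund a" by (rule zygmundI[OF H_disc_zero, of _ 0]) (simp only: z2, simp)
next
  fix f h assume f: "f \<in> zygmund a" and h: "h \<in> zygmund a"
  let ?F = "enn2real (weighted_norm a (deriv2 f))" and ?H = "enn2real (weighted_norm a (deriv2 h))"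
  have fh: "f \<in> H_disc" "h \<in> H_disc" using f h by (auto simp: zygmund_H_disc)
  have bd: "wt a z * cmod (deriv2 (\<lambda>z. f z + h z) z) \<le> ?F + ?H" if z: "z \<in> \<D>" for z
  proof -
    have "wt a z * cmod (deriv2 (\<lambda>z. f z + h z) z)
        \<le> wt a z * (cmod (deriv2 f z) + cmod (deriv2 h z))"
      unfolding higher_deriv_add_H_disc[OF fh z] by (intro mult_left_mono norm_triangle_ineq) simp
    also have "\<dots> \<le> ?F + ?H"
      using weighted_norm_bound[of a "deriv2 f" z] weighted_norm_bound[of a "deriv2 h" z] f h z
      by (simp add: zygmund_def distrib_left)
    finally show ?thesis .
  qed
  show "(\<lambda>z. f z + h z) \<in> zygmund a"
    using bd by (rule zygmundI[OF H_disc_add[OF fh]])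
  have "zygmund_norm a (\<lambda>z. f z + h z) \<le> cmod (f 0 + h 0) + cmod (deriv (\<lambda>z. f z + h z) 0) + (?F + ?H)"
    using zygmund_norm_le[OF bd] .
  also have "deriv (\<lambda>z. f z + h z) 0 = deriv f 0 + deriv h 0"
    by (simp add: deriv_add_H_disc[OF fh])
  finally show "zygmund_norm a (\<lambda>z. f z + h z) \<le> zygmund_norm a f + zygmund_norm a h"
    using norm_triangle_ineq[of "f 0" "h 0"] norm_triangle_ineq[of "deriv f 0" "deriv h 0"]
    by (simp add: zygmund_norm_def)
next
  fix f and c :: complex assume f: "f \<in> zygmund a"
  have fH: "f \<in> H_disc" using f by (rule zygmund_H_disc)
  have eq: "weighted_norm a (deriv2 (\<lambda>z. c * f z)) = ennreal (cmod c) * weighted_norm a (deriv2 f)"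
  proof -
    have "weighted_norm a (deriv2 (\<lambda>z. c * f z)) = weighted_norm a (\<lambda>z. c * deriv2 f z)"
      by (rule weighted_norm_cong) (rule higher_deriv_scale_H_disc[OF fH])
    also have "\<dots> = (SUP z\<in>\<D>. ennreal (cmod c) * ennreal (wt a z * cmod (deriv2 f z)))"
      unfolding weighted_norm_def
      by (intro SUP_cong refl) (simp add: norm_mult ennreal_mult[symmetric] mult_ac)
    finally show ?thesis by (simp add: weighted_norm_def SUP_mult_left_ennreal)
  qed
  show "(\<lambda>z. c * f z) \<in> zygmund a"
    using f H_disc_scale[OF fH] eq by (simp add: zygmund_def ennreal_mult_less_top)
  have "deriv (\<lambda>z. c * f z) 0 = c * deriv f 0"
    by (simp add: deriv_scale_H_disc[OF fH])
  then show "zygmund_norm a (\<lambda>z. c * f z) = cmod c * zygmund_norm a f"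
    by (simp add: zygmund_norm_def eq enn2real_mult norm_mult distrib_left)
next
  fix f assume f: "f \<in> zygmund a" "zygmund_norm a f = 0"
  have "f 0 = 0" "deriv f 0 = 0" using zygmund_bounds(1,2)[OF f(1)] f(2) by auto
  moreover have "deriv2 f z = 0" if "z \<in> \<D>" for z
  proof -
    have "wt a z * cmod (deriv2 f z) \<le> 0" using zygmund_bounds(3)[OF f(1) that] f(2) by simp
    moreover have "wt a z > 0" using one_minus_sq_pos[of z] that by simp
    ultimately show ?thesis by (simp add: mult_le_0_iff)
  qed
  ultimately show "f = (\<lambda>_. 0)" by (rule H_disc_eq_0[OF zygmund_H_disc[OF f(1)]])
qed

section \<open>Sequences annihilated by compact operators\<close>

text \<open>The boundedness of each single second derivative makes \<open>(1 - \<bar>z\<bar>\<^sup>2)\<^bsup>a\<^esup> \<bar>f\<^sub>n''(z)\<bar>\<close> vanish at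
  the boundary. Without it, sums of terms of the sequence need not stay bounded, because all terms
  could be large near the boundary at the same points.\<close>

definition vanishing_sequence :: "real \<Rightarrow> real \<Rightarrow> (nat \<Rightarrow> complex \<Rightarrow> complex) \<Rightarrow> bool" where
  "vanishing_sequence a C f \<longleftrightarrow>
     (\<forall>n. f n \<in> zygmund a \<and> zygmund_norm a (f n) \<le> C) \<and>
     (\<forall>n. \<exists>B. \<forall>z\<in>\<D>. cmod (deriv2 (f n) z) \<le> B) \<and>
     (\<forall>r<1. \<forall>e>0. \<forall>\<^sub>F n in sequentially. \<forall>z. cmod z \<le> r \<longrightarrow> cmod (deriv2 (f n) z) \<le> e) \<and>
     (\<lambda>n. f n 0) \<longlonglongrightarrow> 0 \<and> (\<lambda>n. deriv (f n) 0) \<longlonglongrightarrow> 0"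

text \<open>Each new index is chosen in two steps. The weighted second derivative of the sum so far is at
  most \<open>1\<close> outside some disc of radius \<open>r < 1\<close>; the new term is then taken so late that it is at most
  \<open>d\<close> on that disc. At every point either the old sum or the new term is negligible, so the
  bound never becomes a multiple of \<open>C\<close>. The error \<open>d\<close> is spent once for the second derivative,
  once for the value at \<open>0\<close> and once for the derivative at \<open>0\<close>.\<close>

lemma gliding_hump:
  assumes a: "0 < a" and f: "vanishing_sequence a C f" and J: "infinite J" and d: "0 < d"
  obtains I where "finite I" "I \<subseteq> J" "card I = m"
    "zygmund_norm a (\<lambda>z. \<Sum>n\<in>I. f n z) \<le> C + 1 + 3 * real m * d"
proof -
  have mem: "f n \<in> zygmund a" and nle: "zygmund_norm a (f n) \<le> C" for n
    using f by (auto simp: vanishing_sequence_def)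
  have C: "0 \<le> C" using zygmund.norm_nonneg[OF mem] nle order_trans by blast
  have fH: "f n \<in> H_disc" for n using mem by (rule zygmund_H_disc)
  have hump: "wt a z * cmod (deriv2 (f n) z) \<le> C" if "z \<in> \<D>" for n z
    using zygmund_bounds(3)[OF mem that] nle order_trans by blast
  have "\<exists>I. finite I \<and> I \<subseteq> J \<and> card I = m \<and> cmod (\<Sum>n\<in>I. f n 0) \<le> real m * d \<and>
    cmod (\<Sum>n\<in>I. deriv (f n) 0) \<le> real m * d \<and>
    (\<forall>z\<in>\<D>. wt a z * cmod (\<Sum>n\<in>I. deriv2 (f n) z) \<le> C + 1 + real m * d)"
  proof (induction m)
    case 0
    show ?case using C by (intro exI[of _ "{}"]) simp
  next
    case (Suc m)
    then obtain I where I: "finite I" "I \<subseteq> J" "card I = m" "cmod (\<Sum>n\<in>I. f n 0) \<le> real m * d"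
      "cmod (\<Sum>n\<in>I. deriv (f n) 0) \<le> real m * d"
      "\<And>z. z \<in> \<D> \<Longrightarrow> wt a z * cmod (\<Sum>n\<in>I. deriv2 (f n) z) \<le> C + 1 + real m * d" by blast
    obtain B where B: "\<And>n z. z \<in> \<D> \<Longrightarrow> cmod (deriv2 (f n) z) \<le> B n"
      using f unfolding vanishing_sequence_def by metis
    define b where "b = (\<Sum>n\<in>I. \<bar>B n\<bar>) + 1"
    have b: "b > 0" unfolding b_def by (simp add: add_nonneg_pos sum_nonneg)
    have sb: "cmod (\<Sum>n\<in>I. deriv2 (f n) z) \<le> b" if "z \<in> \<D>" for z
    proof -
      have "cmod (\<Sum>n\<in>I. deriv2 (f n) z) \<le> (\<Sum>n\<in>I. \<bar>B n\<bar>)"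
        using B[OF that] by (intro sum_norm_le) (meson abs_ge_self order_trans)
      then show ?thesis by (simp add: b_def)
    qed
    obtain r where r: "0 \<le> r" "r < 1" "\<And>z. cmod z < 1 \<Longrightarrow> r < cmod z \<Longrightarrow> wt a z \<le> 1 / b"
      using wt_vanishes_at_boundary[OF a, of "1 / b"] b by auto
    have "\<forall>\<^sub>F n in sequentially. (\<forall>z. cmod z \<le> r \<longrightarrow> cmod (deriv2 (f n) z) \<le> d)
        \<and> cmod (f n 0) < d \<and> cmod (deriv (f n) 0) < d"
      using f d r(2) unfolding vanishing_sequence_def tendsto_iff
      by (intro eventually_conj) auto
    then obtain N where N: "\<And>n. n \<ge> N \<Longrightarrow> (\<forall>z. cmod z \<le> r \<longrightarrow> cmod (deriv2 (f n) z) \<le> d)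
        \<and> cmod (f n 0) < d \<and> cmod (deriv (f n) 0) < d"
      unfolding eventually_sequentially by blast
    have "infinite (J - I - {..<N})" using J I(1) by simp
    then obtain n where n: "n \<in> J" "n \<notin> I" "n \<ge> N" by (metis Diff_iff infinite_imp_nonempty ex_in_conv lessThan_iff not_less)
    show ?case
    proof (intro exI[of _ "insert n I"] conjI ballI)
      show "finite (insert n I)" "insert n I \<subseteq> J" "card (insert n I) = Suc m" using I n by auto
      show "cmod (\<Sum>n\<in>insert n I. f n 0) \<le> real (Suc m) * d"
        using I n N[OF n(3)] norm_triangle_ineq[of "f n 0" "\<Sum>n\<in>I. f n 0"] by (simp add: algebra_simps)
      show "cmod (\<Sum>n\<in>insert n I. deriv (f n) 0) \<le> real (Suc m) * d"
        using I n N[OF n(3)] norm_triangle_ineq[of "deriv (f n) 0" "\<Sum>n\<in>I. deriv (f n) 0"]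
        by (simp add: algebra_simps)
      fix z assume z: "z \<in> \<D>"
      have "wt a z * cmod (\<Sum>n\<in>insert n I. deriv2 (f n) z)
          \<le> wt a z * (cmod (deriv2 (f n) z) + cmod (\<Sum>n\<in>I. deriv2 (f n) z))"
        using I n by (intro mult_left_mono) (simp_all add: norm_triangle_ineq)
      also have "\<dots> = wt a z * cmod (deriv2 (f n) z) + wt a z * cmod (\<Sum>n\<in>I. deriv2 (f n) z)"
        by (simp add: distrib_left)
      also have "\<dots> \<le> C + 1 + real (Suc m) * d"
      proof (cases "cmod z \<le> r")
        case True
        have "wt a z * cmod (deriv2 (f n) z) \<le> 1 * d"
          using N[OF n(3)] True z a d by (intro mult_mono wt_le_1) auto
        then show ?thesis using I(6)[OF z] by (simp add: algebra_simps)
      next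
        case False
        have "wt a z * cmod (\<Sum>n\<in>I. deriv2 (f n) z) \<le> (1 / b) * b"
          using r(3)[of z] False z sb[OF z] b by (intro mult_mono) auto
        also have "\<dots> = 1" using b by simp
        finally have "wt a z * cmod (\<Sum>n\<in>I. deriv2 (f n) z) \<le> 1" .
        moreover have "0 \<le> real m * d" "real (Suc m) * d = real m * d + d"
          using d by (simp_all add: algebra_simps)
        ultimately show ?thesis using hump[OF z, of n] d by linarith
      qed
      finally show "wt a z * cmod (\<Sum>n\<in>insert n I. deriv2 (f n) z) \<le> C + 1 + real (Suc m) * d" .
    qed
  qed
  then obtain I where I: "finite I" "I \<subseteq> J" "card I = m" "cmod (\<Sum>n\<in>I. f n 0) \<le> real m * d"
    "cmod (\<Sum>n\<in>I. deriv (f n) 0) \<le> real m * d"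
    "\<And>z. z \<in> \<D> \<Longrightarrow> wt a z * cmod (\<Sum>n\<in>I. deriv2 (f n) z) \<le> C + 1 + real m * d" by blast
  have "zygmund_norm a (\<lambda>z. \<Sum>n\<in>I. f n z)
      \<le> cmod (\<Sum>n\<in>I. f n 0) + cmod (deriv (\<lambda>z. \<Sum>n\<in>I. f n z) 0) + (C + 1 + real m * d)"
    by (rule zygmund_norm_le) (simp add: higher_deriv_sum_H_disc fH I(6))
  also have "deriv (\<lambda>z. \<Sum>n\<in>I. f n z) 0 = (\<Sum>n\<in>I. deriv (f n) 0)"
    using higher_deriv_sum_H_disc[of I f 0 1] fH by simp
  finally have "zygmund_norm a (\<lambda>z. \<Sum>n\<in>I. f n z) \<le> C + 1 + 3 * real m * d" using I(4,5) by simp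
  then show ?thesis using that I by blast
qed

text \<open>Suppose a subsequence of \<open>K f\<^sub>n\<close> converges to \<open>y \<noteq> 0\<close>. The sum of \<open>m\<close> of its terms is close to
  \<open>m y\<close>, so its norm grows linearly in \<open>m\<close>; but it is also the image of a gliding hump sum, whose
  norm is bounded up to an arbitrarily small multiple of \<open>m\<close>.\<close>

lemma compact_op_vanishing_sequence:
  assumes a: "0 < a" and f: "vanishing_sequence a C f"
    and op: "function_operator (zygmund a) (zygmund_norm a) Y nY K"
    and K: "compact_op (zygmund a) (zygmund_norm a) Y nY K"
  shows "(\<lambda>n. nY (K (f n))) \<longlonglongrightarrow> 0"
proof (rule ccontr)
  interpret K: function_operator "zygmund a" "zygmund_norm a" Y nY K by (rule op)
  have mem: "f n \<in> zygmund a" and nle: "zygmund_norm a (f n) \<le> C" for n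
    using f by (auto simp: vanishing_sequence_def)
  have KY: "K (f n) \<in> Y" for n by (rule K.op_mem[OF mem])
  assume "\<not> ?thesis"
  then obtain e where e: "e > 0" "\<exists>\<^sub>F n in sequentially. nY (K (f n)) \<ge> e"
    unfolding tendsto_iff not_all not_imp frequently_def[symmetric]
    using K.cod.norm_nonneg[OF KY] by (auto simp: not_less not_eventually)
  have infJ: "infinite {n. nY (K (f n)) \<ge> e}"
    using e(2) by (simp add: cofinite_eq_sequentially[symmetric] frequently_cofinite)
  define s where "s = enumerate {n. nY (K (f n)) \<ge> e}"
  have s: "strict_mono s" "nY (K (f (s n))) \<ge> e" for n
    using strict_mono_enumerate[OF infJ] enumerate_in_set[OF infJ, of n] by (auto simp: s_def)
  obtain y r where y: "y \<in> Y" "strict_mono (r :: nat \<Rightarrow> nat)"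
    "(\<lambda>n. nY (\<lambda>z. K (f (s (r n))) z - y z)) \<longlonglongrightarrow> 0"
    using K.compact_op_subsequence[OF K, of "\<lambda>n. f (s n)" C] mem nle by blast
  obtain N where N: "\<And>n. n \<ge> N \<Longrightarrow> nY (\<lambda>z. K (f (s (r n))) z - y z) < e / 4"
    using order_tendstoD(2)[OF y(3), of "e / 4"] e(1) by (auto simp: eventually_sequentially)
  have sr: "strict_mono (\<lambda>n. s (r n))"
    using strict_mono_o[OF s(1) y(2)] by (simp add: o_def)
  define J where "J = (\<lambda>n. s (r n)) ` {N..}"
  have J: "infinite J" unfolding J_def
    using finite_imageD[OF _ inj_on_subset[OF strict_mono_imp_inj_on[OF sr]]] infinite_Ici by blast
  have close: "nY (\<lambda>z. K (f n) z - y z) \<le> e / 4" if "n \<in> J" for n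
    using that N by (auto simp: J_def less_imp_le)
  have big: "nY y \<ge> 3 * e / 4"
    using K.cod.norm_le_diff[OF KY y(1), of "s (r N)"] N[of N] s(2)[of "r N"] by simp
  obtain B where B: "0 < B" "\<And>g. g \<in> zygmund a \<Longrightarrow> nY (K g) \<le> B * zygmund_norm a g"
    using K.compact_op_bounded[OF K] by blast
  \<comment> \<open>the error \<open>e / (12 B)\<close> per term costs \<open>m e / 4\<close> after applying \<open>K\<close>, half of the growth \<open>m e / 2\<close>\<close>
  have "real m * (e / 4) \<le> B * (C + 1)" for m
  proof -
    obtain I where I: "finite I" "I \<subseteq> J" "card I = m"
      "zygmund_norm a (\<lambda>z. \<Sum>n\<in>I. f n z) \<le> C + 1 + 3 * real m * (e / (12 * B))"
      using gliding_hump[OF a f J, of "e / (12 * B)" m] e(1) B(1) by auto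
    let ?S = "\<lambda>z. \<Sum>n\<in>I. f n z"
    have KS: "K ?S = (\<lambda>z. \<Sum>n\<in>I. K (f n) z)" by (rule K.op_sum) (rule mem)
    have SY: "?S \<in> zygmund a" by (rule zygmund.sum_mem) (rule mem)
    have my: "(\<lambda>z. of_nat m * y z) \<in> Y" by (rule K.cod.scale_mem[OF y(1)])
    have "(\<lambda>z. \<Sum>n\<in>I. (K (f n) z - y z)) = (\<lambda>z. K ?S z - of_nat m * y z)"
      by (simp add: KS sum_subtractf I(3))
    then have "nY (\<lambda>z. K ?S z - of_nat m * y z) \<le> (\<Sum>n\<in>I. nY (\<lambda>z. K (f n) z - y z))"
      using K.cod.norm_sum[of I "\<lambda>n z. K (f n) z - y z"] K.cod.diff_mem[OF KY y(1)] by simp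
    also have "\<dots> \<le> (\<Sum>n\<in>I. e / 4)" using close I(2) by (intro sum_mono) auto
    finally have "nY (\<lambda>z. K ?S z - of_nat m * y z) \<le> real m * (e / 4)" by (simp add: I(3))
    moreover have "nY (\<lambda>z. of_nat m * y z) = real m * nY y"
      using K.cod.norm_scale[OF y(1), of "of_nat m"] by simp
    moreover have "real m * nY y \<ge> real m * (3 * e / 4)" using big by (intro mult_left_mono) auto
    ultimately have "real m * (e / 2) \<le> nY (K ?S)"
      using K.cod.norm_le_diff[OF my K.op_mem[OF SY]]
        K.cod.norm_diff_commute[OF my K.op_mem[OF SY]] by (simp add: algebra_simps)
    also have "\<dots> \<le> B * (C + 1 + 3 * real m * (e / (12 * B)))"
      using B I(4) SY by (meson mult_left_mono less_imp_le order_trans)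
    also have "\<dots> = B * (C + 1) + real m * (e / 4)" using B(1) by (simp add: field_simps)
    finally show ?thesis by (simp add: algebra_simps)
  qed
  moreover obtain m where "real m * (e / 4) > B * (C + 1)"
    using reals_Archimedean3[of "e / 4"] e(1) by auto
  ultimately show False by (meson not_less)
qed

text \<open>A compact perturbation is asymptotically invisible on a vanishing sequence. The \<open>1\<close> in
  \<open>C + 1\<close> absorbs the perturbation, which is eventually smaller than \<open>M\<close>.\<close>

lemma essential_norm_vanishing_sequence:
  assumes a: "0 < a" and f: "vanishing_sequence a C f"
    and op: "function_operator (zygmund a) (zygmund_norm a) Y nY T"
    and M: "essential_norm (zygmund a) (zygmund_norm a) Y nY T < ennreal M" "0 < M"
  shows "\<forall>\<^sub>F n in sequentially. nY (T (f n)) \<le> (C + 1) * M"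
proof -
  interpret T: function_operator "zygmund a" "zygmund_norm a" Y nY T by (rule op)
  have mem: "f n \<in> zygmund a" and nle: "zygmund_norm a (f n) \<le> C" for n
    using f by (auto simp: vanishing_sequence_def)
  obtain K where K: "compact_op (zygmund a) (zygmund_norm a) Y nY K"
    and lt: "op_norm (zygmund a) (zygmund_norm a) nY (\<lambda>f z. T f z + K f z) < ennreal M"
    using M(1) unfolding essential_norm_def INF_less_iff by blast
  have opK: "function_operator (zygmund a) (zygmund_norm a) Y nY K"
    using K by unfold_locales (simp add: compact_op_def)
  interpret K: function_operator "zygmund a" "zygmund_norm a" Y nY K by (rule opK)
  have "linear_op (zygmund a) Y (\<lambda>f z. T f z + K f z)"
    unfolding linear_op_def
    by (auto intro!: T.cod.add_mem T.op_mem K.op_mem simp: T.op_add K.op_add T.op_scale K.op_scale algebra_simps)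
  then interpret S: function_operator "zygmund a" "zygmund_norm a" Y nY "\<lambda>f z. T f z + K f z"
    by unfold_locales
  have "nY (\<lambda>z. T h z + K h z) \<le> M" if "h \<in> zygmund a" "zygmund_norm a h \<le> 1" for h
  proof -
    have "ennreal (nY (\<lambda>z. T h z + K h z)) \<le> op_norm (zygmund a) (zygmund_norm a) nY (\<lambda>f z. T f z + K f z)"
      unfolding op_norm_def using that by (intro SUP_upper) auto
    then have "ennreal (nY (\<lambda>z. T h z + K h z)) < ennreal M" using lt by simp
    then show ?thesis using M(2) by (simp add: ennreal_less_iff T.cod.norm_nonneg[OF S.op_mem[OF that(1)]])
  qed
  then have S: "nY (\<lambda>z. T (f n) z + K (f n) z) \<le> M * C" for n
    using S.op_norm_bound[of M "f n"] mem[of n] nle[of n] M(2)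
    by (meson mult_left_mono less_imp_le order_trans)
  have "\<forall>\<^sub>F n in sequentially. nY (K (f n)) < M"
    using order_tendstoD(2)[OF compact_op_vanishing_sequence[OF a f opK K]] M(2) by blast
  then show ?thesis
  proof eventually_elim
    case (elim n)
    have "(\<lambda>z. T (f n) z - (T (f n) z + K (f n) z)) = (\<lambda>z. - K (f n) z)" by simp
    then have "nY (T (f n)) \<le> nY (\<lambda>z. T (f n) z + K (f n) z) + nY (K (f n))"
      using T.cod.norm_le_diff[OF T.op_mem[OF mem] S.op_mem[OF mem], of n n]
        T.cod.norm_minus[OF K.op_mem[OF mem], of n] by simp
    then show ?case using S[of n] elim by (simp add: algebra_simps)
  qed
qed

section \<open>The operator and its derivatives\<close>

text \<open>\<open>VC\<close> itself is such a primitive, and test functions are conveniently given by their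
  derivatives. The value \<open>0\<close> off the disc places primitives in \<open>H_disc\<close>.\<close>

definition primitive :: "(complex \<Rightarrow> complex) \<Rightarrow> complex \<Rightarrow> complex" where
  "primitive F z = (if z \<in> \<D> then contour_integral (linepath 0 z) F else 0)"

lemma VC_eq_primitive: "VC g \<phi> f = primitive (\<lambda>\<xi>. deriv f (\<phi> \<xi>) * g \<xi>)"
  by (simp add: VC_def primitive_def fun_eq_iff)

lemma primitive_0 [simp]: "primitive F 0 = 0"
  by (simp add: primitive_def)

lemma
  assumes F: "F holomorphic_on \<D>"
  shows primitive_H_disc: "primitive F \<in> H_disc"
    and deriv_primitive: "z \<in> \<D> \<Longrightarrow> deriv (primitive F) z = F z"
    and deriv2_primitive: "z \<in> \<D> \<Longrightarrow> deriv2 (primitive F) z = deriv F z"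
proof -
  obtain h where h: "\<And>z. z \<in> \<D> \<Longrightarrow> (h has_field_derivative F z) (at z within \<D>)"
    using holomorphic_convex_primitive'[OF convex_ball open_ball F] by blast
  have eq: "primitive F z = h z - h 0" if "z \<in> \<D>" for z
  proof -
    have "closed_segment 0 z \<subseteq> \<D>"
      using that by (intro closed_segment_subset) auto
    then have "(F has_contour_integral (h z - h 0)) (linepath 0 z)"
      using contour_integral_primitive[OF h, of "linepath 0 z"] by simp
    then show ?thesis using that by (simp add: primitive_def contour_integral_unique)
  qed
  have der: "(primitive F has_field_derivative F z) (at z)" if z: "z \<in> \<D>" for z
  proof -
    have "((\<lambda>z. h z - h 0) has_field_derivative F z) (at z)"
      using DERIV_diff[OF h[OF z] DERIV_const, of "h 0"] at_within_open[OF z] by simp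
    then show ?thesis
      by (rule has_field_derivative_transform_within_open[OF _ open_ball z]) (simp add: eq)
  qed
  have "primitive F holomorphic_on \<D>"
    unfolding holomorphic_on_def field_differentiable_def
    using has_field_derivative_at_within[OF der] by blast
  then show "primitive F \<in> H_disc" by (simp add: H_disc_def primitive_def)
  show d: "deriv (primitive F) z = F z" if "z \<in> \<D>" for z
    by (rule DERIV_imp_deriv[OF der[OF that]])
  show "deriv2 (primitive F) z = deriv F z" if z: "z \<in> \<D>"
    unfolding deriv2_eq
    by (rule complex_derivative_transform_within_open[OF _ F open_ball z])
      (use d deriv_holomorphic[OF \<open>primitive F \<in> H_disc\<close>] in auto)
qed

lemma primitive_zygmund:
  assumes "0 \<le> a" "F holomorphic_on \<D>" "\<And>z. z \<in> \<D> \<Longrightarrow> cmod (deriv F z) \<le> B"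
  shows "primitive F \<in> zygmund a"
proof (rule zygmundI[OF primitive_H_disc[OF assms(2)], of _ B])
  fix z :: complex assume z: "z \<in> \<D>"
  have "wt a z * cmod (deriv F z) \<le> 1 * B"
    using z assms by (intro mult_mono wt_le_1) auto
  then show "wt a z * cmod (deriv2 (primitive F) z) \<le> B"
    by (simp add: deriv2_primitive[OF assms(2) z])
qed

lemma vanishing_sequence_primitives:
  assumes a: "0 \<le> a" and hol: "\<And>n. F n holomorphic_on \<D>" and zero: "\<And>n. F n 0 = 0"
    and C: "\<And>n z. z \<in> \<D> \<Longrightarrow> wt a z * cmod (deriv (F n) z) \<le> C"
    and bd: "\<And>n. \<exists>B. \<forall>z\<in>\<D>. cmod (deriv (F n) z) \<le> B"
    and loc: "\<And>r e. 0 \<le> r \<Longrightarrow> r < 1 \<Longrightarrow> 0 < e \<Longrightarrow>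
      \<forall>\<^sub>F n in sequentially. \<forall>z. cmod z \<le> r \<longrightarrow> cmod (deriv (F n) z) \<le> e"
  shows "vanishing_sequence a C (\<lambda>n. primitive (F n))"
  unfolding vanishing_sequence_def
proof (intro conjI allI impI)
  fix n
  show "primitive (F n) \<in> zygmund a"
    using bd[of n] primitive_zygmund[OF a hol] by blast
  show "zygmund_norm a (primitive (F n)) \<le> C"
    using zygmund_norm_le[of a "primitive (F n)" C] C
    by (simp add: deriv2_primitive[OF hol] deriv_primitive[OF hol] zero)
  show "\<exists>B. \<forall>z\<in>\<D>. cmod (deriv2 (primitive (F n)) z) \<le> B"
    using bd[of n] by (simp add: deriv2_primitive[OF hol])
next
  fix r e :: real assume r: "r < 1" and e: "0 < e"
  have "\<forall>\<^sub>F n in sequentially. \<forall>z. cmod z \<le> max r 0 \<longrightarrow> cmod (deriv (F n) z) \<le> e"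
    using r e by (intro loc) auto
  then show "\<forall>\<^sub>F n in sequentially. \<forall>z. cmod z \<le> r \<longrightarrow> cmod (deriv2 (primitive (F n)) z) \<le> e"
    by eventually_elim (use r in \<open>auto simp: deriv2_primitive[OF hol]\<close>)
qed (simp_all add: deriv_primitive[OF hol] zero)

locale bounded_VC =
  fixes \<alpha> \<beta> :: real and g \<phi> :: "complex \<Rightarrow> complex"
  assumes \<alpha>_pos: "0 < \<alpha>" and \<beta>_pos: "0 < \<beta>"
    and symbols: "(g, \<phi>) \<in> VC_bounded_symbols \<alpha> \<beta>"
begin

text \<open>The coefficients of \<open>f'' \<circ> \<phi>\<close> and \<open>f' \<circ> \<phi>\<close> in the second derivative of the image of \<open>f\<close>.\<close>

abbreviation u :: "complex \<Rightarrow> complex" where "u z \<equiv> g z * deriv \<phi> z"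
abbreviation w :: "complex \<Rightarrow> complex" where "w z \<equiv> deriv g z"

lemma g_holomorphic: "g holomorphic_on \<D>" and \<phi>_holomorphic: "\<phi> holomorphic_on \<D>"
  and \<phi>_self_map: "\<phi> ` \<D> \<subseteq> \<D>"
  and VC_linear: "linear_op (zygmund \<alpha>) (zygmund \<beta>) (VC g \<phi>)"
  using symbols by (auto simp: VC_bounded_symbols_def bounded_op_def)

lemma \<phi>_disc: "cmod z < 1 \<Longrightarrow> cmod (\<phi> z) < 1"
  using \<phi>_self_map by fastforce

sublocale function_operator "zygmund \<alpha>" "zygmund_norm \<alpha>" "zygmund \<beta>" "zygmund_norm \<beta>" "VC g \<phi>"
  by unfold_locales (rule VC_linear)

lemma VC_0: "VC g \<phi> f 0 = 0"
  by (simp add: VC_eq_primitive)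

lemma
  assumes f: "f \<in> H_disc" and z: "z \<in> \<D>"
  shows deriv_VC: "deriv (VC g \<phi> f) z = deriv f (\<phi> z) * g z"
    and deriv2_VC: "deriv2 (VC g \<phi> f) z = deriv2 f (\<phi> z) * u z + deriv f (\<phi> z) * w z"
proof -
  have comp: "(\<lambda>\<xi>. deriv f (\<phi> \<xi>)) holomorphic_on \<D>"
    using holomorphic_on_compose_gen[OF \<phi>_holomorphic deriv_holomorphic[OF f] \<phi>_self_map]
    by (simp add: o_def)
  have hol: "(\<lambda>\<xi>. deriv f (\<phi> \<xi>) * g \<xi>) holomorphic_on \<D>"
    using comp g_holomorphic by (rule holomorphic_on_mult)
  show "deriv (VC g \<phi> f) z = deriv f (\<phi> z) * g z"
    unfolding VC_eq_primitive by (rule deriv_primitive[OF hol z])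
  have \<phi>': "(\<phi> has_field_derivative deriv \<phi> z) (at z)" and g': "(g has_field_derivative deriv g z) (at z)"
    using z by (auto intro!: holomorphic_derivI[OF \<phi>_holomorphic] holomorphic_derivI[OF g_holomorphic])
  have "(deriv f has_field_derivative deriv2 f (\<phi> z)) (at (\<phi> z))"
    using has_deriv_H_disc(2)[OF f] \<phi>_disc z by simp
  from DERIV_mult[OF DERIV_chain2[OF this \<phi>'] g']
  have "((\<lambda>\<xi>. deriv f (\<phi> \<xi>) * g \<xi>) has_field_derivative
      deriv2 f (\<phi> z) * u z + deriv f (\<phi> z) * w z) (at z)"
    by (simp add: algebra_simps)
  then show "deriv2 (VC g \<phi> f) z = deriv2 f (\<phi> z) * u z + deriv f (\<phi> z) * w z"
    unfolding VC_eq_primitive deriv2_primitive[OF hol z] by (rule DERIV_imp_deriv)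
qed

lemma VC_norm_lower:
  assumes "f \<in> zygmund \<alpha>" "z \<in> \<D>"
  shows "wt \<beta> z * cmod (deriv2 f (\<phi> z) * u z + deriv f (\<phi> z) * w z) \<le> zygmund_norm \<beta> (VC g \<phi> f)"
  using zygmund_bounds(3)[OF op_mem[OF assms(1)] assms(2)]
  by (simp add: deriv2_VC[OF zygmund_H_disc[OF assms(1)] assms(2)])

lemma VC_norm_upper:
  assumes f: "f \<in> zygmund \<alpha>"
    and M: "\<And>z. z \<in> \<D> \<Longrightarrow> wt \<beta> z * cmod (deriv2 f (\<phi> z) * u z + deriv f (\<phi> z) * w z) \<le> M"
  shows "zygmund_norm \<beta> (VC g \<phi> f) \<le> cmod (deriv f (\<phi> 0)) * cmod (g 0) + M"
proof -
  have fH: "f \<in> H_disc" using f by (rule zygmund_H_disc)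
  show ?thesis
    using zygmund_norm_le[of \<beta> "VC g \<phi> f" M] M deriv_VC[OF fH, of 0]
    by (simp add: deriv2_VC[OF fH] VC_0 norm_mult)
qed

text \<open>The images of the functions with derivatives \<open>1\<close> and \<open>z\<close> have second derivatives \<open>w\<close> and
  \<open>u + \<phi> w\<close>, and \<open>\<bar>\<phi>\<bar> < 1\<close>.\<close>

lemma symbols_weighted_bounded:
  obtains B where "0 < B" "\<And>z. z \<in> \<D> \<Longrightarrow> wt \<beta> z * cmod (u z) \<le> B"
    "\<And>z. z \<in> \<D> \<Longrightarrow> wt \<beta> z * cmod (w z) \<le> B"
proof -
  let ?p = "primitive (\<lambda>_. 1)" and ?q = "primitive (\<lambda>z. z)"
  let ?P = "zygmund_norm \<beta> (VC g \<phi> ?p)" and ?Q = "zygmund_norm \<beta> (VC g \<phi> ?q)"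
  have pZ: "?p \<in> zygmund \<alpha>" and qZ: "?q \<in> zygmund \<alpha>"
    using \<alpha>_pos by (auto intro!: primitive_zygmund[where B = 1] holomorphic_intros)
  have W: "wt \<beta> z * cmod (w z) \<le> ?P" if "z \<in> \<D>" for z
    using VC_norm_lower[OF pZ that] \<phi>_disc that by (simp add: deriv_primitive deriv2_primitive)
  have U: "wt \<beta> z * cmod (u z) \<le> ?Q + ?P" if z: "z \<in> \<D>" for z
  proof -
    have Q: "wt \<beta> z * cmod (u z + \<phi> z * w z) \<le> ?Q"
      using VC_norm_lower[OF qZ z] \<phi>_disc z by (simp add: deriv_primitive deriv2_primitive)
    have "cmod (u z) \<le> cmod (u z + \<phi> z * w z) + cmod (\<phi> z * w z)"
      using norm_triangle_ineq4[of "u z + \<phi> z * w z" "\<phi> z * w z"] by simp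
    also have "cmod (\<phi> z * w z) \<le> cmod (w z)"
      using \<phi>_disc[of z] z by (simp add: norm_mult mult_left_le_one_le)
    finally have "wt \<beta> z * cmod (u z) \<le> wt \<beta> z * (cmod (u z + \<phi> z * w z) + cmod (w z))"
      by (intro mult_left_mono) auto
    then show ?thesis using Q W[OF z] by (simp add: distrib_left)
  qed
  have "0 \<le> ?P" "0 \<le> ?Q" using pZ qZ by (auto intro!: zygmund.norm_nonneg op_mem)
  then show ?thesis using that[of "?Q + ?P + 1"] U W by fastforce
qed

lemma essential_norm_test_derivatives:
  assumes F: "vanishing_sequence \<alpha> C (\<lambda>n. primitive (F n))" and hol: "\<And>n. F n holomorphic_on \<D>"
    and M: "VC_essential_norm \<alpha> \<beta> g \<phi> < ennreal M" "0 < M"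
  shows "\<forall>\<^sub>F n in sequentially. \<forall>z\<in>\<D>.
    wt \<beta> z * cmod (deriv (F n) (\<phi> z) * u z + F n (\<phi> z) * w z) \<le> (C + 1) * M"
  using essential_norm_vanishing_sequence[OF \<alpha>_pos F function_operator_axioms
      M(1)[unfolded VC_essential_norm_def] M(2)]
proof eventually_elim
  case (elim n)
  have mem: "primitive (F n) \<in> zygmund \<alpha>" using F by (simp add: vanishing_sequence_def)
  show ?case
  proof
    fix z :: complex assume z: "z \<in> \<D>"
    then have "\<phi> z \<in> \<D>" using \<phi>_disc by simp
    then show "wt \<beta> z * cmod (deriv (F n) (\<phi> z) * u z + F n (\<phi> z) * w z) \<le> (C + 1) * M"
      using VC_norm_lower[OF mem z] elim by (simp add: deriv_primitive[OF hol] deriv2_primitive[OF hol])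
  qed
qed

end

section \<open>Lower bounds from powers\<close>

text \<open>With \<open>s = t / a\<close> this is the \<open>a\<close>-th power of \<open>s \<le> exp s\<close>.\<close>

lemma powr_le_exp:
  assumes "0 < a" "0 \<le> (t::real)"
  shows "t powr a \<le> a powr a * exp t"
proof -
  have "t / a \<le> exp (t / a)" using exp_ge_add_one_self[of "t / a"] by linarith
  then have "(t / a) powr a \<le> exp (t / a) powr a" using assms by (intro powr_mono2) auto
  also have "\<dots> = exp t" using assms by (simp add: powr_def)
  finally have "a powr a * (t / a) powr a \<le> a powr a * exp t" by (intro mult_left_mono) auto
  moreover have "a powr a * (t / a) powr a = t powr a"
    using assms by (simp add: powr_divide)
  ultimately show ?thesis by simp
qed

lemma power_le_exp:
  assumes "0 \<le> x"
  shows "x ^ n \<le> exp (- real n * (1 - x))"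
proof -
  have "x \<le> exp (- (1 - x))" using exp_ge_add_one_self[of "- (1 - x)"] by linarith
  then have "x ^ n \<le> exp (- (1 - x)) ^ n" using assms by (intro power_mono)
  then show ?thesis by (simp add: exp_of_nat_mult[symmetric] algebra_simps)
qed

text \<open>An upper bound for \<open>(1 - x\<^sup>2)\<^bsup>a\<^esup> (n + 1)\<^bsup>a\<^esup> x\<^bsup>n\<^esup>\<close> over \<open>0 \<le> x < 1\<close> and \<open>n\<close>; its exact value is
  immaterial.\<close>

definition weight_const :: "real \<Rightarrow> real" where
  "weight_const a = exp 1 * (2 * a) powr a"

lemma weight_const_pos: "0 < a \<Longrightarrow> 0 < weight_const a"
  by (simp add: weight_const_def)

text \<open>Since \<open>1 - x\<^sup>2 \<le> 2 (1 - x)\<close> and \<open>x\<^bsup>n\<^esup> \<le> exp (- n (1 - x))\<close>, the expression is controlled by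
  \<open>t\<^bsup>a\<^esup> exp (- t)\<close> with \<open>t = (n + 1) (1 - x)\<close>.\<close>

lemma weighted_power_bound:
  assumes a: "0 < a" and x: "0 \<le> x" "x < 1"
  shows "(1 - x\<^sup>2) powr a * ((real n + 1) powr a * x ^ n) \<le> weight_const a"
proof -
  let ?t = "(real n + 1) * (1 - x)"
  have "1 - x\<^sup>2 \<le> 2 * (1 - x)" using zero_le_power2[of "x - 1"] by (simp add: power2_eq_square algebra_simps)
  moreover have "x\<^sup>2 \<le> 1" using x by (simp add: power_le_one)
  ultimately have "(1 - x\<^sup>2) powr a \<le> (2 * (1 - x)) powr a"
    using a by (intro powr_mono2) auto
  then have "(1 - x\<^sup>2) powr a * ((real n + 1) powr a * x ^ n)
      \<le> (2 * (1 - x)) powr a * ((real n + 1) powr a * exp (- real n * (1 - x)))"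
    using x power_le_exp[OF x(1), of n] by (intro mult_mono mult_nonneg_nonneg) auto
  also have "\<dots> = 2 powr a * (?t powr a * exp (- real n * (1 - x)))"
    by (simp only: powr_mult mult.assoc)
      (simp only: mult.left_commute[of "(1 - x) powr a"])
  also have "\<dots> \<le> 2 powr a * ((a powr a * exp ?t) * exp (- real n * (1 - x)))"
    using x by (intro mult_left_mono mult_right_mono powr_le_exp a) auto
  also have "\<dots> = 2 powr a * a powr a * exp (1 - x)"
    by (simp add: mult.assoc exp_add[symmetric] algebra_simps)
  also have "\<dots> \<le> 2 powr a * a powr a * exp 1" using x by (intro mult_left_mono) auto
  finally show ?thesis using a by (simp add: weight_const_def powr_mult mult_ac)
qed

text \<open>The previous bound for the exponent \<open>a + 1\<close> leaves a factor \<open>1 / (n + 1)\<close>.\<close>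

lemma powr_times_power_tendsto_0:
  assumes "0 < a" "0 \<le> r" "r < 1"
  shows "(\<lambda>n. (real n + 1) powr a * r ^ n) \<longlonglongrightarrow> 0"
proof -
  define c where "c = weight_const (a + 1) / (1 - r\<^sup>2) powr (a + 1)"
  have r: "0 < 1 - r\<^sup>2" using assms by (simp add: power_less_one_iff abs_square_less_1)
  have le: "(real n + 1) powr a * r ^ n \<le> c * (1 / (real n + 1))" for n
  proof -
    have "(1 - r\<^sup>2) powr (a + 1) * ((real n + 1) powr (a + 1) * r ^ n) \<le> weight_const (a + 1)"
      using assms by (intro weighted_power_bound) auto
    then have "(real n + 1) powr (a + 1) * r ^ n \<le> c" using r by (simp add: c_def field_simps)
    moreover have "(real n + 1) powr (a + 1) * r ^ n = (real n + 1) * ((real n + 1) powr a * r ^ n)"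
      by (simp add: powr_add mult_ac)
    ultimately have "(real n + 1) * ((real n + 1) powr a * r ^ n) \<le> c" by (simp only:)
    then have "(real n + 1) powr a * r ^ n \<le> c / (real n + 1)"
      by (subst pos_le_divide_eq) (auto simp: mult_ac)
    then show ?thesis by simp
  qed
  have lim: "(\<lambda>n. c * (1 / (real n + 1))) \<longlonglongrightarrow> 0"
    by (intro tendsto_mult_right_zero) (use LIMSEQ_inverse_real_of_nat in \<open>simp add: inverse_eq_divide add.commute\<close>)
  show ?thesis
    by (rule tendsto_sandwich[OF _ _ tendsto_const lim]; intro always_eventually allI le)
      (use assms(2) in simp)
qed

text \<open>The factor normalises the monomials, because the weighted supremum of \<open>z\<^bsup>n\<^esup>\<close> has size \<open>n\<^bsup>-a\<^esup>\<close>.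
  Starting at exponent \<open>Suc n\<close> makes all derivatives vanish at \<open>0\<close>.\<close>

lemma vanishing_sequence_powers:
  assumes a: "0 < a"
  defines "F \<equiv> \<lambda>n z. of_real ((real n + 1) powr (a - 1)) * z ^ Suc n"
  shows "vanishing_sequence a (weight_const a) (\<lambda>n. primitive (F n))"
    and "F n holomorphic_on \<D>"
    and "deriv (F n) z = of_real ((real n + 1) powr a) * z ^ n"
proof -
  show hol: "F n holomorphic_on \<D>" for n by (auto simp: F_def intro!: holomorphic_intros)
  show der: "deriv (F n) z = of_real ((real n + 1) powr a) * z ^ n" for n z
  proof (rule DERIV_imp_deriv)
    have "(F n has_field_derivative
        of_real ((real n + 1) powr (a - 1)) * (of_nat (Suc n) * z ^ n)) (at z)"
      unfolding F_def by (rule DERIV_cmult, rule derivative_eq_intros, rule DERIV_ident) simp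
    moreover have "of_real ((real n + 1) powr (a - 1)) * of_nat (Suc n)
        = (of_real ((real n + 1) powr a) :: complex)"
    proof -
      have "(real n + 1) powr (a - 1) * (real n + 1) = (real n + 1) powr a"
        by (simp add: powr_diff)
      moreover have "of_real ((real n + 1) powr (a - 1)) * of_nat (Suc n)
          = (of_real ((real n + 1) powr (a - 1) * (real n + 1)) :: complex)"
        by simp
      ultimately show ?thesis by (simp only:)
    qed
    ultimately show "(F n has_field_derivative of_real ((real n + 1) powr a) * z ^ n) (at z)"
      by (simp only: mult.assoc[symmetric])
  qed
  have mod: "cmod (deriv (F n) z) = (real n + 1) powr a * cmod z ^ n" for n z
    by (simp add: der norm_mult norm_power)
  show "vanishing_sequence a (weight_const a) (\<lambda>n. primitive (F n))"
  proof (rule vanishing_sequence_primitives)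
    show "wt a z * cmod (deriv (F n) z) \<le> weight_const a" if "z \<in> \<D>" for n z
      using weighted_power_bound[OF a, of "cmod z" n] that by (simp add: mod)
    show "\<exists>B. \<forall>z\<in>\<D>. cmod (deriv (F n) z) \<le> B" for n
      by (intro exI[of _ "(real n + 1) powr a"])
        (auto simp: mod intro!: mult_left_le power_le_one)
    fix r e :: real assume r: "0 \<le> r" "r < 1" and e: "0 < e"
    have "\<forall>\<^sub>F n in sequentially. (real n + 1) powr a * r ^ n < e"
      using order_tendstoD(2)[OF powr_times_power_tendsto_0[OF a r]] e by blast
    then show "\<forall>\<^sub>F n in sequentially. \<forall>z. cmod z \<le> r \<longrightarrow> cmod (deriv (F n) z) \<le> e"
    proof eventually_elim
      case (elim n)
      have "(real n + 1) powr a * cmod z ^ n \<le> (real n + 1) powr a * r ^ n" if "cmod z \<le> r" for z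
        using that by (intro mult_left_mono power_mono) auto
      then show ?case unfolding mod using elim by (meson less_imp_le order_trans)
    qed
  qed (use a hol in \<open>auto simp: F_def\<close>)
qed

text \<open>The factor \<open>weight_const a + 1\<close> comes from the test functions, \<open>2 + 2\<^bsup>1-a\<^esup>\<close> from separating the
  two terms, and \<open>4\<^bsup>a\<^esup>\<close> from passing from the exponents \<open>2 k - 1\<close> and \<open>2 k\<close> to arbitrary ones.\<close>

definition lower_const :: "real \<Rightarrow> real" where
  "lower_const a = 4 powr a * (2 + 2 powr (1 - a)) * (weight_const a + 1)"

lemma lower_const_pos: "0 < a \<Longrightarrow> 0 < lower_const a"
  using weight_const_pos[of a] by (auto simp: lower_const_def intro!: mult_pos_pos add_pos_pos)

text \<open>Let \<open>P j\<close> be the combination obtained from the \<open>j\<close>-th power, \<open>A = k\<^bsup>a\<^esup> p\<^bsup>2k-1\<^esup> U\<close> and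
  \<open>B = k\<^bsup>a-1\<^esup> p\<^bsup>2k\<^esup> W\<close>. Then \<open>p\<^bsup>k\<^esup> P k = A + B\<close> and \<open>2\<^bsup>1-a\<^esup> P (2 k) = 2 A + B\<close>, and these two
  equations can be solved for \<open>A\<close> and \<open>B\<close>.\<close>

lemma separate_power_terms:
  fixes p U W :: complex and k :: nat
  assumes k: "1 \<le> k" and p: "cmod p \<le> 1" and v: "0 \<le> v"
    and E: "\<And>j. j \<in> {k, 2 * k} \<Longrightarrow>
      v * cmod (of_real (real j powr a) * p ^ (j - 1) * U + of_real (real j powr (a - 1)) * p ^ j * W) \<le> E"
  shows "real k powr a * (v * cmod U * cmod p ^ (2 * k - 1)) \<le> (1 + 2 powr (1 - a)) * E"
    and "real k powr (a - 1) * (v * cmod W * cmod p ^ (2 * k)) \<le> (2 + 2 powr (1 - a)) * E"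
proof -
  define P where "P j = of_real (real j powr a) * p ^ (j - 1) * U + of_real (real j powr (a - 1)) * p ^ j * W" for j
  define A where "A = of_real (real k powr a) * p ^ (2 * k - 1) * U"
  define B where "B = of_real (real k powr (a - 1)) * p ^ (2 * k) * W"
  have E1: "v * cmod (P k) \<le> E" and E2: "v * cmod (P (2 * k)) \<le> E"
    using E[of k] E[of "2 * k"] by (auto simp: P_def)
  have pk: "p ^ k * p ^ (k - 1) = p ^ (2 * k - 1)" "p ^ k * p ^ k = p ^ (2 * k)"
    using k by (simp_all add: power_add[symmetric] mult_2)
  have P1: "p ^ k * P k = A + B"
    unfolding P_def A_def B_def distrib_left pk[symmetric] by (simp only: mult_ac)
  have pow2: "2 powr (1 - a) * (2 * real k) powr a = 2 * real k powr a"
    "2 powr (1 - a) * (2 * real k) powr (a - 1) = real k powr (a - 1)"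
    by (simp_all add: powr_mult powr_add[symmetric] mult.assoc[symmetric])
  have P2: "of_real (2 powr (1 - a)) * P (2 * k) = 2 * A + B"
  proof -
    have "of_real (2 powr (1 - a)) * P (2 * k) =
        of_real (2 powr (1 - a) * (2 * real k) powr a) * p ^ (2 * k - 1) * U
        + of_real (2 powr (1 - a) * (2 * real k) powr (a - 1)) * p ^ (2 * k) * W"
      by (simp add: P_def algebra_simps)
    then show ?thesis by (simp only: pow2) (simp add: A_def B_def)
  qed
  have b1: "v * cmod (p ^ k * P k) \<le> E"
  proof -
    have "cmod (p ^ k * P k) \<le> cmod (P k)"
      using p by (simp add: norm_mult norm_power mult_left_le_one_le power_le_one)
    then have "v * cmod (p ^ k * P k) \<le> v * cmod (P k)" using v by (rule mult_left_mono)
    then show ?thesis using E1 by simp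
  qed
  have b2: "v * cmod (of_real (2 powr (1 - a)) * P (2 * k)) \<le> 2 powr (1 - a) * E"
    using mult_left_mono[OF E2, of "2 powr (1 - a)"] by (simp add: norm_mult mult_ac)
  have "cmod A \<le> cmod (p ^ k * P k) + cmod (of_real (2 powr (1 - a)) * P (2 * k))"
    using norm_triangle_ineq4[of "2 * A + B" "A + B"] by (simp only: P1 P2) simp
  then have "v * cmod A \<le> v * (cmod (p ^ k * P k) + cmod (of_real (2 powr (1 - a)) * P (2 * k)))"
    using v by (rule mult_left_mono)
  then have "v * cmod A \<le> (1 + 2 powr (1 - a)) * E" using b1 b2 by (simp only: distrib_left distrib_right)
  then show "real k powr a * (v * cmod U * cmod p ^ (2 * k - 1)) \<le> (1 + 2 powr (1 - a)) * E"
    by (simp add: A_def norm_mult norm_power mult_ac)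
  have "cmod B \<le> 2 * cmod (p ^ k * P k) + cmod (of_real (2 powr (1 - a)) * P (2 * k))"
    using norm_triangle_ineq4[of "2 * (A + B)" "2 * A + B"] norm_mult[of 2 "A + B"]
    by (simp only: P1 P2) simp
  then have "v * cmod B \<le> v * (2 * cmod (p ^ k * P k) + cmod (of_real (2 powr (1 - a)) * P (2 * k)))"
    using v by (rule mult_left_mono)
  then have "v * cmod B \<le> (2 + 2 powr (1 - a)) * E" using b1 b2 by (simp add: distrib_left distrib_right)
  then show "real k powr (a - 1) * (v * cmod W * cmod p ^ (2 * k)) \<le> (2 + 2 powr (1 - a)) * E"
    by (simp add: B_def norm_mult norm_power mult_ac)
qed

context bounded_VC
begin

text \<open>Separation gives the estimates along \<open>2 k - 1\<close> and \<open>2 k\<close>. They extend to all exponents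
  because \<open>\<bar>\<phi>\<bar>\<^bsup>n\<^esup>\<close> decreases in \<open>n\<close> while the power of \<open>n + 1\<close> changes by a bounded factor only.\<close>

lemma essential_norm_lower_powers:
  assumes M: "VC_essential_norm \<alpha> \<beta> g \<phi> < ennreal M" "0 < M"
  shows "\<forall>\<^sub>F n in sequentially. \<forall>z\<in>\<D>.
      (real n + 1) powr \<alpha> * (wt \<beta> z * cmod (u z * \<phi> z ^ n)) \<le> lower_const \<alpha> * M" (is ?U)
    and "1 \<le> \<alpha> \<Longrightarrow> \<forall>\<^sub>F n in sequentially. \<forall>z\<in>\<D>.
      (real n + 1) powr (\<alpha> - 1) * (wt \<beta> z * cmod (w z * \<phi> z ^ n)) \<le> lower_const \<alpha> * M" (is "_ \<Longrightarrow> ?W")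
proof -
  define E where "E = (weight_const \<alpha> + 1) * M"
  have E0: "0 \<le> E" using weight_const_pos[OF \<alpha>_pos] M(2) by (simp add: E_def)
  have "\<forall>\<^sub>F n in sequentially. \<forall>z\<in>\<D>.
    wt \<beta> z * cmod (of_real ((real n + 1) powr \<alpha>) * \<phi> z ^ n * u z
      + of_real ((real n + 1) powr (\<alpha> - 1)) * \<phi> z ^ Suc n * w z) \<le> E"
    using essential_norm_test_derivatives[OF vanishing_sequence_powers(1,2)[OF \<alpha>_pos] M]
    by (simp only: vanishing_sequence_powers(3)[OF \<alpha>_pos] E_def)
  then obtain N where N: "\<And>n z. n \<ge> N \<Longrightarrow> z \<in> \<D> \<Longrightarrow>
    wt \<beta> z * cmod (of_real ((real n + 1) powr \<alpha>) * \<phi> z ^ n * u z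
      + of_real ((real n + 1) powr (\<alpha> - 1)) * \<phi> z ^ Suc n * w z) \<le> E"
    unfolding eventually_sequentially by blast
  have N': "wt \<beta> z * cmod (of_real (real j powr \<alpha>) * \<phi> z ^ (j - 1) * u z
      + of_real (real j powr (\<alpha> - 1)) * \<phi> z ^ j * w z) \<le> E" if "j \<ge> Suc N" "z \<in> \<D>" for j z
  proof -
    from that(1) obtain n where n: "j = Suc n" "n \<ge> N" by (cases j) auto
    have "real (Suc n) = real n + 1" by simp
    then show ?thesis using N[OF n(2) that(2)] by (simp only: n(1) diff_Suc_1)
  qed
  have sep: "real k powr \<alpha> * (wt \<beta> z * cmod (u z) * cmod (\<phi> z) ^ (2 * k - 1)) \<le> (1 + 2 powr (1 - \<alpha>)) * E"
    "real k powr (\<alpha> - 1) * (wt \<beta> z * cmod (w z) * cmod (\<phi> z) ^ (2 * k)) \<le> (2 + 2 powr (1 - \<alpha>)) * E"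
    if k: "k \<ge> Suc N" and z: "z \<in> \<D>" for k z
  proof -
    have k1: "1 \<le> k" using k by simp
    have p: "cmod (\<phi> z) \<le> 1" using \<phi>_disc[of z] z by simp
    have v: "0 \<le> wt \<beta> z" by simp
    have E': "wt \<beta> z * cmod (of_real (real j powr \<alpha>) * \<phi> z ^ (j - 1) * u z
        + of_real (real j powr (\<alpha> - 1)) * \<phi> z ^ j * w z) \<le> E" if "j \<in> {k, 2 * k}" for j
      by (rule N'[OF _ z]) (use that k in auto)
    show "real k powr \<alpha> * (wt \<beta> z * cmod (u z) * cmod (\<phi> z) ^ (2 * k - 1)) \<le> (1 + 2 powr (1 - \<alpha>)) * E"
      "real k powr (\<alpha> - 1) * (wt \<beta> z * cmod (w z) * cmod (\<phi> z) ^ (2 * k)) \<le> (2 + 2 powr (1 - \<alpha>)) * E"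
      by (rule separate_power_terms[OF k1 p v E']; assumption)+
  qed
  have const: "lower_const \<alpha> * M = 4 powr \<alpha> * ((2 + 2 powr (1 - \<alpha>)) * E)"
    by (simp add: lower_const_def E_def)
  have low: "(real n + 1) powr c * (v * x ^ n) \<le> lower_const \<alpha> * M"
    if le: "real k powr c * (v * x ^ m) \<le> (2 + 2 powr (1 - \<alpha>)) * E"
      and "m \<le> n" "n + 1 \<le> 4 * k" "0 \<le> x" "x \<le> 1" "0 \<le> v" "0 \<le> c" "c \<le> \<alpha>" for c v x k m n
  proof -
    have "(real n + 1) powr c \<le> (4 * real k) powr c" using that by (intro powr_mono2) auto
    also have "\<dots> = 4 powr c * real k powr c" by (simp add: powr_mult)
    also have "\<dots> \<le> 4 powr \<alpha> * real k powr c" using that by (intro mult_right_mono powr_mono) auto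
    finally have "(real n + 1) powr c * (v * x ^ n) \<le> (4 powr \<alpha> * real k powr c) * (v * x ^ m)"
      using that by (intro mult_mono mult_left_mono power_decreasing) auto
    also have "\<dots> \<le> 4 powr \<alpha> * ((2 + 2 powr (1 - \<alpha>)) * E)"
      using le by (simp only: mult.assoc) (intro mult_left_mono, auto)
    finally show ?thesis by (simp add: const)
  qed
  have x: "cmod (\<phi> z) \<le> 1" if "z \<in> \<D>" for z using \<phi>_disc[of z] that by simp
  show ?U
    using eventually_ge_at_top[of "2 * N + 2"]
  proof eventually_elim
    case (elim n)
    define k where "k = (n + 1) div 2"
    have "2 * k \<le> n + 1" "n \<le> 2 * k" by (auto simp: k_def)
    then have k: "k \<ge> Suc N" "2 * k - 1 \<le> n" "n + 1 \<le> 4 * k" using elim by linarith+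
    show ?case
    proof
      fix z :: complex assume z: "z \<in> \<D>"
      have "(1 + 2 powr (1 - \<alpha>)) * E \<le> (2 + 2 powr (1 - \<alpha>)) * E"
        using E0 by (intro mult_right_mono) auto
      then show "(real n + 1) powr \<alpha> * (wt \<beta> z * cmod (u z * \<phi> z ^ n)) \<le> lower_const \<alpha> * M"
        using low[OF order_trans[OF sep(1)[OF k(1) z]] k(2,3)] x[OF z] \<alpha>_pos
        by (simp add: norm_mult norm_power mult.assoc)
    qed
  qed
  show ?W if "1 \<le> \<alpha>"
    using eventually_ge_at_top[of "2 * N + 2"]
  proof eventually_elim
    case (elim n)
    define k where "k = n div 2"
    have n: "2 * k \<le> n" "n \<le> 2 * k + 1" by (auto simp: k_def)
    then have "k \<ge> Suc N" using elim by linarith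
    with n have k: "k \<ge> Suc N" "2 * k \<le> n" "n + 1 \<le> 4 * k" by linarith+
    show ?case
      using low[OF sep(2)[OF k(1)] k(2,3)] x that
      by (simp add: norm_mult norm_power mult.assoc)
  qed
qed

end

section \<open>The logarithmic lower bound\<close>

text \<open>A partial sum of \<open>- log (1 - z)\<close>.\<close>

definition log_poly :: "nat \<Rightarrow> complex \<Rightarrow> complex" where
  "log_poly N z = (\<Sum>k=1..N. z ^ k / of_nat k)"

lemma log_poly_0: "log_poly N 0 = 0"
  unfolding log_poly_def by (rule sum.neutral) auto

lemma log_poly_deriv:
  "(log_poly N has_field_derivative (\<Sum>k<N. z ^ k)) (at z)"
proof -
  have "(log_poly N has_field_derivative (\<Sum>k=1..N. of_nat k * z ^ (k - 1) / of_nat k)) (at z)"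
    unfolding log_poly_def by (auto intro!: derivative_eq_intros sum.cong)
  also have "(\<Sum>k=1..N. of_nat k * z ^ (k - 1) / of_nat k) = (\<Sum>k=1..N. z ^ (k - 1))"
    by (intro sum.cong) auto
  also have "\<dots> = (\<Sum>k<N. z ^ k)"
    by (rule sum.reindex_bij_witness[of _ Suc "\<lambda>k. k - 1"]) auto
  finally show ?thesis .
qed

lemma norm_geometric_le:
  fixes z :: complex
  assumes "cmod z < 1"
  shows "cmod (\<Sum>k<N. z ^ k) \<le> real N" "cmod (\<Sum>k<N. z ^ k) \<le> 1 / (1 - cmod z)"
proof -
  have le: "cmod (\<Sum>k<N. z ^ k) \<le> (\<Sum>k<N. cmod z ^ k)"
    by (rule sum_norm_le) (simp add: norm_power)
  have "(\<Sum>k<N. cmod z ^ k) \<le> (\<Sum>k<N. 1)" using assms by (intro sum_mono power_le_one) auto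
  then show "cmod (\<Sum>k<N. z ^ k) \<le> real N" using le by simp
  have "(\<Sum>k<N. cmod z ^ k) = (1 - cmod z ^ N) / (1 - cmod z)"
    using assms by (simp add: sum_gp_strict)
  also have "\<dots> \<le> 1 / (1 - cmod z)" using assms by (intro divide_right_mono) auto
  finally show "cmod (\<Sum>k<N. z ^ k) \<le> 1 / (1 - cmod z)" using le by simp
qed

lemma norm_log_poly_le:
  assumes z: "cmod z < 1"
  shows "cmod (log_poly N z) \<le> harm N" "cmod (log_poly N z) \<le> 1 / (1 - cmod z)"
proof -
  have "cmod (log_poly N z) \<le> (\<Sum>k=1..N. cmod z ^ k / real k)"
    unfolding log_poly_def by (rule sum_norm_le) (simp add: norm_divide norm_power)
  also have "\<dots> \<le> (\<Sum>k=1..N. 1 / real k)"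
    using z by (intro sum_mono divide_right_mono power_le_one) auto
  finally show "cmod (log_poly N z) \<le> harm N" by (simp add: harm_def inverse_eq_divide)
  have "cmod (log_poly N z) \<le> (\<Sum>k=1..N. cmod z ^ (k - 1))"
    unfolding log_poly_def
  proof (rule sum_norm_le)
    fix k assume k: "k \<in> {1..N}"
    have "cmod z ^ k / real k \<le> cmod z ^ k / 1" using k by (intro divide_left_mono) auto
    also have "\<dots> \<le> cmod z ^ (k - 1)" using z by (simp add: power_decreasing)
    finally show "cmod (z ^ k / of_nat k) \<le> cmod z ^ (k - 1)" by (simp add: norm_divide norm_power)
  qed
  also have "\<dots> = (\<Sum>k<N. cmod z ^ k)"
    by (rule sum.reindex_bij_witness[of _ Suc "\<lambda>k. k - 1"]) auto
  also have "\<dots> = (1 - cmod z ^ N) / (1 - cmod z)" using z by (simp add: sum_gp_strict)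
  also have "\<dots> \<le> 1 / (1 - cmod z)" using z by (intro divide_right_mono) auto
  finally show "cmod (log_poly N z) \<le> 1 / (1 - cmod z)" .
qed

text \<open>On the positive axis nothing cancels: every power is at least \<open>x\<^bsup>N\<^esup>\<close>, which leaves a harmonic
  sum.\<close>

lemma log_poly_real_lower:
  assumes x: "0 \<le> x" "x \<le> 1" and N: "0 < N"
  shows "x ^ N * ln (real N) \<le> cmod (log_poly N (of_real x))"
proof -
  have "ln (real N) \<le> harm N"
  proof -
    have "ln (real N) \<le> ln (real (N + 1))" using N by simp
    also have "\<dots> \<le> harm N" using ln_le_harm[of N] by (simp add: add.commute)
    finally show ?thesis .
  qed
  then have "x ^ N * ln (real N) \<le> x ^ N * harm N" using x by (intro mult_left_mono) auto
  also have "\<dots> = (\<Sum>k=1..N. x ^ N / real k)" by (simp add: harm_def sum_distrib_left inverse_eq_divide)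
  also have "\<dots> \<le> (\<Sum>k=1..N. x ^ k / real k)"
    using x by (intro sum_mono divide_right_mono power_decreasing) auto
  also have "\<dots> \<le> cmod (of_real (\<Sum>k=1..N. x ^ k / real k))" by (simp only: norm_of_real abs_ge_self)
  also have "of_real (\<Sum>k=1..N. x ^ k / real k) = log_poly N (of_real x)" by (simp add: log_poly_def)
  finally show ?thesis .
qed

lemma ln_ge_1: "3 \<le> N \<Longrightarrow> 1 \<le> ln (real N)"
  using exp_le by (subst ln_ge_iff) auto

lemma harm_le_2_ln: "3 \<le> N \<Longrightarrow> harm N \<le> 2 * ln (real N)"
  using decseqD[OF decseq_harm_diff_ln, of 0 "N - 1"] ln_ge_1[of N] by (simp add: harm_def)

text \<open>Squaring and dividing by \<open>ln N\<close> keeps the size \<open>ln N\<close> near the point \<open>1 / c\<close>, where the partial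
  sum itself has size \<open>ln N\<close>, and it forces local convergence to \<open>0\<close>, which the partial sums
  do not have. The derivative gains only the bounded factor \<open>2 log_poly N / ln N\<close>.\<close>

definition log_test :: "nat \<Rightarrow> complex \<Rightarrow> complex \<Rightarrow> complex" where
  "log_test N c z = (log_poly N (c * z))\<^sup>2 / of_real (ln (real N))"

lemma deriv_log_test:
  "(log_test N c has_field_derivative
      2 * log_poly N (c * z) * (\<Sum>k<N. (c * z) ^ k) * c / of_real (ln (real N))) (at z)"
proof -
  have "((\<lambda>z. c * z) has_field_derivative c) (at z)"
    using DERIV_cmult[OF DERIV_ident, of c] by simp
  from DERIV_chain2[OF log_poly_deriv this]
  have "((\<lambda>z. log_poly N (c * z)) has_field_derivative (\<Sum>k<N. (c * z) ^ k) * c) (at z)" .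
  from DERIV_cdivide[OF DERIV_power[OF this, of 2], of "of_real (ln (real N))"]
  show ?thesis unfolding log_test_def by (simp add: mult_ac)
qed

lemma log_test_holomorphic: "log_test N c holomorphic_on A"
  using deriv_log_test by (meson field_differentiable_at_within field_differentiable_def holomorphic_on_def)

lemma norm_deriv_log_test:
  "cmod c = 1 \<Longrightarrow> cmod (deriv (log_test N c) z)
    = 2 * cmod (log_poly N (c * z)) * cmod (\<Sum>k<N. (c * z) ^ k) / \<bar>ln (real N)\<bar>"
  unfolding DERIV_imp_deriv[OF deriv_log_test] by (simp add: norm_mult norm_divide)

text \<open>The shift by \<open>3\<close> ensures \<open>ln N \<ge> 1\<close>, so that harmonic sums are at most \<open>2 ln N\<close>. The rotations
  \<open>c n\<close> are arbitrary, so they may be adapted to an operator.\<close>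

lemma vanishing_sequence_log:
  assumes c: "\<And>n. cmod (c n) = 1"
  shows "vanishing_sequence 1 8 (\<lambda>n. primitive (log_test (n + 3) (c n)))"
proof (rule vanishing_sequence_primitives)
  have cz: "cmod (c n * z) = cmod z" for n z by (simp add: norm_mult c)
  have ln: "ln (real (n + 3)) \<ge> 1" for n by (rule ln_ge_1) simp
  show "wt 1 z * cmod (deriv (log_test (n + 3) (c n)) z) \<le> 8" if "z \<in> \<D>" for n z
  proof -
    have z: "cmod z < 1" using that by simp
    have "cmod (log_poly (n + 3) (c n * z)) \<le> 2 * ln (real (n + 3))"
      using norm_log_poly_le(1)[of "c n * z" "n + 3"] harm_le_2_ln[of "n + 3"] z by (simp add: cz)
    moreover have "cmod (\<Sum>k<n+3. (c n * z) ^ k) \<le> 1 / (1 - cmod z)"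
      using norm_geometric_le(2)[of "c n * z" "n + 3"] z by (simp only: cz)
    ultimately have "2 * cmod (log_poly (n + 3) (c n * z)) * cmod (\<Sum>k<n+3. (c n * z) ^ k) / \<bar>ln (real (n + 3))\<bar>
        \<le> 2 * (2 * ln (real (n + 3))) * (1 / (1 - cmod z)) / \<bar>ln (real (n + 3))\<bar>"
      using ln[of n] by (intro divide_right_mono mult_mono) auto
    also have "\<dots> = 4 / (1 - cmod z)" using ln[of n] z by (simp add: field_simps)
    finally have "cmod (deriv (log_test (n + 3) (c n)) z) \<le> 4 / (1 - cmod z)"
      by (simp only: norm_deriv_log_test[OF c])
    then have "wt 1 z * cmod (deriv (log_test (n + 3) (c n)) z) \<le> wt 1 z * (4 / (1 - cmod z))"
      by (intro mult_left_mono) auto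
    also have "\<dots> = 4 * (1 + cmod z)"
    proof -
      have "wt 1 z = (1 - cmod z) * (1 + cmod z)"
        using one_minus_sq_pos[OF z] by (simp add: power2_eq_square algebra_simps)
      then show ?thesis using z by simp
    qed
    also have "\<dots> \<le> 8" using z by simp
    finally show ?thesis .
  qed
  show "\<exists>B. \<forall>z\<in>\<D>. cmod (deriv (log_test (n + 3) (c n)) z) \<le> B" for n
  proof (intro exI ballI)
    fix z :: complex assume "z \<in> \<D>"
    then have z: "cmod (c n * z) < 1" by (simp add: cz)
    show "cmod (deriv (log_test (n + 3) (c n)) z) \<le> 2 * harm (n + 3) * real (n + 3) / \<bar>ln (real (n + 3))\<bar>"
      unfolding norm_deriv_log_test[OF c]
      by (intro divide_right_mono mult_mono norm_log_poly_le[OF z] norm_geometric_le[OF z])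
        (auto intro!: harm_nonneg)
  qed
  fix r e :: real assume r: "0 \<le> r" "r < 1" and e: "0 < e"
  have "filterlim (\<lambda>n. ln (real (n + 3))) at_top sequentially"
    by (intro filterlim_compose[OF ln_at_top] filterlim_compose[OF filterlim_real_sequentially]
        filterlim_add_const_nat_at_top)
  then have "\<forall>\<^sub>F n in sequentially. 2 * (1 / (1 - r)) * (1 / (1 - r)) / e \<le> ln (real (n + 3))"
    by (simp add: filterlim_at_top)
  then show "\<forall>\<^sub>F n in sequentially. \<forall>z. cmod z \<le> r \<longrightarrow> cmod (deriv (log_test (n + 3) (c n)) z) \<le> e"
  proof eventually_elim
    case (elim n)
    show ?case
    proof (intro allI impI)
      fix z assume z: "cmod z \<le> r"
      then have z1: "cmod (c n * z) < 1" using r by (simp add: cz)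
      have mono: "1 / (1 - cmod (c n * z)) \<le> 1 / (1 - r)"
        using z r by (intro divide_left_mono) (auto simp: cz)
      have "cmod (deriv (log_test (n + 3) (c n)) z)
          \<le> 2 * (1 / (1 - r)) * (1 / (1 - r)) / \<bar>ln (real (n + 3))\<bar>"
        unfolding norm_deriv_log_test[OF c]
        by (intro divide_right_mono mult_mono order_trans[OF norm_log_poly_le(2)[OF z1] mono]
            order_trans[OF norm_geometric_le(2)[OF z1] mono]) (use r in auto)
      also have "\<dots> \<le> e"
      proof -
        have L: "0 < ln (real (n + 3))" using ln[of n] by linarith
        have "2 * (1 / (1 - r)) * (1 / (1 - r)) \<le> e * ln (real (n + 3))"
          using elim by (simp only: pos_divide_le_eq[OF e] mult.commute[of e])
        then show ?thesis by (simp only: abs_of_pos[OF L] pos_divide_le_eq[OF L])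
      qed
      finally show "cmod (deriv (log_test (n + 3) (c n)) z) \<le> e" .
    qed
  qed
qed (simp_all add: log_test_holomorphic, simp add: log_test_def log_poly_0)

text \<open>Here \<open>9 = 8 + 1\<close> comes from the test functions, \<open>4 lower_const 1\<close> from the \<open>u\<close> term that has to
  be removed, and the factor \<open>2\<close> from replacing \<open>ln N\<close> by \<open>ln (3 N + 2)\<close>.\<close>

definition log_const :: real where
  "log_const = 2 * (9 + 4 * lower_const 1)"

lemma log_const_pos: "0 < log_const"
  using lower_const_pos[of 1] by (simp add: log_const_def)

context bounded_VC
begin

text \<open>Fix \<open>N\<close> and a point \<open>z\<close>, and rotate the test function so that \<open>\<phi> z\<close> is moved to
  \<open>x = \<bar>\<phi> z\<bar>\<close>. There the test derivative is at least \<open>x\<^bsup>2N\<^esup> ln N\<close> and its derivative at most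
  \<open>4 N\<close>. After multiplication by \<open>x\<^bsup>N\<^esup>\<close> the \<open>u\<close> term is \<open>N \<bar>u\<bar> x\<^bsup>N\<^esup>\<close>, which the power test functions
  control. What remains is the estimate for \<open>w\<close> with exponent \<open>3 N\<close>.

  A vanishing sequence allows one rotation for each \<open>N\<close> only. So the point is chosen to
  violate the desired estimate whenever some point does; the estimate at the chosen points then
  implies it everywhere.\<close>

lemma essential_norm_lower_log:
  assumes \<alpha>: "\<alpha> = 1" and M: "VC_essential_norm \<alpha> \<beta> g \<phi> < ennreal M" "0 < M"
  shows "\<forall>\<^sub>F n in sequentially. \<forall>z\<in>\<D>.
    ln (real n) * (wt \<beta> z * cmod (w z * \<phi> z ^ n)) \<le> log_const * M"
proof -
  define R where "R = (9 + 4 * lower_const 1) * M"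
  define Q where "Q N z \<longleftrightarrow> wt \<beta> z * cmod (w z) * cmod (\<phi> z) ^ (3 * N) * ln (real N) \<le> R" for N z
  have "\<exists>y\<in>\<D>. Q (n + 3) y \<longrightarrow> (\<forall>z\<in>\<D>. Q (n + 3) z)" for n
    using centre_in_ball[of "0 :: complex" 1] zero_less_one by blast
  then obtain \<zeta> where \<zeta>: "\<And>n. \<zeta> n \<in> \<D>" "\<And>n z. Q (n + 3) (\<zeta> n) \<Longrightarrow> z \<in> \<D> \<Longrightarrow> Q (n + 3) z"
    by metis
  have "\<exists>c. cmod c = 1 \<and> c * p = of_real (cmod p)" for p :: complex
  proof (cases "p = 0")
    case False
    then show ?thesis
      by (intro exI[of _ "of_real (cmod p) / p"]) (simp add: norm_divide)
  qed (auto intro: exI[of _ 1])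
  then obtain d where d: "\<And>p. cmod (d p) = 1 \<and> d p * p = of_real (cmod p)" by metis
  define c where "c n = d (\<phi> (\<zeta> n))" for n
  have c: "cmod (c n) = 1" "c n * \<phi> (\<zeta> n) = of_real (cmod (\<phi> (\<zeta> n)))" for n
    using d by (auto simp: c_def)
  let ?F = "\<lambda>n. log_test (n + 3) (c n)"
  have vs: "vanishing_sequence \<alpha> 8 (\<lambda>n. primitive (?F n))" unfolding \<alpha> by (rule vanishing_sequence_log[OF c(1)])
  have "\<forall>\<^sub>F n in sequentially. \<forall>z\<in>\<D>.
      wt \<beta> z * cmod (deriv (?F n) (\<phi> z) * u z + ?F n (\<phi> z) * w z) \<le> (8 + 1) * M"
    by (rule essential_norm_test_derivatives[OF vs log_test_holomorphic M])
  moreover have "\<forall>\<^sub>F n in sequentially. \<forall>z\<in>\<D>.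
      (real (n + 3) + 1) powr 1 * (wt \<beta> z * cmod (u z * \<phi> z ^ (n + 3))) \<le> lower_const 1 * M"
    using essential_norm_lower_powers(1)[OF M]
    unfolding \<alpha> by (subst eventually_sequentially_seg)
  ultimately have "\<forall>\<^sub>F n in sequentially. Q (n + 3) (\<zeta> n)"
  proof eventually_elim
    case (elim n)
    define N where "N = n + 3"
    define z where "z = \<zeta> n"
    define x where "x = cmod (\<phi> z)"
    have z: "z \<in> \<D>" using \<zeta>(1) by (simp add: z_def)
    have x: "0 \<le> x" "x < 1" using \<phi>_disc[of z] z by (auto simp: x_def)
    have cx: "c n * \<phi> z = of_real x" using c(2) by (simp add: z_def x_def)
    have N: "3 \<le> N" by (simp add: N_def)
    have L: "1 \<le> ln (real N)" by (rule ln_ge_1[OF N])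
    have E: "wt \<beta> z * cmod (deriv (?F n) (\<phi> z) * u z + ?F n (\<phi> z) * w z) \<le> 9 * M"
      using elim(1) z by auto
    have U: "(real N + 1) * (wt \<beta> z * cmod (u z) * x ^ N) \<le> lower_const 1 * M"
      using elim(2) z unfolding N_def[symmetric] by (auto simp: norm_mult norm_power x_def mult.assoc)
    have F: "x ^ (2 * N) * ln (real N) \<le> cmod (?F n (\<phi> z))"
    proof -
      have "(x ^ N * ln (real N))\<^sup>2 \<le> (cmod (log_poly N (of_real x)))\<^sup>2"
        using x N L by (intro power_mono log_poly_real_lower) auto
      then have "(x ^ N * ln (real N))\<^sup>2 / ln (real N) \<le> (cmod (log_poly N (of_real x)))\<^sup>2 / ln (real N)"
        using L by (intro divide_right_mono) auto
      moreover have "(x ^ N * ln (real N))\<^sup>2 / ln (real N) = x ^ (2 * N) * ln (real N)"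
        using L by (simp add: power2_eq_square power_add mult_2)
      ultimately show ?thesis
        using L by (simp add: log_test_def cx N_def[symmetric] norm_divide norm_power)
    qed
    have F': "cmod (deriv (?F n) (\<phi> z)) \<le> 4 * real N"
    proof -
      have xx: "cmod (of_real x) < 1" using x by simp
      have "cmod (deriv (?F n) (\<phi> z)) \<le> 2 * (2 * ln (real N)) * real N / \<bar>ln (real N)\<bar>"
        unfolding norm_deriv_log_test[OF c(1)] cx N_def[symmetric]
        by (intro divide_right_mono mult_mono order_trans[OF norm_log_poly_le(1)[OF xx] harm_le_2_ln[OF N]]
            norm_geometric_le(1)[OF xx]) (use L in auto)
      then show ?thesis using L by simp
    qed
    have "x ^ (2 * N) * ln (real N) * cmod (w z) \<le> cmod (?F n (\<phi> z) * w z)"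
      using F by (simp add: norm_mult mult_right_mono)
    also have "\<dots> \<le> cmod (deriv (?F n) (\<phi> z) * u z + ?F n (\<phi> z) * w z) + cmod (deriv (?F n) (\<phi> z) * u z)"
      using norm_triangle_ineq4[of "deriv (?F n) (\<phi> z) * u z + ?F n (\<phi> z) * w z" "deriv (?F n) (\<phi> z) * u z"]
      by simp
    also have "cmod (deriv (?F n) (\<phi> z) * u z) \<le> 4 * real N * cmod (u z)"
      unfolding norm_mult[of "deriv (?F n) (\<phi> z)"] by (intro mult_right_mono F') auto
    finally have "wt \<beta> z * (x ^ (2 * N) * ln (real N) * cmod (w z))
        \<le> wt \<beta> z * (cmod (deriv (?F n) (\<phi> z) * u z + ?F n (\<phi> z) * w z) + 4 * real N * cmod (u z))"
      by (intro mult_left_mono) auto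
    then have "wt \<beta> z * (x ^ (2 * N) * ln (real N) * cmod (w z)) \<le> 9 * M + wt \<beta> z * (4 * real N * cmod (u z))"
      using E by (simp only: distrib_left)
    then have "x ^ N * (wt \<beta> z * (x ^ (2 * N) * ln (real N) * cmod (w z)))
        \<le> x ^ N * (9 * M + wt \<beta> z * (4 * real N * cmod (u z)))"
      using x by (intro mult_left_mono) auto
    also have "\<dots> = x ^ N * (9 * M) + 4 * (real N * (wt \<beta> z * cmod (u z) * x ^ N))"
      by (simp add: algebra_simps)
    also have "x ^ N * (9 * M) \<le> 9 * M" using x M(2) by (intro mult_left_le_one_le power_le_one) auto
    also have "real N * (wt \<beta> z * cmod (u z) * x ^ N) \<le> lower_const 1 * M"
      by (rule order_trans[OF _ U]) (intro mult_right_mono, use x in auto)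
    finally have "x ^ N * (wt \<beta> z * (x ^ (2 * N) * ln (real N) * cmod (w z))) \<le> R"
      by (simp add: R_def algebra_simps)
    moreover have "x ^ (3 * N) = x ^ N * x ^ (2 * N)" by (simp add: power_add[symmetric])
    ultimately have "Q N z" unfolding Q_def x_def[symmetric] by (simp only: mult_ac)
    then show ?case by (simp add: N_def z_def)
  qed
  then obtain N0 where N0: "\<And>n z. n \<ge> N0 \<Longrightarrow> z \<in> \<D> \<Longrightarrow> Q (n + 3) z"
    using \<zeta>(2) unfolding eventually_sequentially by blast
  show ?thesis
    using eventually_ge_at_top[of "3 * N0 + 12"]
  proof eventually_elim
    case (elim m)
    define N where "N = m div 3"
    have m: "3 * N \<le> m" "m \<le> 3 * N + 2" by (auto simp: N_def)
    then have N: "N \<ge> N0 + 3" "N \<ge> 4" using elim by linarith+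
    have "ln (real m) \<le> ln ((real N)\<^sup>2)"
    proof -
      have "real m \<le> 3 * real N + 2" using m by linarith
      also have "\<dots> \<le> 4 * real N" using N by simp
      also have "\<dots> \<le> (real N)\<^sup>2" using N unfolding power2_eq_square by (intro mult_right_mono) auto
      finally show ?thesis using elim by (subst ln_le_cancel_iff) (use N in auto)
    qed
    then have lm: "ln (real m) \<le> 2 * ln (real N)" using N by (simp add: ln_realpow)
    show ?case
    proof
      fix z :: complex assume z: "z \<in> \<D>"
      have Q: "wt \<beta> z * cmod (w z) * cmod (\<phi> z) ^ (3 * N) * ln (real N) \<le> R"
        using N0[of "N - 3" z] N z by (simp add: Q_def)
      have "ln (real m) * (wt \<beta> z * cmod (w z * \<phi> z ^ m))
          = ln (real m) * (wt \<beta> z * cmod (w z) * cmod (\<phi> z) ^ m)"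
        by (simp add: norm_mult norm_power)
      also have "\<dots> \<le> (2 * ln (real N)) * (wt \<beta> z * cmod (w z) * cmod (\<phi> z) ^ (3 * N))"
        using lm m(1) N \<phi>_disc[of z] z by (intro mult_mono mult_left_mono power_decreasing) auto
      also have "\<dots> \<le> 2 * R" using Q by (simp add: mult_ac)
      finally show "ln (real m) * (wt \<beta> z * cmod (w z * \<phi> z ^ m)) \<le> log_const * M"
        by (simp add: log_const_def R_def algebra_simps)
    qed
  qed
qed

end

section \<open>Approximation by finite rank operators\<close>

text \<open>The Taylor coefficients of \<open>f'\<close>. The image of \<open>f\<close> under \<open>VC\<close> depends on \<open>f'\<close> only, so
  approximating \<open>f'\<close> suffices and the constant term of \<open>f\<close> is left alone.\<close>

definition deriv_coeff :: "nat \<Rightarrow> (complex \<Rightarrow> complex) \<Rightarrow> complex" where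
  "deriv_coeff k f = (deriv ^^ Suc k) f 0 / fact k"

text \<open>The primitive of a Taylor polynomial of \<open>f'(\<rho> z)\<close>.\<close>

definition dilated_taylor :: "real \<Rightarrow> nat \<Rightarrow> (complex \<Rightarrow> complex) \<Rightarrow> complex \<Rightarrow> complex" where
  "dilated_taylor \<rho> N f z = (\<Sum>k<N. (deriv_coeff k f * of_real \<rho> ^ k) * primitive (\<lambda>z. z ^ k) z)"

lemma wt_neg_eq: "wt (- a) z = 1 / wt a z"
  by (simp add: powr_minus_divide)

lemma wt_neg_mono:
  assumes "0 \<le> a" "cmod y \<le> r" "r < 1" "0 \<le> r"
  shows "wt (- a) y \<le> (1 - r\<^sup>2) powr (- a)"
proof -
  have "(cmod y)\<^sup>2 \<le> r\<^sup>2" using assms by (intro power_mono) auto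
  moreover have "r\<^sup>2 < 1" using assms by (simp add: power_less_one_iff abs_square_less_1)
  ultimately show ?thesis using assms by (intro powr_mono2') auto
qed

lemma zygmund_unit_ball_deriv2:
  assumes "f \<in> zygmund a" "zygmund_norm a f \<le> 1" "z \<in> \<D>"
  shows "cmod (deriv2 f z) \<le> wt (- a) z"
proof -
  have "wt a z * cmod (deriv2 f z) \<le> 1" using zygmund_bounds(3)[OF assms(1,3)] assms(2) by simp
  moreover have "0 < wt a z" using one_minus_sq_pos[of z] assms(3) by simp
  ultimately show ?thesis using assms(3) by (simp add: wt_neg_eq field_simps)
qed

text \<open>Cauchy's inequality on the circle of radius \<open>s\<close>.\<close>

lemma deriv2_taylor_coeff_bound:
  assumes a: "0 \<le> a" and f: "f \<in> zygmund a" "zygmund_norm a f \<le> 1" and s: "0 < s" "s < 1"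
  shows "cmod ((deriv ^^ m) (deriv2 f) 0 / fact m) \<le> (1 - s\<^sup>2) powr (- a) / s ^ m"
proof -
  have hol: "deriv2 f holomorphic_on \<D>" using zygmund_H_disc[OF f(1)] by (rule deriv2_holomorphic)
  have "cmod ((deriv ^^ m) (deriv2 f) 0) \<le> fact m * (1 - s\<^sup>2) powr (- a) / s ^ m"
  proof (rule Cauchy_inequality)
    show "deriv2 f holomorphic_on ball 0 s" "continuous_on (cball 0 s) (deriv2 f)"
      using hol s by (auto intro!: holomorphic_on_imp_continuous_on elim!: holomorphic_on_subset)
    fix x :: complex assume x: "norm (0 - x) = s"
    then show "norm (deriv2 f x) \<le> (1 - s\<^sup>2) powr (- a)"
      using zygmund_unit_ball_deriv2[OF f, of x] s by simp
  qed (rule s)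
  then show ?thesis by (simp add: norm_divide field_simps)
qed

lemma deriv_coeff_Suc: "deriv_coeff (Suc m) f = (deriv ^^ m) (deriv2 f) 0 / fact m / of_nat (Suc m)"
proof -
  have "(deriv ^^ Suc (Suc m)) f = (deriv ^^ m) (deriv2 f)"
    by (metis add_2_eq_Suc' comp_apply funpow_add)
  then show ?thesis by (simp add: deriv_coeff_def mult.commute)
qed

lemma deriv_coeff_bound:
  assumes a: "0 \<le> a" and f: "f \<in> zygmund a" "zygmund_norm a f \<le> 1"
  shows "cmod (deriv_coeff k f) \<le> 1 + (3 / 4) powr (- a) * 2 ^ k"
proof (cases k)
  case 0
  have "cmod (deriv f 0) \<le> 1" using zygmund_bounds(2)[OF f(1)] f(2) by simp
  then show ?thesis by (simp add: 0 deriv_coeff_def add_increasing2)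
next
  case (Suc m)
  have "cmod (deriv_coeff k f) = cmod ((deriv ^^ m) (deriv2 f) 0 / fact m) / real (Suc m)"
    unfolding Suc deriv_coeff_Suc norm_divide by (simp only: norm_of_nat)
  also have "\<dots> \<le> cmod ((deriv ^^ m) (deriv2 f) 0 / fact m) / 1"
    by (intro divide_left_mono) auto
  also have "\<dots> \<le> (3 / 4) powr (- a) * 2 ^ m"
    using deriv2_taylor_coeff_bound[OF a f, of "1 / 2" m] by (simp add: power_divide)
  also have "\<dots> \<le> 1 + (3 / 4) powr (- a) * 2 ^ k"
    by (intro add_increasing mult_left_mono power_increasing) (auto simp: Suc)
  finally show ?thesis .
qed

lemma deriv_power_function: "deriv (\<lambda>z. z ^ k) z = of_nat k * (z :: complex) ^ (k - 1)"
  by (rule DERIV_imp_deriv) (auto intro!: derivative_eq_intros)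

lemma power_primitive_H_disc: "primitive (\<lambda>z. z ^ k) \<in> H_disc"
  by (intro primitive_H_disc holomorphic_intros)

lemma power_primitive_zygmund: "0 \<le> a \<Longrightarrow> primitive (\<lambda>z. z ^ k) \<in> zygmund a"
proof (rule primitive_zygmund[where B = "real k"])
  fix z :: complex assume "z \<in> \<D>"
  then have "real k * cmod z ^ (k - 1) \<le> real k" by (intro mult_left_le power_le_one) auto
  then show "cmod (deriv (\<lambda>z. z ^ k) z) \<le> real k" by (simp add: deriv_power_function norm_mult norm_power)
qed (auto intro!: holomorphic_intros)

lemma dilated_taylor_zygmund: "0 \<le> a \<Longrightarrow> dilated_taylor \<rho> N f \<in> zygmund a"
  unfolding dilated_taylor_def
  by (intro zygmund.sum_mem zygmund.scale_mem power_primitive_zygmund)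

lemma
  assumes "z \<in> \<D>"
  shows deriv_dilated_taylor: "deriv (dilated_taylor \<rho> N f) z = (\<Sum>k<N. (deriv_coeff k f * of_real \<rho> ^ k) * z ^ k)"
    and deriv2_dilated_taylor: "deriv2 (dilated_taylor \<rho> (Suc N) f) z
      = of_real \<rho> * (\<Sum>m<N. (deriv ^^ m) (deriv2 f) 0 / fact m * (of_real \<rho> * z) ^ m)"
proof -
  let ?c = "\<lambda>k. deriv_coeff k f * of_real \<rho> ^ k"
  have hol: "(\<lambda>z. z ^ k) holomorphic_on \<D>" for k by (intro holomorphic_intros)
  have gen: "(deriv ^^ n) (dilated_taylor \<rho> N f) z = (\<Sum>k<N. ?c k * (deriv ^^ n) (primitive (\<lambda>z. z ^ k)) z)" for n N
    unfolding dilated_taylor_def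
    using higher_deriv_sum_H_disc[of "{..<N}" "\<lambda>k z. ?c k * primitive (\<lambda>z. z ^ k) z" z n, OF _ assms]
    by (simp only: H_disc_scale[OF power_primitive_H_disc] higher_deriv_scale_H_disc[OF power_primitive_H_disc assms])
  show "deriv (dilated_taylor \<rho> N f) z = (\<Sum>k<N. ?c k * z ^ k)"
    using gen[of 1 N] by (simp add: deriv_primitive[OF hol assms])
  have "deriv2 (dilated_taylor \<rho> (Suc N) f) z = (\<Sum>k<Suc N. ?c k * (of_nat k * z ^ (k - 1)))"
    unfolding gen by (simp only: deriv2_primitive[OF hol assms] deriv_power_function)
  also have "\<dots> = (\<Sum>m<N. ?c (Suc m) * (of_nat (Suc m) * z ^ m))"
    by (subst sum.lessThan_Suc_shift) simp
  also have "\<dots> = (\<Sum>m<N. of_real \<rho> * ((deriv ^^ m) (deriv2 f) 0 / fact m * (of_real \<rho> * z) ^ m))"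
  proof (intro sum.cong refl)
    fix m
    have eq: "deriv_coeff (Suc m) f * of_nat (Suc m) = (deriv ^^ m) (deriv2 f) 0 / fact m"
      unfolding deriv_coeff_Suc by (simp del: of_nat_Suc)
    have "?c (Suc m) * (of_nat (Suc m) * z ^ m)
        = (deriv_coeff (Suc m) f * of_nat (Suc m)) * (of_real \<rho> ^ Suc m * z ^ m)"
      by (simp only: mult_ac)
    also have "\<dots> = of_real \<rho> * ((deriv ^^ m) (deriv2 f) 0 / fact m * (of_real \<rho> * z) ^ m)"
      unfolding eq by (simp add: power_mult_distrib)
    finally show "?c (Suc m) * (of_nat (Suc m) * z ^ m)
        = of_real \<rho> * ((deriv ^^ m) (deriv2 f) 0 / fact m * (of_real \<rho> * z) ^ m)" .
  qed
  finally show "deriv2 (dilated_taylor \<rho> (Suc N) f) z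
      = of_real \<rho> * (\<Sum>m<N. (deriv ^^ m) (deriv2 f) 0 / fact m * (of_real \<rho> * z) ^ m)"
    by (simp only: sum_distrib_left)
qed

text \<open>The coefficients grow at most like \<open>s\<^bsup>-m\<^esup>\<close> for every \<open>s < 1\<close>, so at \<open>\<rho> z\<close> with \<open>\<rho> < s\<close> the tail is
  dominated by a geometric series, uniformly over the unit ball and the disc.\<close>

lemma taylor_tail_bound:
  assumes a: "0 \<le> a" and f: "f \<in> zygmund a" "zygmund_norm a f \<le> 1"
    and s: "0 < s" "s < 1" and \<rho>: "0 \<le> \<rho>" "\<rho> < s" and z: "z \<in> \<D>"
  shows "cmod (deriv2 f (of_real \<rho> * z) - (\<Sum>m<N. (deriv ^^ m) (deriv2 f) 0 / fact m * (of_real \<rho> * z) ^ m))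
    \<le> (1 - s\<^sup>2) powr (- a) * (\<rho> / s) ^ N / (1 - \<rho> / s)"
proof -
  let ?b = "\<lambda>m. (deriv ^^ m) (deriv2 f) 0 / fact m" and ?M = "(1 - s\<^sup>2) powr (- a)"
  have "cmod (of_real \<rho> * z) \<le> \<rho>" using z \<rho> by (simp add: norm_mult mult_left_le)
  then have "of_real \<rho> * z \<in> \<D>" using \<rho> s by simp
  then have "(\<lambda>m. ?b m * (of_real \<rho> * z) ^ m) sums deriv2 f (of_real \<rho> * z)"
    using holomorphic_power_series[OF deriv2_holomorphic[OF zygmund_H_disc[OF f(1)]], of "of_real \<rho> * z"]
    by simp
  then have sums: "(\<lambda>m. ?b (m + N) * (of_real \<rho> * z) ^ (m + N)) sums
      (deriv2 f (of_real \<rho> * z) - (\<Sum>m<N. ?b m * (of_real \<rho> * z) ^ m))"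
    by (rule sums_split_initial_segment)
  have geo: "(\<lambda>m. ?M * (\<rho> / s) ^ (m + N)) sums (?M * (\<rho> / s) ^ N / (1 - \<rho> / s))"
    using sums_mult[OF geometric_sums[of "\<rho> / s"], of "?M * (\<rho> / s) ^ N"] \<rho> s
    by (simp add: power_add mult_ac)
  have "cmod (?b k * (of_real \<rho> * z) ^ k) \<le> ?M * (\<rho> / s) ^ k" for k
  proof -
    have "cmod (?b k * (of_real \<rho> * z) ^ k) = cmod (?b k) * (\<rho> ^ k * cmod z ^ k)"
      by (simp only: norm_mult norm_power power_mult_distrib norm_of_real abs_of_nonneg[OF \<rho>(1)])
    also have "\<dots> \<le> (?M / s ^ k) * (\<rho> ^ k * 1)"
      using z \<rho> s deriv2_taylor_coeff_bound[OF a f s]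
      by (intro mult_mono mult_left_mono power_le_one) auto
    finally show ?thesis by (simp add: power_divide)
  qed
  then show ?thesis using norm_sums_le[OF sums geo] by blast
qed

text \<open>Cauchy's inequality on discs of radius \<open>t - r\<close>, with \<open>t\<close> halfway between \<open>r\<close> and \<open>1\<close>, bounds
  the third derivative on \<open>\<bar>z\<bar> \<le> r\<close> uniformly over the unit ball; then apply the mean value
  inequality.\<close>

lemma dilation_close:
  assumes a: "0 \<le> a" and f: "f \<in> zygmund a" "zygmund_norm a f \<le> 1" and r: "0 \<le> r" "r < 1"
    and \<rho>: "0 \<le> \<rho>" "\<rho> \<le> 1" and z: "cmod z \<le> r"
  defines "t \<equiv> (1 + r) / 2"
  shows "cmod (deriv2 f z - deriv2 f (of_real \<rho> * z)) \<le> (1 - t\<^sup>2) powr (- a) / (t - r) * (1 - \<rho>)"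
proof -
  let ?B = "(1 - t\<^sup>2) powr (- a) / (t - r)"
  have t: "r < t" "t < 1" "0 \<le> t" using r by (auto simp: t_def)
  have hol: "deriv2 f holomorphic_on \<D>" using zygmund_H_disc[OF f(1)] by (rule deriv2_holomorphic)
  have der: "(deriv2 f has_field_derivative deriv (deriv2 f) x) (at x within cball 0 r)"
    and bd: "cmod (deriv (deriv2 f) x) \<le> ?B" if "x \<in> cball 0 r" for x
  proof -
    have x: "cmod x \<le> r" using that by simp
    show "(deriv2 f has_field_derivative deriv (deriv2 f) x) (at x within cball 0 r)"
      using x r by (intro has_field_derivative_at_within[OF holomorphic_derivI[OF hol open_ball]]) simp
    have sub: "cmod y \<le> t" if "dist x y \<le> t - r" for y
      using that x norm_triangle_ineq4[of x "x - y"] by (simp add: dist_norm)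
    have "cmod ((deriv ^^ 1) (deriv2 f) x) \<le> fact 1 * (1 - t\<^sup>2) powr (- a) / (t - r) ^ 1"
    proof (rule Cauchy_inequality)
      have "cball x (t - r) \<subseteq> \<D>" using sub t by fastforce
      then show "deriv2 f holomorphic_on ball x (t - r)" "continuous_on (cball x (t - r)) (deriv2 f)"
        using hol by (auto intro!: holomorphic_on_imp_continuous_on elim!: holomorphic_on_subset)
      fix y assume "norm (x - y) = t - r"
      then have y: "cmod y \<le> t" using sub[of y] by (simp add: dist_norm)
      then have "cmod (deriv2 f y) \<le> wt (- a) y" using t by (intro zygmund_unit_ball_deriv2[OF f]) auto
      also have "\<dots> \<le> (1 - t\<^sup>2) powr (- a)" using y t a by (intro wt_neg_mono) auto
      finally show "norm (deriv2 f y) \<le> (1 - t\<^sup>2) powr (- a)" .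
    qed (use t in simp)
    then show "cmod (deriv (deriv2 f) x) \<le> ?B" by simp
  qed
  have "cmod (of_real \<rho> * z) \<le> r"
  proof -
    have "\<rho> * cmod z \<le> cmod z" using \<rho> by (intro mult_left_le_one_le) auto
    then show ?thesis using z \<rho>(1) by (simp add: norm_mult)
  qed
  then have "cmod (deriv2 f z - deriv2 f (of_real \<rho> * z)) \<le> ?B * cmod (z - of_real \<rho> * z)"
    using z by (intro field_differentiable_bound[OF convex_cball der bd]) auto
  also have "\<dots> \<le> ?B * (1 - \<rho>)"
  proof (rule mult_left_mono)
    have "z - of_real \<rho> * z = of_real (1 - \<rho>) * z" by (simp add: algebra_simps)
    moreover have "cmod (of_real (1 - \<rho>) * z) \<le> (1 - \<rho>) * 1"
      unfolding norm_mult norm_of_real using z r \<rho> by (intro mult_mono) auto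
    ultimately show "cmod (z - of_real \<rho> * z) \<le> 1 - \<rho>" by simp
    show "0 \<le> ?B" using t by simp
  qed
  finally show ?thesis .
qed

text \<open>With \<open>h = f''\<close> and \<open>S\<close> the Taylor polynomial at \<open>\<rho> z\<close>, the second derivative of the error is
  \<open>h(z) - \<rho> S(z) = (h(z) - h(\<rho> z)) + (1 - \<rho>) h(\<rho> z) + \<rho> (h(\<rho> z) - S(z))\<close>.
  The dilation parameter \<open>\<rho>\<close> is chosen first, close enough to \<open>1\<close> for the first two terms on
  \<open>\<bar>z\<bar> \<le> r\<close>, and then the degree for the last one. For the global bound, \<open>h(z)\<close>, \<open>h(\<rho> z)\<close> and the tail
  contribute one multiple of the inverse weight each.\<close>

lemma dilated_taylor_approximation:
  assumes a: "0 \<le> a" and r: "0 \<le> r" "r < 1" and \<delta>: "0 < \<delta>"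
  obtains \<rho> N where "\<And>f. f \<in> zygmund a \<Longrightarrow> zygmund_norm a f \<le> 1 \<Longrightarrow>
    (let F = (\<lambda>z. f z - dilated_taylor \<rho> N f z) in F \<in> zygmund a \<and> deriv F 0 = 0 \<and>
      (\<forall>z\<in>\<D>. cmod (deriv2 F z) \<le> 3 * wt (- a) z) \<and> (\<forall>z. cmod z \<le> r \<longrightarrow> cmod (deriv2 F z) \<le> \<delta>))"
proof -
  define t where "t = (1 + r) / 2"
  define B where "B = (1 - t\<^sup>2) powr (- a) / (t - r) + (1 - r\<^sup>2) powr (- a)"
  have t: "r < t" "t < 1" "0 \<le> t" using r by (auto simp: t_def)
  have B: "0 \<le> B" using t by (simp add: B_def)
  define \<eta> where "\<eta> = min (1 / 2) (\<delta> / (2 * (B + 1)))"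
  define \<rho> where "\<rho> = 1 - \<eta>"
  have \<eta>: "0 < \<eta>" using \<delta> B by (simp add: \<eta>_def)
  have \<eta>2: "\<eta> \<le> 1 / 2" "\<eta> \<le> \<delta> / (2 * (B + 1))"
    unfolding \<eta>_def by (rule min.cobounded1 min.cobounded2)+
  have \<rho>: "0 < \<rho>" "\<rho> < 1" using \<eta> \<eta>2(1) by (auto simp: \<rho>_def)
  have B\<rho>: "B * (1 - \<rho>) \<le> \<delta> / 2"
  proof -
    have "B * \<eta> \<le> (B + 1) * (\<delta> / (2 * (B + 1)))" using \<eta> \<eta>2(2) B by (intro mult_mono) auto
    also have "\<dots> = \<delta> / 2" using B by (simp add: field_simps)
    finally show ?thesis by (simp add: \<rho>_def)
  qed
  define s where "s = (1 + \<rho>) / 2"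
  have s: "0 < s" "s < 1" "\<rho> < s" using \<rho> by (auto simp: s_def)
  let ?T = "\<lambda>N. (1 - s\<^sup>2) powr (- a) * (\<rho> / s) ^ N / (1 - \<rho> / s)"
  have "(\<lambda>N. (1 - s\<^sup>2) powr (- a) * (\<rho> / s) ^ N / (1 - \<rho> / s)) \<longlonglongrightarrow> (1 - s\<^sup>2) powr (- a) * 0 / (1 - \<rho> / s)"
    using \<rho> s by (intro tendsto_intros LIMSEQ_power_zero) auto
  then have "\<forall>\<^sub>F N in sequentially. ?T N < min 1 (\<delta> / 2)"
    using \<delta> by (intro order_tendstoD(2)) auto
  then obtain N where N: "?T N < min 1 (\<delta> / 2)" by (auto simp: eventually_sequentially)
  show ?thesis
  proof (rule that[of \<rho> "Suc N"], unfold Let_def, intro conjI ballI allI impI)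
    fix f assume f: "f \<in> zygmund a" "zygmund_norm a f \<le> 1"
    let ?L = "dilated_taylor \<rho> (Suc N) f"
    let ?F = "\<lambda>z. f z - ?L z"
    let ?S = "\<lambda>z. \<Sum>m<N. (deriv ^^ m) (deriv2 f) 0 / fact m * (of_real \<rho> * z) ^ m"
    have fH: "f \<in> H_disc" and LH: "?L \<in> H_disc"
      using f dilated_taylor_zygmund[OF a] by (auto intro: zygmund_H_disc)
    show "?F \<in> zygmund a" by (intro zygmund.diff_mem f dilated_taylor_zygmund a)
    have dF: "(deriv ^^ n) ?F z = (deriv ^^ n) f z - (deriv ^^ n) ?L z" if "z \<in> \<D>" for n z
      by (rule higher_deriv_diff[of _ "\<D>"]) (use fH LH that in \<open>auto simp: H_disc_holomorphic\<close>)
    show "deriv ?F 0 = 0"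
    proof -
      have "deriv ?L 0 = deriv f 0"
        by (simp add: deriv_dilated_taylor sum.lessThan_Suc_shift deriv_coeff_def)
      then show ?thesis using dF[of 0 1] by simp
    qed
    have F2: "deriv2 ?F z = deriv2 f z - of_real \<rho> * ?S z" if "z \<in> \<D>" for z
      using dF[OF that, of 2] deriv2_dilated_taylor[OF that] by simp
    have tail: "cmod (deriv2 f (of_real \<rho> * z) - ?S z) \<le> min 1 (\<delta> / 2)" if "z \<in> \<D>" for z
      using taylor_tail_bound[OF a f s(1,2) _ s(3) that, of N] \<rho> N by linarith
    have \<rho>z: "cmod (of_real \<rho> * z) \<le> cmod z" for z
      using \<rho> by (simp add: norm_mult mult_left_le_one_le)
    have split: "cmod (of_real \<rho> * ?S z) \<le> cmod (deriv2 f (of_real \<rho> * z)) + min 1 (\<delta> / 2)" if "z \<in> \<D>" for z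
    proof -
      have "cmod (of_real \<rho> * ?S z) \<le> cmod (?S z)" using \<rho> by (simp add: norm_mult mult_left_le_one_le)
      also have "\<dots> \<le> cmod (deriv2 f (of_real \<rho> * z)) + cmod (deriv2 f (of_real \<rho> * z) - ?S z)"
        using norm_triangle_ineq4[of "deriv2 f (of_real \<rho> * z)" "deriv2 f (of_real \<rho> * z) - ?S z"] by simp
      finally show ?thesis using tail[OF that] by linarith
    qed
    show "cmod (deriv2 ?F z) \<le> 3 * wt (- a) z" if z: "z \<in> \<D>" for z
    proof -
      have w: "cmod (deriv2 f z) \<le> wt (- a) z" using f z by (intro zygmund_unit_ball_deriv2)
      have "cmod (deriv2 f (of_real \<rho> * z)) \<le> wt (- a) (of_real \<rho> * z)"
        using f z \<rho>z[of z] by (intro zygmund_unit_ball_deriv2) auto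
      also have "\<dots> \<le> wt (- a) z" using \<rho>z[of z] z a by (intro wt_neg_mono) auto
      finally have w': "cmod (deriv2 f (of_real \<rho> * z)) \<le> wt (- a) z" .
      have "1 \<le> wt (- a) z" using wt_le_1[OF a, of z] z one_minus_sq_pos[of z] by (simp add: wt_neg_eq)
      then show ?thesis
        using norm_triangle_ineq4[of "deriv2 f z" "of_real \<rho> * ?S z"] split[OF z] w w'
        unfolding F2[OF z] by linarith
    qed
    show "cmod (deriv2 ?F z) \<le> \<delta>" if zr: "cmod z \<le> r" for z
    proof -
      have z: "z \<in> \<D>" using zr r by simp
      let ?h = "deriv2 f (of_real \<rho> * z)"
      have "cmod ?h \<le> wt (- a) (of_real \<rho> * z)"
        using f z \<rho>z[of z] by (intro zygmund_unit_ball_deriv2) auto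
      also have "\<dots> \<le> (1 - r\<^sup>2) powr (- a)"
        using \<rho>z[of z] zr r a by (intro wt_neg_mono) auto
      finally have h: "cmod ?h * (1 - \<rho>) \<le> (1 - r\<^sup>2) powr (- a) * (1 - \<rho>)"
        using \<rho> by (intro mult_right_mono) auto
      have "deriv2 ?F z = (deriv2 f z - ?h) + (of_real (1 - \<rho>) * ?h + of_real \<rho> * (?h - ?S z))"
        unfolding F2[OF z] by (simp add: algebra_simps)
      then have "cmod (deriv2 ?F z) \<le> cmod (deriv2 f z - ?h)
          + (cmod (of_real (1 - \<rho>) * ?h) + cmod (of_real \<rho> * (?h - ?S z)))"
        by (simp only:) (intro order_trans[OF norm_triangle_ineq] add_left_mono norm_triangle_ineq)
      moreover have "cmod (deriv2 f z - ?h) \<le> (1 - t\<^sup>2) powr (- a) / (t - r) * (1 - \<rho>)"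
        unfolding t_def using dilation_close[OF a f r _ _ zr, of \<rho>] \<rho> by simp
      moreover have "cmod (of_real (1 - \<rho>) * ?h) = cmod ?h * (1 - \<rho>)"
        unfolding norm_mult norm_of_real using \<rho> by simp
      moreover have "cmod (of_real \<rho> * (?h - ?S z)) \<le> cmod (?h - ?S z)"
        unfolding norm_mult norm_of_real using \<rho> by (simp add: mult_left_le_one_le)
      moreover have "B * (1 - \<rho>) = (1 - t\<^sup>2) powr (- a) / (t - r) * (1 - \<rho>) + (1 - r\<^sup>2) powr (- a) * (1 - \<rho>)"
        unfolding B_def by (rule distrib_right)
      ultimately show ?thesis using h tail[OF z] B\<rho> by linarith
    qed
  qed
qed

section \<open>Growth of derivatives\<close>

text \<open>The mean value inequality along a ray, in the form that compares with a real function \<open>Q\<close>.\<close>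

lemma deriv_radial_growth:
  assumes F: "F \<in> H_disc" and e: "cmod e = 1" and t: "0 \<le> t" "t \<le> x" "x < 1"
    and Q: "\<And>s. t \<le> s \<Longrightarrow> s \<le> x \<Longrightarrow> (Q has_real_derivative q s) (at s)"
    and q: "\<And>s. t \<le> s \<Longrightarrow> s \<le> x \<Longrightarrow> cmod (deriv2 F (of_real s * e)) \<le> q s"
  shows "cmod (deriv F (of_real x * e)) \<le> cmod (deriv F (of_real t * e)) + (Q x - Q t)"
proof (cases "t = x")
  case False
  then have tx: "t < x" using t by simp
  have disc: "of_real s * e \<in> \<D>" if "t \<le> s" "s \<le> x" for s
    using that t e by (simp add: norm_mult)
  have der: "((\<lambda>s. deriv F (of_real s * e)) has_vector_derivative e * deriv2 F (of_real s * e)) (at s)"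
    if s: "t \<le> s" "s \<le> x" for s
  proof -
    have "((\<lambda>s. of_real s * e) has_vector_derivative e) (at s)"
      by (auto intro!: derivative_eq_intros has_vector_derivative_of_real)
    from field_vector_diff_chain_at[OF this has_deriv_H_disc(2)[OF F disc[OF s]]]
    show ?thesis by (simp add: o_def)
  qed
  have "cmod (deriv F (of_real x * e) - deriv F (of_real t * e)) \<le> Q x - Q t"
  proof (rule differentiable_bound_general[OF tx, where f' = "\<lambda>s. e * deriv2 F (of_real s * e)" and \<phi>' = q])
    show "continuous_on {t..x} (\<lambda>s. deriv F (of_real s * e))"
      by (intro continuous_at_imp_continuous_on ballI has_vector_derivative_continuous[OF der]) auto
    show "continuous_on {t..x} Q"
      by (intro continuous_at_imp_continuous_on ballI DERIV_isCont[OF Q]) auto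
  qed (use der Q q e in \<open>auto simp: has_real_derivative_iff_has_vector_derivative norm_mult\<close>)
  then show ?thesis
    using norm_triangle_ineq[of "deriv F (of_real x * e) - deriv F (of_real t * e)" "deriv F (of_real t * e)"]
    by simp
qed (simp add: t)

lemma polar_disc:
  obtains e where "cmod e = 1" "z = of_real (cmod z) * e"
proof (cases "z = 0")
  case True
  then show ?thesis using that[of 1] by simp
next
  case False
  then show ?thesis using that[of "z / of_real (cmod z)"] by (simp add: norm_divide)
qed

lemma wt_neg_le_one_minus:
  assumes "0 \<le> a" "cmod z < 1"
  shows "wt (- a) z \<le> (1 - cmod z) powr (- a)"
proof -
  have "(cmod z)\<^sup>2 \<le> cmod z" using assms by (simp add: power2_eq_square mult_left_le)
  then show ?thesis using assms by (intro powr_mono2') auto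
qed

text \<open>One formula serves both \<open>a < 1\<close> and \<open>a > 1\<close>. For \<open>a > 1\<close> it is used from \<open>t = 0\<close> and shows the
  growth of the derivative; for \<open>a < 1\<close> it is used from \<open>t\<close> near \<open>1\<close> and shows that the derivative
  hardly changes there.\<close>

lemma deriv_growth_powr:
  assumes F: "F \<in> H_disc" "\<And>z. z \<in> \<D> \<Longrightarrow> cmod (deriv2 F z) \<le> 3 * wt (- a) z"
    and a: "0 \<le> a" "a \<noteq> 1" and e: "cmod e = 1" and t: "0 \<le> t" "t \<le> x" "x < 1"
  shows "cmod (deriv F (of_real x * e)) \<le> cmod (deriv F (of_real t * e))
    + 3 / (a - 1) * ((1 - x) powr (1 - a) - (1 - t) powr (1 - a))"
proof -
  let ?Q = "\<lambda>s. 3 / (a - 1) * (1 - s) powr (1 - a)"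
  have "cmod (deriv F (of_real x * e)) \<le> cmod (deriv F (of_real t * e)) + (?Q x - ?Q t)"
  proof (rule deriv_radial_growth[OF F(1) e t, where q = "\<lambda>s. 3 * (1 - s) powr (- a)"])
    fix s assume s: "t \<le> s" "s \<le> x"
    have "((\<lambda>s. (1 - s) powr (1 - a)) has_real_derivative (1 - a) * (1 - s) powr (1 - a - 1) * (- 1)) (at s)"
      using s t by (auto intro!: derivative_eq_intros)
    from DERIV_cmult[OF this, of "3 / (a - 1)"]
    have "(?Q has_real_derivative 3 / (a - 1) * ((1 - a) * (1 - s) powr (1 - a - 1) * (- 1))) (at s)" .
    moreover have "3 / (a - 1) * ((1 - a) * (1 - s) powr (1 - a - 1) * (- 1)) = 3 * (1 - s) powr (- a)"
      using a(2) by (simp add: divide_simps) (simp add: algebra_simps)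
    ultimately show "(?Q has_real_derivative 3 * (1 - s) powr (- a)) (at s)" by (simp only:)
    have "cmod (deriv2 F (of_real s * e)) \<le> 3 * wt (- a) (of_real s * e)"
      using s t e by (intro F(2)) (simp add: norm_mult)
    also have "\<dots> \<le> 3 * (1 - s) powr (- a)"
      using wt_neg_le_one_minus[of a "of_real s * e"] s t a e by (simp add: norm_mult)
    finally show "cmod (deriv2 F (of_real s * e)) \<le> 3 * (1 - s) powr (- a)" .
  qed
  then show ?thesis by (simp only: right_diff_distrib)
qed

lemma deriv_growth_ln:
  assumes F: "F \<in> H_disc" "\<And>z. z \<in> \<D> \<Longrightarrow> cmod (deriv2 F z) \<le> 3 * wt (- 1) z"
    and F0: "deriv F 0 = 0" and z: "z \<in> \<D>"
  shows "cmod (deriv F z) \<le> 3 * ln (1 / (1 - cmod z))"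
proof -
  obtain e where e: "cmod e = 1" "z = of_real (cmod z) * e" by (rule polar_disc)
  let ?Q = "\<lambda>s. - 3 * ln (1 - s)"
  have "cmod (deriv F (of_real (cmod z) * e)) \<le> cmod (deriv F (of_real 0 * e)) + (?Q (cmod z) - ?Q 0)"
  proof (rule deriv_radial_growth[OF F(1) e(1), where q = "\<lambda>s. 3 * (1 - s) powr (- 1)"])
    fix s assume s: "0 \<le> s" "s \<le> cmod z"
    then show "(?Q has_real_derivative 3 * (1 - s) powr (- 1)) (at s)"
      using z by (auto intro!: derivative_eq_intros simp: powr_minus_divide)
    have "cmod (deriv2 F (of_real s * e)) \<le> 3 * wt (- 1) (of_real s * e)"
      using s z e by (intro F(2)) (simp add: norm_mult)
    also have "\<dots> \<le> 3 * (1 - s) powr (- 1)"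
      using wt_neg_le_one_minus[of 1 "of_real s * e"] s z e(1) by (simp add: norm_mult)
    finally show "cmod (deriv2 F (of_real s * e)) \<le> 3 * (1 - s) powr (- 1)" .
  qed (use z in auto)
  then show ?thesis using z e(2) by (simp add: F0 ln_div)
qed

lemma deriv_small_inside:
  assumes F: "F \<in> H_disc" and F0: "deriv F 0 = 0" and r: "r < 1"
    and \<delta>: "0 \<le> \<delta>" "\<And>z. cmod z \<le> r \<Longrightarrow> cmod (deriv2 F z) \<le> \<delta>" and z: "cmod z \<le> r"
  shows "cmod (deriv F z) \<le> \<delta>"
proof -
  have "cmod (deriv F z - deriv F 0) \<le> \<delta> * cmod (z - 0)"
  proof (rule field_differentiable_bound[OF convex_cball])
    fix x :: complex assume "x \<in> cball 0 r"
    then have x: "cmod x \<le> r" by simp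
    then show "(deriv F has_field_derivative deriv2 F x) (at x within cball 0 r)"
      using r by (intro has_field_derivative_at_within[OF has_deriv_H_disc(2)[OF F]]) simp
    show "cmod (deriv2 F x) \<le> \<delta>" by (rule \<delta>(2)[OF x])
  next
    show "z \<in> cball 0 r" "0 \<in> cball 0 r" using z norm_ge_zero[of z] by (auto simp del: norm_ge_zero)
  qed
  also have "\<dots> \<le> \<delta>" using z r \<delta>(1) by (simp add: mult_left_le)
  finally show ?thesis by (simp add: F0)
qed

section \<open>Upper bounds\<close>

lemma deriv_coeff_add:
  "f \<in> H_disc \<Longrightarrow> h \<in> H_disc \<Longrightarrow> deriv_coeff k (\<lambda>z. f z + h z) = deriv_coeff k f + deriv_coeff k h"
  using higher_deriv_add_H_disc[of f h 0 "Suc k"] by (simp add: deriv_coeff_def add_divide_distrib)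

lemma deriv_coeff_scale:
  "f \<in> H_disc \<Longrightarrow> deriv_coeff k (\<lambda>z. c * f z) = c * deriv_coeff k f"
  using higher_deriv_scale_H_disc[of f 0 "Suc k" c] by (simp add: deriv_coeff_def)

context bounded_VC
begin

text \<open>The sign makes this the perturbation to be added to the operator.\<close>

lemma compact_VC_dilated_taylor:
  "compact_op (zygmund \<alpha>) (zygmund_norm \<alpha>) (zygmund \<beta>) (zygmund_norm \<beta>)
    (\<lambda>f z. - VC g \<phi> (dilated_taylor \<rho> N f) z)"
proof -
  let ?p = "\<lambda>k. primitive (\<lambda>z. z ^ k)"
  let ?c = "\<lambda>k f. - (deriv_coeff k f * of_real \<rho> ^ k)"
  have p: "?p k \<in> zygmund \<alpha>" for k using \<alpha>_pos by (intro power_primitive_zygmund) simp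
  have eq: "(\<lambda>f z. - VC g \<phi> (dilated_taylor \<rho> N f) z) = (\<lambda>f z. \<Sum>k<N. ?c k f * VC g \<phi> (?p k) z)"
  proof (rule ext)
    fix f
    have "VC g \<phi> (dilated_taylor \<rho> N f) = (\<lambda>z. \<Sum>k<N. (deriv_coeff k f * of_real \<rho> ^ k) * VC g \<phi> (?p k) z)"
      unfolding dilated_taylor_def
      by (subst op_sum) (auto intro!: zygmund.scale_mem p simp: op_scale[OF p])
    then show "(\<lambda>z. - VC g \<phi> (dilated_taylor \<rho> N f) z) = (\<lambda>z. \<Sum>k<N. ?c k f * VC g \<phi> (?p k) z)"
      by (simp add: sum_negf)
  qed
  show ?thesis unfolding eq
  proof (rule compact_op_finite_rank)
    show "linear_op (zygmund \<alpha>) (zygmund \<beta>) (\<lambda>f z. \<Sum>k<N. ?c k f * VC g \<phi> (?p k) z)"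
      unfolding linear_op_def
    proof (intro conjI ballI allI)
      show "(\<lambda>f z. \<Sum>k<N. ?c k f * VC g \<phi> (?p k) z) ` zygmund \<alpha> \<subseteq> zygmund \<beta>"
        by (intro image_subsetI zygmund.sum_mem zygmund.scale_mem op_mem p)
      fix f assume f: "f \<in> zygmund \<alpha>"
      show "(\<lambda>z. \<Sum>k<N. ?c k (\<lambda>z. a * f z) * VC g \<phi> (?p k) z) = (\<lambda>z. a * (\<Sum>k<N. ?c k f * VC g \<phi> (?p k) z))" for a
        by (simp add: deriv_coeff_scale[OF zygmund_H_disc[OF f]] sum_distrib_left mult.assoc)
      fix h assume h: "h \<in> zygmund \<alpha>"
      show "(\<lambda>z. \<Sum>k<N. ?c k (\<lambda>z. f z + h z) * VC g \<phi> (?p k) z)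
          = (\<lambda>z. (\<Sum>k<N. ?c k f * VC g \<phi> (?p k) z) + (\<Sum>k<N. ?c k h * VC g \<phi> (?p k) z))"
        by (simp add: deriv_coeff_add[OF f[THEN zygmund_H_disc] h[THEN zygmund_H_disc]]
            sum.distrib[symmetric] algebra_simps)
    qed
    show "VC g \<phi> (?p k) \<in> zygmund \<beta>" for k by (rule op_mem[OF p])
    show "cmod (?c k f) \<le> (1 + (3 / 4) powr (- \<alpha>) * 2 ^ k) * cmod (of_real \<rho> ^ k)"
      if "f \<in> zygmund \<alpha>" "zygmund_norm \<alpha> f \<le> 1" for k f
      unfolding norm_minus_cancel norm_mult
      using \<alpha>_pos that by (intro mult_right_mono deriv_coeff_bound) auto
  qed (rule zygmund.normed_function_space_axioms)+
qed

text \<open>The reduction to the boundary. On \<open>\<bar>\<phi> z\<bar> \<le> r\<close> the error \<open>F\<close> of the approximation is so small that,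
  together with the point evaluation at \<open>0\<close>, it costs at most \<open>A\<close>; this fixes \<open>\<delta>\<close>. On
  \<open>\<bar>\<phi> z\<bar> \<ge> r\<close> the hypothesis on \<open>u\<close> yields \<open>3 A\<close>. The hypothesis on \<open>w\<close> is stated for all functions with
  the properties of \<open>F\<close>, since the estimate of \<open>F'\<close> depends on the range of \<open>\<alpha>\<close>.\<close>

lemma essential_norm_upper:
  assumes r: "cmod (\<phi> 0) \<le> r" "r < 1" and A: "0 < A" and \<delta>0: "0 < \<delta>0"
    and U: "\<And>z. z \<in> \<D> \<Longrightarrow> r \<le> cmod (\<phi> z) \<Longrightarrow>
      wt \<beta> z * cmod (u z) * (1 - cmod (\<phi> z)) powr (- \<alpha>) \<le> A"
    and W: "\<And>F z. F \<in> H_disc \<Longrightarrow> deriv F 0 = 0 \<Longrightarrow>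
      (\<And>z. z \<in> \<D> \<Longrightarrow> cmod (deriv2 F z) \<le> 3 * wt (- \<alpha>) z) \<Longrightarrow>
      (\<And>z. cmod z \<le> r \<Longrightarrow> cmod (deriv2 F z) \<le> \<delta>0) \<Longrightarrow>
      z \<in> \<D> \<Longrightarrow> r \<le> cmod (\<phi> z) \<Longrightarrow> wt \<beta> z * cmod (w z) * cmod (deriv F (\<phi> z)) \<le> B"
    and B: "0 \<le> B"
  shows "VC_essential_norm \<alpha> \<beta> g \<phi> \<le> ennreal (4 * A + B)"
proof -
  have r0: "0 \<le> r" using r(1) norm_ge_zero order_trans by blast
  obtain b where b: "0 < b" "\<And>z. z \<in> \<D> \<Longrightarrow> wt \<beta> z * cmod (u z) \<le> b"
    "\<And>z. z \<in> \<D> \<Longrightarrow> wt \<beta> z * cmod (w z) \<le> b"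
    using symbols_weighted_bounded by blast
  define \<delta> where "\<delta> = min \<delta>0 (A / (cmod (g 0) + 2 * b))"
  have gb: "0 < cmod (g 0) + 2 * b" using b(1) by (simp add: add_nonneg_pos)
  have \<delta>: "0 < \<delta>" "\<delta> \<le> \<delta>0" using \<delta>0 A gb by (auto simp: \<delta>_def)
  have \<delta>A: "\<delta> * cmod (g 0) + 2 * \<delta> * b \<le> A"
  proof -
    have "\<delta> \<le> A / (cmod (g 0) + 2 * b)" unfolding \<delta>_def by (rule min.cobounded2)
    then show ?thesis using gb by (simp add: pos_le_divide_eq algebra_simps)
  qed
  obtain \<rho> N where approx: "\<And>f. f \<in> zygmund \<alpha> \<Longrightarrow> zygmund_norm \<alpha> f \<le> 1 \<Longrightarrow>
    (let F = (\<lambda>z. f z - dilated_taylor \<rho> N f z) in F \<in> zygmund \<alpha> \<and> deriv F 0 = 0 \<and>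
      (\<forall>z\<in>\<D>. cmod (deriv2 F z) \<le> 3 * wt (- \<alpha>) z) \<and> (\<forall>z. cmod z \<le> r \<longrightarrow> cmod (deriv2 F z) \<le> \<delta>))"
    using dilated_taylor_approximation[OF less_imp_le[OF \<alpha>_pos] r0 r(2) \<delta>(1)] by blast
  let ?K = "\<lambda>f z. - VC g \<phi> (dilated_taylor \<rho> N f) z"
  have bound: "zygmund_norm \<beta> (\<lambda>z. VC g \<phi> f z + ?K f z) \<le> 4 * A + B"
    if f: "f \<in> zygmund \<alpha>" "zygmund_norm \<alpha> f \<le> 1" for f
  proof -
    define F where "F = (\<lambda>z. f z - dilated_taylor \<rho> N f z)"
    have F: "F \<in> zygmund \<alpha>" "deriv F 0 = 0" "\<And>z. z \<in> \<D> \<Longrightarrow> cmod (deriv2 F z) \<le> 3 * wt (- \<alpha>) z"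
      "\<And>z. cmod z \<le> r \<Longrightarrow> cmod (deriv2 F z) \<le> \<delta>"
      using approx[OF f] unfolding Let_def F_def by blast+
    have FH: "F \<in> H_disc" by (rule zygmund_H_disc[OF F(1)])
    have F1: "cmod (deriv F z) \<le> \<delta>" if "cmod z \<le> r" for z
      by (rule deriv_small_inside[OF FH F(2) r(2) less_imp_le[OF \<delta>(1)] F(4) that])
    have "wt \<beta> z * cmod (deriv2 F (\<phi> z) * u z + deriv F (\<phi> z) * w z) \<le> 3 * A + B + 2 * \<delta> * b"
      if z: "z \<in> \<D>" for z
    proof -
      have \<phi>z: "cmod (\<phi> z) < 1" using \<phi>_disc z by simp
      have "wt \<beta> z * cmod (deriv2 F (\<phi> z) * u z + deriv F (\<phi> z) * w z)
          \<le> wt \<beta> z * (cmod (deriv2 F (\<phi> z)) * cmod (u z) + cmod (deriv F (\<phi> z)) * cmod (w z))"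
        by (intro mult_left_mono order_trans[OF norm_triangle_ineq]) (simp_all add: norm_mult)
      also have "\<dots> = cmod (deriv2 F (\<phi> z)) * (wt \<beta> z * cmod (u z)) + cmod (deriv F (\<phi> z)) * (wt \<beta> z * cmod (w z))"
        by (simp only: distrib_left mult_ac)
      also have "\<dots> \<le> 3 * A + B + 2 * \<delta> * b"
      proof (cases "cmod (\<phi> z) \<le> r")
        case True
        have "cmod (deriv2 F (\<phi> z)) * (wt \<beta> z * cmod (u z)) \<le> \<delta> * b"
          using F(4)[OF True] b(2)[OF z] \<delta>(1) by (intro mult_mono) auto
        moreover have "cmod (deriv F (\<phi> z)) * (wt \<beta> z * cmod (w z)) \<le> \<delta> * b"
          using F1[OF True] b(3)[OF z] \<delta>(1) by (intro mult_mono) auto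
        ultimately show ?thesis using A B by linarith
      next
        case False
        have "cmod (deriv2 F (\<phi> z)) \<le> 3 * (1 - cmod (\<phi> z)) powr (- \<alpha>)"
          using F(3)[of "\<phi> z"] wt_neg_le_one_minus[of \<alpha> "\<phi> z"] \<phi>z \<alpha>_pos by simp
        then have "cmod (deriv2 F (\<phi> z)) * (wt \<beta> z * cmod (u z))
            \<le> (3 * (1 - cmod (\<phi> z)) powr (- \<alpha>)) * (wt \<beta> z * cmod (u z))"
          by (intro mult_right_mono) auto
        also have "\<dots> \<le> 3 * A" using U[OF z] False by (simp add: mult_ac)
        finally have 1: "cmod (deriv2 F (\<phi> z)) * (wt \<beta> z * cmod (u z)) \<le> 3 * A" .
        have "cmod (deriv F (\<phi> z)) * (wt \<beta> z * cmod (w z)) \<le> B"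
          using W[OF FH F(2,3) order_trans[OF F(4) \<delta>(2)] z] False by (simp add: mult_ac)
        moreover have "0 \<le> 2 * \<delta> * b" using \<delta>(1) b(1) by simp
        ultimately show ?thesis using 1 by linarith
      qed
      finally show ?thesis .
    qed
    then have "zygmund_norm \<beta> (VC g \<phi> F) \<le> cmod (deriv F (\<phi> 0)) * cmod (g 0) + (3 * A + B + 2 * \<delta> * b)"
      by (rule VC_norm_upper[OF F(1)])
    also have "\<dots> \<le> \<delta> * cmod (g 0) + (3 * A + B + 2 * \<delta> * b)"
      using F1[OF r(1)] by (intro add_right_mono mult_right_mono) auto
    also have "\<dots> \<le> 4 * A + B" using \<delta>A by linarith
    also have "VC g \<phi> F = (\<lambda>z. VC g \<phi> f z + ?K f z)"
      unfolding F_def using \<alpha>_pos by (subst op_diff) (auto intro: f(1) dilated_taylor_zygmund)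
    finally show ?thesis .
  qed
  have "VC_essential_norm \<alpha> \<beta> g \<phi>
      \<le> op_norm (zygmund \<alpha>) (zygmund_norm \<alpha>) (zygmund_norm \<beta>) (\<lambda>f z. VC g \<phi> f z + ?K f z)"
    unfolding VC_essential_norm_def essential_norm_def
    by (rule INF_lower) (simp add: compact_VC_dilated_taylor)
  also have "\<dots> \<le> ennreal (4 * A + B)"
    unfolding op_norm_def using bound by (intro SUP_least ennreal_leI) auto
  finally show ?thesis .
qed

end

text \<open>Take \<open>n\<close> to be the integer part of \<open>1 / (2 (1 - x))\<close>; Bernoulli's inequality then gives
  \<open>x\<^bsup>n\<^esup> \<ge> 1 - n (1 - x) \<ge> 1 / 2\<close>.\<close>

lemma power_index_near_1:
  assumes x: "1 - 1 / (2 * (real n0 + 1)) \<le> x" "x < 1"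
  obtains n where "n0 \<le> n" "1 / (1 - x) \<le> 2 * (real n + 1)" "1 \<le> 2 * x ^ n"
proof -
  define q where "q = 1 / (2 * (1 - x))"
  define n where "n = nat \<lfloor>q\<rfloor>"
  have q: "real n0 + 1 \<le> q" using x by (simp add: q_def field_simps)
  then have n: "real n \<le> q" "q < real n + 1" by (auto simp: n_def)
  have "real n0 < real n + 1" using q n by linarith
  then have "n0 \<le> n" by linarith
  moreover have "1 / (1 - x) \<le> 2 * (real n + 1)" using n(2) x by (simp add: q_def field_simps)
  moreover have "1 \<le> 2 * x ^ n"
  proof -
    have "1 / (2 * (real n0 + 1)) \<le> 1" by simp
    then have "1 + real n * (- (1 - x)) \<le> (1 + (- (1 - x))) ^ n"
      using x by (intro Bernoulli_inequality) linarith
    moreover have "real n * (1 - x) \<le> 1 / 2" using n(1) x by (simp add: q_def field_simps)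
    ultimately show ?thesis by (simp add: algebra_simps)
  qed
  ultimately show ?thesis using that by blast
qed

text \<open>A bound along all large exponents \<open>n\<close> becomes a bound in terms of \<open>1 - x\<close> by choosing
  \<open>n\<close> comparable to \<open>1 / (1 - x)\<close>.\<close>

lemma boundary_bound_powr:
  assumes M: "\<And>n. n \<ge> n0 \<Longrightarrow> (real n + 1) powr c * (v * x ^ n) \<le> M" and c: "0 \<le> c" and v: "0 \<le> v"
    and x: "1 - 1 / (2 * (real n0 + 1)) \<le> x" "x < 1"
  shows "v * (1 - x) powr (- c) \<le> 2 powr (c + 1) * M"
proof -
  obtain n where n: "n0 \<le> n" "1 / (1 - x) \<le> 2 * (real n + 1)" "1 \<le> 2 * x ^ n"
    using power_index_near_1[OF x] .
  have "(1 - x) powr (- c) = (1 / (1 - x)) powr c" using x by (simp add: powr_minus_divide powr_divide)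
  also have "\<dots> \<le> (2 * (real n + 1)) powr c" using n(2) x c by (intro powr_mono2) auto
  also have "\<dots> = 2 powr c * (real n + 1) powr c" by (rule powr_mult)
  finally have "v * (1 - x) powr (- c) \<le> v * (2 powr c * (real n + 1) powr c)"
    using v by (rule mult_left_mono)
  also have "\<dots> \<le> v * (2 powr c * (real n + 1) powr c) * (2 * x ^ n)"
    using mult_left_mono[OF n(3), of "v * (2 powr c * (real n + 1) powr c)"] v by simp
  also have "\<dots> = 2 powr (c + 1) * ((real n + 1) powr c * (v * x ^ n))"
    by (simp add: powr_add mult_ac)
  also have "\<dots> \<le> 2 powr (c + 1) * M" using M[OF n(1)] by (rule mult_left_mono) simp
  finally show ?thesis .
qed

text \<open>The condition \<open>n \<ge> 4\<close> makes \<open>2 (n + 1) \<le> n\<^sup>2\<close>, so that \<open>ln (1 / (1 - x)) \<le> 2 ln n\<close>.\<close>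

lemma boundary_bound_ln:
  assumes M: "\<And>n. n \<ge> n0 \<Longrightarrow> ln (real n) * (v * x ^ n) \<le> M" and n0: "4 \<le> n0" and v: "0 \<le> v"
    and x: "1 - 1 / (2 * (real n0 + 1)) \<le> x" "x < 1"
  shows "v * ln (1 / (1 - x)) \<le> 4 * M"
proof -
  obtain n where n: "n0 \<le> n" "1 / (1 - x) \<le> 2 * (real n + 1)" "1 \<le> 2 * x ^ n"
    using power_index_near_1[OF x] .
  have n4: "4 \<le> real n" using n(1) n0 by simp
  have "1 / (1 - x) \<le> (real n)\<^sup>2"
  proof -
    have "2 * (real n + 1) \<le> 4 * real n" using n4 by simp
    also have "\<dots> \<le> (real n)\<^sup>2" unfolding power2_eq_square using n4 by (intro mult_right_mono) auto
    finally show ?thesis using n(2) by simp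
  qed
  then have "ln (1 / (1 - x)) \<le> ln ((real n)\<^sup>2)" using x n4 by (subst ln_le_cancel_iff) auto
  then have "ln (1 / (1 - x)) \<le> 2 * ln (real n)" using n4 by (simp add: ln_realpow)
  then have "v * ln (1 / (1 - x)) \<le> v * (2 * ln (real n))" using v by (rule mult_left_mono)
  also have "\<dots> \<le> v * (2 * ln (real n)) * (2 * x ^ n)"
    using mult_left_mono[OF n(3), of "v * (2 * ln (real n))"] v n4 by simp
  also have "\<dots> = 4 * (ln (real n) * (v * x ^ n))" by simp
  also have "\<dots> \<le> 4 * M" using M[OF n(1)] by simp
  finally show ?thesis .
qed

context bounded_VC
begin

lemma u_boundary_bound:
  assumes "\<forall>\<^sub>F n in sequentially. \<forall>z\<in>\<D>.
    (real n + 1) powr \<alpha> * (wt \<beta> z * cmod (u z * \<phi> z ^ n)) \<le> M"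
  obtains r where "r < 1" "\<And>z. z \<in> \<D> \<Longrightarrow> r \<le> cmod (\<phi> z) \<Longrightarrow>
    wt \<beta> z * cmod (u z) * (1 - cmod (\<phi> z)) powr (- \<alpha>) \<le> 2 powr (\<alpha> + 1) * M"
proof -
  obtain n0 where n0: "\<And>n z. n \<ge> n0 \<Longrightarrow> z \<in> \<D> \<Longrightarrow>
    (real n + 1) powr \<alpha> * (wt \<beta> z * cmod (u z * \<phi> z ^ n)) \<le> M"
    using assms unfolding eventually_sequentially by blast
  show ?thesis
  proof (rule that[of "1 - 1 / (2 * (real n0 + 1))"])
    fix z :: complex assume z: "z \<in> \<D>" "1 - 1 / (2 * (real n0 + 1)) \<le> cmod (\<phi> z)"
    show "wt \<beta> z * cmod (u z) * (1 - cmod (\<phi> z)) powr (- \<alpha>) \<le> 2 powr (\<alpha> + 1) * M"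
      using n0[OF _ z(1)] z \<phi>_disc[of z] \<alpha>_pos
      by (intro boundary_bound_powr[of n0]) (auto simp: norm_mult norm_power mult_ac)
  qed simp
qed

text \<open>For \<open>\<alpha> < 1\<close> the function \<open>(1 - s)\<^bsup>-\<alpha>\<^esup>\<close> is integrable up to \<open>1\<close>. With \<open>r\<close> close to \<open>1\<close> the
  derivative of an error function therefore exceeds its values on \<open>\<bar>z\<bar> = r\<close> by at most \<open>\<delta>\<close>, so it
  stays below \<open>2 \<delta>\<close>. As \<open>w\<close> is bounded in the weighted norm, its term can be made at most \<open>M\<close>.\<close>

lemma essential_norm_upper_lt_1:
  assumes \<alpha>: "\<alpha> < 1" and M: "0 < M"
    and U: "\<forall>\<^sub>F n in sequentially. \<forall>z\<in>\<D>.
      (real n + 1) powr \<alpha> * (wt \<beta> z * cmod (u z * \<phi> z ^ n)) \<le> M"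
  shows "VC_essential_norm \<alpha> \<beta> g \<phi> \<le> ennreal ((4 * 2 powr (\<alpha> + 1) + 1) * M)"
proof -
  obtain r1 where r1: "r1 < 1" "\<And>z. z \<in> \<D> \<Longrightarrow> r1 \<le> cmod (\<phi> z) \<Longrightarrow>
    wt \<beta> z * cmod (u z) * (1 - cmod (\<phi> z)) powr (- \<alpha>) \<le> 2 powr (\<alpha> + 1) * M"
    using u_boundary_bound[OF U] by blast
  obtain b where b: "0 < b" "\<And>z. z \<in> \<D> \<Longrightarrow> wt \<beta> z * cmod (w z) \<le> b"
    using symbols_weighted_bounded by metis
  define \<delta> where "\<delta> = M / (2 * b)"
  have \<delta>: "0 < \<delta>" using M b(1) by (simp add: \<delta>_def)
  \<comment> \<open>the solution of \<open>3 t\<^bsup>1-\<alpha>\<^esup> / (1 - \<alpha>) = \<delta>\<close>\<close>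
  define t where "t = (\<delta> * (1 - \<alpha>) / 3) powr (1 / (1 - \<alpha>))"
  have t: "0 < t" using \<delta> \<alpha> by (simp add: t_def)
  define r where "r = max (max r1 (1 - t)) (cmod (\<phi> 0))"
  have r: "cmod (\<phi> 0) \<le> r" "r < 1" "r1 \<le> r" "1 - r \<le> t"
    using r1(1) t \<phi>_disc[of 0] by (auto simp: r_def)
  have r0: "0 \<le> r" using r(1) norm_ge_zero order_trans by blast
  have "VC_essential_norm \<alpha> \<beta> g \<phi> \<le> ennreal (4 * (2 powr (\<alpha> + 1) * M) + M)"
  proof (rule essential_norm_upper[OF r(1,2) _ \<delta>])
    fix F z assume F: "F \<in> H_disc" "deriv F 0 = 0" "\<And>z. z \<in> \<D> \<Longrightarrow> cmod (deriv2 F z) \<le> 3 * wt (- \<alpha>) z"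
      "\<And>z. cmod z \<le> r \<Longrightarrow> cmod (deriv2 F z) \<le> \<delta>" and z: "z \<in> \<D>" "r \<le> cmod (\<phi> z)"
    let ?x = "cmod (\<phi> z)"
    obtain e where e: "cmod e = 1" "\<phi> z = of_real ?x * e" by (rule polar_disc)
    have x: "?x < 1" using \<phi>_disc z by simp
    have "cmod (deriv F (of_real ?x * e)) \<le> cmod (deriv F (of_real r * e))
        + 3 / (\<alpha> - 1) * ((1 - ?x) powr (1 - \<alpha>) - (1 - r) powr (1 - \<alpha>))"
      using F(1,3) \<alpha>_pos \<alpha> e(1) r0 z(2) x by (intro deriv_growth_powr) auto
    moreover have "cmod (deriv F (of_real r * e)) \<le> \<delta>"
      using e(1) r0 by (intro deriv_small_inside[OF F(1,2) r(2) less_imp_le[OF \<delta>] F(4)]) (auto simp: norm_mult)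
    moreover have "3 / (\<alpha> - 1) * ((1 - ?x) powr (1 - \<alpha>) - (1 - r) powr (1 - \<alpha>)) \<le> \<delta>"
    proof -
      have "(1 - r) powr (1 - \<alpha>) \<le> t powr (1 - \<alpha>)" using r \<alpha> by (intro powr_mono2) auto
      also have "\<dots> = \<delta> * (1 - \<alpha>) / 3" using \<alpha> \<delta> by (simp add: t_def powr_powr)
      finally have "(1 - r) powr (1 - \<alpha>) - (1 - ?x) powr (1 - \<alpha>) \<le> \<delta> * (1 - \<alpha>) / 3"
        by (simp add: add_increasing2 diff_le_eq)
      then have "3 / (1 - \<alpha>) * ((1 - r) powr (1 - \<alpha>) - (1 - ?x) powr (1 - \<alpha>)) \<le> 3 / (1 - \<alpha>) * (\<delta> * (1 - \<alpha>) / 3)"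
        using \<alpha> by (intro mult_left_mono) auto
      also have "\<dots> = \<delta>" using \<alpha> by simp
      also have "3 / (1 - \<alpha>) * ((1 - r) powr (1 - \<alpha>) - (1 - ?x) powr (1 - \<alpha>))
          = 3 / (\<alpha> - 1) * ((1 - ?x) powr (1 - \<alpha>) - (1 - r) powr (1 - \<alpha>))"
        using \<alpha> by (simp add: divide_simps) (simp add: algebra_simps)
      finally show ?thesis .
    qed
    ultimately have "cmod (deriv F (\<phi> z)) \<le> 2 * \<delta>" using e(2) by simp
    then have "wt \<beta> z * cmod (w z) * cmod (deriv F (\<phi> z)) \<le> b * (2 * \<delta>)"
      using b(1) b(2)[OF z(1)] by (intro mult_mono) auto
    also have "\<dots> = M" using b(1) by (simp add: \<delta>_def)
    finally show "wt \<beta> z * cmod (w z) * cmod (deriv F (\<phi> z)) \<le> M" .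
  qed (use M r r1 in auto)
  then show ?thesis by (simp add: algebra_simps)
qed

lemma essential_norm_upper_eq_1:
  assumes \<alpha>: "\<alpha> = 1" and M: "0 < M"
    and U: "\<forall>\<^sub>F n in sequentially. \<forall>z\<in>\<D>.
      (real n + 1) powr \<alpha> * (wt \<beta> z * cmod (u z * \<phi> z ^ n)) \<le> M"
    and W: "\<forall>\<^sub>F n in sequentially. \<forall>z\<in>\<D>.
      ln (real n) * (wt \<beta> z * cmod (w z * \<phi> z ^ n)) \<le> M"
  shows "VC_essential_norm \<alpha> \<beta> g \<phi> \<le> ennreal ((4 * 2 powr (\<alpha> + 1) + 12) * M)"
proof -
  obtain r1 where r1: "r1 < 1" "\<And>z. z \<in> \<D> \<Longrightarrow> r1 \<le> cmod (\<phi> z) \<Longrightarrow>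
    wt \<beta> z * cmod (u z) * (1 - cmod (\<phi> z)) powr (- \<alpha>) \<le> 2 powr (\<alpha> + 1) * M"
    using u_boundary_bound[OF U] by blast
  obtain n1 where n1: "\<And>n z. n \<ge> n1 \<Longrightarrow> z \<in> \<D> \<Longrightarrow>
      ln (real n) * (wt \<beta> z * cmod (w z * \<phi> z ^ n)) \<le> M"
    using W unfolding eventually_sequentially by blast
  define n0 where "n0 = max 4 n1"
  have n0: "4 \<le> n0" "\<And>n z. n \<ge> n0 \<Longrightarrow> z \<in> \<D> \<Longrightarrow>
      ln (real n) * (wt \<beta> z * cmod (w z * \<phi> z ^ n)) \<le> M"
    using n1 by (auto simp: n0_def)
  define r where "r = max (max r1 (1 - 1 / (2 * (real n0 + 1)))) (cmod (\<phi> 0))"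
  have r: "cmod (\<phi> 0) \<le> r" "r < 1" "r1 \<le> r" "1 - 1 / (2 * (real n0 + 1)) \<le> r"
    using r1(1) \<phi>_disc[of 0] by (auto simp: r_def)
  have "VC_essential_norm \<alpha> \<beta> g \<phi> \<le> ennreal (4 * (2 powr (\<alpha> + 1) * M) + 12 * M)"
  proof (rule essential_norm_upper[OF r(1,2) _ zero_less_one])
    fix F z assume F: "F \<in> H_disc" "deriv F 0 = 0" "\<And>z. z \<in> \<D> \<Longrightarrow> cmod (deriv2 F z) \<le> 3 * wt (- \<alpha>) z"
      and z: "z \<in> \<D>" "r \<le> cmod (\<phi> z)"
    have x: "cmod (\<phi> z) < 1" using \<phi>_disc z by simp
    have "cmod (deriv F (\<phi> z)) \<le> 3 * ln (1 / (1 - cmod (\<phi> z)))"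
      using F x unfolding \<alpha> by (intro deriv_growth_ln) auto
    then have "wt \<beta> z * cmod (w z) * cmod (deriv F (\<phi> z)) \<le> wt \<beta> z * cmod (w z) * (3 * ln (1 / (1 - cmod (\<phi> z))))"
      by (intro mult_left_mono) auto
    also have "\<dots> = 3 * (wt \<beta> z * cmod (w z) * ln (1 / (1 - cmod (\<phi> z))))" by simp
    also have "\<dots> \<le> 3 * (4 * M)"
      using n0(2)[OF _ z(1)] n0(1) r(4) z x
      by (intro mult_left_mono boundary_bound_ln[of n0]) (auto simp: norm_mult norm_power mult_ac)
    finally show "wt \<beta> z * cmod (w z) * cmod (deriv F (\<phi> z)) \<le> 12 * M" by simp
  qed (use M r r1 in auto)
  then show ?thesis by (simp add: algebra_simps)
qed

lemma essential_norm_upper_gt_1: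
  assumes \<alpha>: "1 < \<alpha>" and M: "0 < M"
    and U: "\<forall>\<^sub>F n in sequentially. \<forall>z\<in>\<D>.
      (real n + 1) powr \<alpha> * (wt \<beta> z * cmod (u z * \<phi> z ^ n)) \<le> M"
    and W: "\<forall>\<^sub>F n in sequentially. \<forall>z\<in>\<D>.
      (real n + 1) powr (\<alpha> - 1) * (wt \<beta> z * cmod (w z * \<phi> z ^ n)) \<le> M"
  shows "VC_essential_norm \<alpha> \<beta> g \<phi> \<le> ennreal ((4 * 2 powr (\<alpha> + 1) + 3 / (\<alpha> - 1) * 2 powr \<alpha>) * M)"
proof -
  obtain r1 where r1: "r1 < 1" "\<And>z. z \<in> \<D> \<Longrightarrow> r1 \<le> cmod (\<phi> z) \<Longrightarrow>
    wt \<beta> z * cmod (u z) * (1 - cmod (\<phi> z)) powr (- \<alpha>) \<le> 2 powr (\<alpha> + 1) * M"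
    using u_boundary_bound[OF U] by blast
  obtain n0 where n0: "\<And>n z. n \<ge> n0 \<Longrightarrow> z \<in> \<D> \<Longrightarrow>
      (real n + 1) powr (\<alpha> - 1) * (wt \<beta> z * cmod (w z * \<phi> z ^ n)) \<le> M"
    using W unfolding eventually_sequentially by blast
  define r where "r = max (max r1 (1 - 1 / (2 * (real n0 + 1)))) (cmod (\<phi> 0))"
  have r: "cmod (\<phi> 0) \<le> r" "r < 1" "r1 \<le> r" "1 - 1 / (2 * (real n0 + 1)) \<le> r"
    using r1(1) \<phi>_disc[of 0] by (auto simp: r_def)
  have "VC_essential_norm \<alpha> \<beta> g \<phi> \<le> ennreal (4 * (2 powr (\<alpha> + 1) * M) + 3 / (\<alpha> - 1) * (2 powr \<alpha> * M))"
  proof (rule essential_norm_upper[OF r(1,2) _ zero_less_one])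
    fix F z assume F: "F \<in> H_disc" "deriv F 0 = 0" "\<And>z. z \<in> \<D> \<Longrightarrow> cmod (deriv2 F z) \<le> 3 * wt (- \<alpha>) z"
      and z: "z \<in> \<D>" "r \<le> cmod (\<phi> z)"
    let ?x = "cmod (\<phi> z)"
    have x: "?x < 1" using \<phi>_disc z by simp
    obtain e where e: "cmod e = 1" "\<phi> z = of_real ?x * e" by (rule polar_disc)
    have "cmod (deriv F (of_real ?x * e)) \<le> cmod (deriv F (of_real 0 * e))
        + 3 / (\<alpha> - 1) * ((1 - ?x) powr (1 - \<alpha>) - (1 - 0) powr (1 - \<alpha>))"
      using F(1,3) \<alpha> e(1) x by (intro deriv_growth_powr) auto
    also have "\<dots> \<le> 3 / (\<alpha> - 1) * (1 - ?x) powr (1 - \<alpha>)"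
      using \<alpha> F(2) by (simp add: mult_left_mono divide_right_mono)
    finally have "cmod (deriv F (\<phi> z)) \<le> 3 / (\<alpha> - 1) * (1 - ?x) powr (- (\<alpha> - 1))" using e(2) by simp
    then have "wt \<beta> z * cmod (w z) * cmod (deriv F (\<phi> z))
        \<le> wt \<beta> z * cmod (w z) * (3 / (\<alpha> - 1) * (1 - ?x) powr (- (\<alpha> - 1)))"
      by (intro mult_left_mono) auto
    also have "\<dots> = 3 / (\<alpha> - 1) * (wt \<beta> z * cmod (w z) * (1 - ?x) powr (- (\<alpha> - 1)))"
      by (simp only: mult_ac)
    also have "\<dots> \<le> 3 / (\<alpha> - 1) * (2 powr (\<alpha> - 1 + 1) * M)"
      using n0[OF _ z(1)] r(4) z x \<alpha>
      by (intro mult_left_mono boundary_bound_powr[of n0]) (auto simp: norm_mult norm_power mult_ac)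
    finally show "wt \<beta> z * cmod (w z) * cmod (deriv F (\<phi> z)) \<le> 3 / (\<alpha> - 1) * (2 powr \<alpha> * M)" by simp
  qed (use M r r1 \<alpha> in auto)
  then show ?thesis by (simp add: algebra_simps)
qed

end

section \<open>The equivalences\<close>

text \<open>Both directions of a comparison are proved by letting a real number \<open>M\<close> decrease to one side,
  which covers infinite values as well.\<close>

lemma ennreal_le_scaled:
  assumes C: "0 < C" and le: "\<And>M. 0 < M \<Longrightarrow> E < ennreal M \<Longrightarrow> L \<le> ennreal (C * M)"
  shows "L \<le> ennreal C * E"
proof (cases E)
  case (real e)
  show ?thesis
  proof (rule ennreal_le_epsilon)
    fix d :: real assume d: "0 < d"
    have "E < ennreal (e + d / C)" using real d C by (simp add: ennreal_less_iff)
    then have "L \<le> ennreal (C * (e + d / C))" using real(1) d C by (intro le) (auto simp: add_nonneg_pos)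
    also have "C * (e + d / C) = C * e + d" using C by (simp add: field_simps)
    also have "ennreal (C * e + d) = ennreal C * E + ennreal d"
      using real d C by (simp add: ennreal_plus ennreal_mult)
    finally show "L \<le> ennreal C * E + ennreal d" .
  qed
next
  case top
  then show ?thesis using C by (simp add: ennreal_mult_top)
qed

lemma comparable_onI:
  assumes C: "0 < C" "0 < D"
    and B: "\<And>p M. p \<in> P \<Longrightarrow> 0 < M \<Longrightarrow> A p < ennreal M \<Longrightarrow> B p \<le> ennreal (C * M)"
    and A: "\<And>p M. p \<in> P \<Longrightarrow> 0 < M \<Longrightarrow> B p < ennreal M \<Longrightarrow> A p \<le> ennreal (D * M)"
  shows "comparable_on P A B"
  unfolding comparable_on_def
proof (rule exI[of _ "1 / D"], intro conjI, simp add: C, rule exI[of _ C], intro conjI ballI)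
  fix p assume p: "p \<in> P"
  show "B p \<le> ennreal C * A p" by (rule ennreal_le_scaled[OF C(1) B[OF p]])
  have "A p \<le> ennreal D * B p" by (rule ennreal_le_scaled[OF C(2) A[OF p]])
  then have "ennreal (1 / D) * A p \<le> ennreal (1 / D) * (ennreal D * B p)" by (rule mult_left_mono) simp
  also have "\<dots> = B p" using C by (simp add: mult.assoc[symmetric] ennreal_mult[symmetric])
  finally show "ennreal (1 / D) * A p \<le> B p" .
qed (rule C)

lemma scaled_weighted_norm_le_iff:
  assumes "0 \<le> c" "0 \<le> M"
  shows "ennreal c * weighted_norm b h \<le> ennreal M \<longleftrightarrow> (\<forall>z\<in>\<D>. c * (wt b z * cmod (h z)) \<le> M)"
proof -
  have "ennreal c * weighted_norm b h = (SUP z\<in>\<D>. ennreal (c * (wt b z * cmod (h z))))"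
    unfolding weighted_norm_def SUP_mult_left_ennreal
    using assms by (intro SUP_cong refl) (simp add: ennreal_mult)
  then show ?thesis using assms by (simp add: SUP_le_iff ennreal_le_iff)
qed

lemma limsup_scaled_weighted_norm_le:
  assumes "\<And>n. 0 \<le> c n" "0 \<le> M"
    and "\<forall>\<^sub>F n in sequentially. \<forall>z\<in>\<D>. c n * (wt b z * cmod (h n z)) \<le> M"
  shows "limsup (\<lambda>n. ennreal (c n) * weighted_norm b (h n)) \<le> ennreal M"
  by (rule Limsup_bounded) (use assms(3) in \<open>eventually_elim, simp only: scaled_weighted_norm_le_iff[OF assms(1,2)]\<close>)

lemma limsup_scaled_weighted_norm_less:
  assumes "\<And>n. 0 \<le> c n" "0 \<le> M"
    and "limsup (\<lambda>n. ennreal (c n) * weighted_norm b (h n)) < ennreal M"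
  shows "\<forall>\<^sub>F n in sequentially. \<forall>z\<in>\<D>. c n * (wt b z * cmod (h n z)) \<le> M"
  using Limsup_lessD[OF assms(3)]
  by eventually_elim (metis less_imp_le scaled_weighted_norm_le_iff[OF assms(1,2)])

theorem theorem3p1:
  fixes \<alpha> \<beta> :: real
  assumes "0 < \<alpha>" and "0 < \<beta>"
  shows
    "(\<alpha> < 1 \<longrightarrow>
       comparable_on (VC_bounded_symbols \<alpha> \<beta>)
         (\<lambda>(g, \<phi>). VC_essential_norm \<alpha> \<beta> g \<phi>)
         (\<lambda>(g, \<phi>). limsup (\<lambda>n. ennreal ((real n + 1) powr \<alpha>) *
                        weighted_norm \<beta> (\<lambda>z. g z * deriv \<phi> z * \<phi> z ^ n)))) \<and>
     (\<alpha> = 1 \<longrightarrow>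
       comparable_on (VC_bounded_symbols \<alpha> \<beta>)
         (\<lambda>(g, \<phi>). VC_essential_norm \<alpha> \<beta> g \<phi>)
         (\<lambda>(g, \<phi>). max
            (limsup (\<lambda>n. ennreal (real n + 1) *
                        weighted_norm \<beta> (\<lambda>z. g z * deriv \<phi> z * \<phi> z ^ n)))
            (limsup (\<lambda>n. ennreal (ln (real n)) *
                        weighted_norm \<beta> (\<lambda>z. deriv g z * \<phi> z ^ n))))) \<and>
     (1 < \<alpha> \<longrightarrow>
       comparable_on (VC_bounded_symbols \<alpha> \<beta>)
         (\<lambda>(g, \<phi>). VC_essential_norm \<alpha> \<beta> g \<phi>)
         (\<lambda>(g, \<phi>). max
            (limsup (\<lambda>n. ennreal ((real n + 1) powr \<alpha>) *
                        weighted_norm \<beta> (\<lambda>z. g z * deriv \<phi> z * \<phi> z ^ n)))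
            (limsup (\<lambda>n. ennreal ((real n + 1) powr (\<alpha> - 1)) *
                        weighted_norm \<beta> (\<lambda>z. deriv g z * \<phi> z ^ n)))))"
proof (intro conjI impI)
  have VC: "bounded_VC \<alpha> \<beta> g \<phi>" if "(g, \<phi>) \<in> VC_bounded_symbols \<alpha> \<beta>" for g \<phi>
    using assms that by unfold_locales
  have low: "0 < lower_const \<alpha>" by (rule lower_const_pos[OF assms(1)])
  have lnn: "0 \<le> ln (real n)" for n by (cases n) auto
  {
    assume \<alpha>: "\<alpha> < 1"
    show "comparable_on (VC_bounded_symbols \<alpha> \<beta>)
         (\<lambda>(g, \<phi>). VC_essential_norm \<alpha> \<beta> g \<phi>)
         (\<lambda>(g, \<phi>). limsup (\<lambda>n. ennreal ((real n + 1) powr \<alpha>) *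
                        weighted_norm \<beta> (\<lambda>z. g z * deriv \<phi> z * \<phi> z ^ n)))"
    proof (rule comparable_onI[OF low, of "4 * 2 powr (\<alpha> + 1) + 1"], simp add: add_pos_pos, unfold split_paired_all prod.case)
      fix g \<phi> and M :: real assume p: "(g, \<phi>) \<in> VC_bounded_symbols \<alpha> \<beta>" and M: "0 < M"
      interpret bounded_VC \<alpha> \<beta> g \<phi> by (rule VC[OF p])
      show "limsup (\<lambda>n. ennreal ((real n + 1) powr \<alpha>) * weighted_norm \<beta> (\<lambda>z. u z * \<phi> z ^ n))
          \<le> ennreal (lower_const \<alpha> * M)" if E: "VC_essential_norm \<alpha> \<beta> g \<phi> < ennreal M"
        using low M by (intro limsup_scaled_weighted_norm_le essential_norm_lower_powers(1)[OF E M]) auto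
      show "VC_essential_norm \<alpha> \<beta> g \<phi> \<le> ennreal ((4 * 2 powr (\<alpha> + 1) + 1) * M)"
        if "limsup (\<lambda>n. ennreal ((real n + 1) powr \<alpha>) * weighted_norm \<beta> (\<lambda>z. u z * \<phi> z ^ n)) < ennreal M"
        using M that by (intro essential_norm_upper_lt_1[OF \<alpha> M] limsup_scaled_weighted_norm_less) auto
    qed
  next
    assume \<alpha>: "\<alpha> = 1"
    show "comparable_on (VC_bounded_symbols \<alpha> \<beta>)
         (\<lambda>(g, \<phi>). VC_essential_norm \<alpha> \<beta> g \<phi>)
         (\<lambda>(g, \<phi>). max
            (limsup (\<lambda>n. ennreal (real n + 1) *
                        weighted_norm \<beta> (\<lambda>z. g z * deriv \<phi> z * \<phi> z ^ n)))
            (limsup (\<lambda>n. ennreal (ln (real n)) *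
                        weighted_norm \<beta> (\<lambda>z. deriv g z * \<phi> z ^ n))))"
    proof (rule comparable_onI[of "max (lower_const \<alpha>) log_const" "4 * 2 powr (\<alpha> + 1) + 12"],
        simp add: less_max_iff_disj low, simp add: add_pos_pos, unfold split_paired_all prod.case)
      fix g \<phi> and M :: real assume p: "(g, \<phi>) \<in> VC_bounded_symbols \<alpha> \<beta>" and M: "0 < M"
      interpret bounded_VC \<alpha> \<beta> g \<phi> by (rule VC[OF p])
      have one: "(real n + 1) powr \<alpha> = real n + 1" for n using \<alpha> by simp
      show "max (limsup (\<lambda>n. ennreal (real n + 1) * weighted_norm \<beta> (\<lambda>z. u z * \<phi> z ^ n)))
            (limsup (\<lambda>n. ennreal (ln (real n)) * weighted_norm \<beta> (\<lambda>z. w z * \<phi> z ^ n)))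
          \<le> ennreal (max (lower_const \<alpha>) log_const * M)" if E: "VC_essential_norm \<alpha> \<beta> g \<phi> < ennreal M"
      proof (rule max.boundedI)
        have "limsup (\<lambda>n. ennreal (real n + 1) * weighted_norm \<beta> (\<lambda>z. u z * \<phi> z ^ n)) \<le> ennreal (lower_const \<alpha> * M)"
          using low M essential_norm_lower_powers(1)[OF E M] unfolding one
          by (intro limsup_scaled_weighted_norm_le) auto
        also have "\<dots> \<le> ennreal (max (lower_const \<alpha>) log_const * M)"
          using M by (intro ennreal_leI mult_right_mono) auto
        finally show "limsup (\<lambda>n. ennreal (real n + 1) * weighted_norm \<beta> (\<lambda>z. u z * \<phi> z ^ n))
          \<le> ennreal (max (lower_const \<alpha>) log_const * M)" .
        have "limsup (\<lambda>n. ennreal (ln (real n)) * weighted_norm \<beta> (\<lambda>z. w z * \<phi> z ^ n)) \<le> ennreal (log_const * M)"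
          using log_const_pos M lnn by (intro limsup_scaled_weighted_norm_le essential_norm_lower_log[OF \<alpha> E M]) auto
        also have "\<dots> \<le> ennreal (max (lower_const \<alpha>) log_const * M)"
          using M by (intro ennreal_leI mult_right_mono) auto
        finally show "limsup (\<lambda>n. ennreal (ln (real n)) * weighted_norm \<beta> (\<lambda>z. w z * \<phi> z ^ n))
          \<le> ennreal (max (lower_const \<alpha>) log_const * M)" .
      qed
      show "VC_essential_norm \<alpha> \<beta> g \<phi> \<le> ennreal ((4 * 2 powr (\<alpha> + 1) + 12) * M)"
        if L: "max (limsup (\<lambda>n. ennreal (real n + 1) * weighted_norm \<beta> (\<lambda>z. u z * \<phi> z ^ n)))
            (limsup (\<lambda>n. ennreal (ln (real n)) * weighted_norm \<beta> (\<lambda>z. w z * \<phi> z ^ n))) < ennreal M"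
      proof (rule essential_norm_upper_eq_1[OF \<alpha> M])
        show "\<forall>\<^sub>F n in sequentially. \<forall>z\<in>\<D>. (real n + 1) powr \<alpha> * (wt \<beta> z * cmod (u z * \<phi> z ^ n)) \<le> M"
          using L M unfolding one by (intro limsup_scaled_weighted_norm_less) auto
        show "\<forall>\<^sub>F n in sequentially. \<forall>z\<in>\<D>. ln (real n) * (wt \<beta> z * cmod (w z * \<phi> z ^ n)) \<le> M"
          using L M lnn by (intro limsup_scaled_weighted_norm_less) auto
      qed
    qed
  next
    assume \<alpha>: "1 < \<alpha>"
    show "comparable_on (VC_bounded_symbols \<alpha> \<beta>)
         (\<lambda>(g, \<phi>). VC_essential_norm \<alpha> \<beta> g \<phi>)
         (\<lambda>(g, \<phi>). max
            (limsup (\<lambda>n. ennreal ((real n + 1) powr \<alpha>) *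
                        weighted_norm \<beta> (\<lambda>z. g z * deriv \<phi> z * \<phi> z ^ n)))
            (limsup (\<lambda>n. ennreal ((real n + 1) powr (\<alpha> - 1)) *
                        weighted_norm \<beta> (\<lambda>z. deriv g z * \<phi> z ^ n))))"
    proof (rule comparable_onI[OF low, of "4 * 2 powr (\<alpha> + 1) + 3 / (\<alpha> - 1) * 2 powr \<alpha>"],
        simp add: \<alpha> add_pos_pos, unfold split_paired_all prod.case)
      fix g \<phi> and M :: real assume p: "(g, \<phi>) \<in> VC_bounded_symbols \<alpha> \<beta>" and M: "0 < M"
      interpret bounded_VC \<alpha> \<beta> g \<phi> by (rule VC[OF p])
      show "max (limsup (\<lambda>n. ennreal ((real n + 1) powr \<alpha>) * weighted_norm \<beta> (\<lambda>z. u z * \<phi> z ^ n)))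
            (limsup (\<lambda>n. ennreal ((real n + 1) powr (\<alpha> - 1)) * weighted_norm \<beta> (\<lambda>z. w z * \<phi> z ^ n)))
          \<le> ennreal (lower_const \<alpha> * M)" if E: "VC_essential_norm \<alpha> \<beta> g \<phi> < ennreal M"
        using low M \<alpha>
        by (intro max.boundedI limsup_scaled_weighted_norm_le essential_norm_lower_powers[OF E M]) auto
      show "VC_essential_norm \<alpha> \<beta> g \<phi> \<le> ennreal ((4 * 2 powr (\<alpha> + 1) + 3 / (\<alpha> - 1) * 2 powr \<alpha>) * M)"
        if L: "max (limsup (\<lambda>n. ennreal ((real n + 1) powr \<alpha>) * weighted_norm \<beta> (\<lambda>z. u z * \<phi> z ^ n)))
            (limsup (\<lambda>n. ennreal ((real n + 1) powr (\<alpha> - 1)) * weighted_norm \<beta> (\<lambda>z. w z * \<phi> z ^ n))) < ennreal M"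
        using L M by (intro essential_norm_upper_gt_1[OF \<alpha> M] limsup_scaled_weighted_norm_less) auto
    qed
  }
qed

end
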